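(* (Non-circular case.) Let $\Gamma$ and $\Gamma'$ be non-circular standard weighted graphs that are birationally equivalent. Then, up to isomorphism of weighted graphs, $\Gamma'$ is obtained from $\Gamma$ by reversions of some of its linear segments and by changing the (integer) weights of its branching vertices. In other words, a non-circular standard weighted graph is unique in its birational equivalence class up to reversions of its linear segments and changing the weights of its branching vertices. (Circular case.) Let $\Gamma$ and $\Gamma'$ be circular standard weighted graphs that are birationally equivalent. Then $\Gamma'$ is obtained from $\Gamma$, up to isomorphism, by a cyclic permutation of the nonzero weights and reversion. In other words, a circular standard graph is unique in its birational equivalence class up to a cyclic permutation of its nonzero weights and reversion.
   Context: Weighted graphs. A weighted graph is a finite nonempty graph (multiple edges and loops allowed) with an integer weight attached to each vertex. The degree of a vertex is the number of edge-ends at it (a loop counts twice). A vertex of degree $\ge 3$ is a branching vertex (branching point); $B=B(\Gamma)$ is the set of branching vertices. Isomorphisms of weighted graphs are graph isomorphisms preserving weights. Birational equivalence. An outer blowup at a vertex $v$ adds a new vertex of weight $-1$ joined by one edge to $v$ and lowers the weight of $v$ by $1$. An inner blowup at an edge $e$ joining $u$ and $v$ replaces $e$ by a new vertex of weight $-1$ joined by one edge to $u$ and by one edge to $v$, and lowers the weights of $u$ and $v$ by $1$ each if $u\ne v$ (if $e$ is a loop at $u=v$, the new vertex is joined to $u$ by two edges and the weight of $u$ is lowered by $4$). A blowdown is the inverse of a blowup; thus it contracts a vertex of weight $-1$ and degree $1$ or $2$. A birational transformation is a finite sequence of blowups and blowdowns (and isomorphisms); two weighted graphs are birationally equivalent if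 there is a birational transformation between them. Linear and circular graphs. $[[w_1,\dots,w_n]]$ denotes the linear weighted graph (chain) with consecutive weights $w_1,\dots,w_n$, and $((w_1,\dots,w_n))$ the circular weighted graph (cycle) with cyclically consecutive weights $w_1,\dots,w_n$ (for $n=1$ one vertex with a loop, for $n=2$ two vertices joined by two edges). $0_m$ stands for a string of $m$ zero weights. A connected weighted graph is circular if it is of the form $((w_1,\dots,w_n))$, and non-circular otherwise. Segments. For a connected non-circular $\Gamma$, let $\Gamma\ominus B$ be the graph obtained by deleting the branching vertices and all edges incident to them. Its connected components are chains, called the (linear) segments of $\Gamma$. (If $B=\emptyset$, then $\Gamma$ itself is a chain and is its only segment.) Standard graphs. A chain is standard if, read in one of the two directions, it is $[[0_{2k},w_1,\dots,w_n]]$ with $k,n\ge 0$ and all $w_i\le -2$, or $[[0_{2k+1}]]$ with $k\ge 0$. A circular graph is standard if it is one of $((0_{2k},w_1,\dots,w_n))$, $((0_l,w))$, $((0_{2k},-1,-1))$ with $k,l\ge 0$, $n>0$, $w\le 0$ and all $w_i\le -2$. A non-circular weighted graph is standard if it is connected and all its segments are standard. Standard graphs are always assumed connected. Reversion. Let $L$ be a standard linear segment of $\Gamma$ with consecutive vertices $v_1,\dots,v_m$ having weights $(0_{2k},w_1,\dots,w_n)$ with all $w_i\le -2$. The reversion of $L$ replaces these weights by $(w_1,\dots,w_n,0_{2k})$ on $v_1,\dots,v_m$ (as an abstract chain this is $[[0_{2k},w_n,\dots,w_1]]$), leaving the underlying graph and the weights of all other vertices unchanged; the inverse operation is also called reversion.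 For $L=[[0_{2k+1}]]$ the reversion changes nothing. For a circular graph, a cyclic permutation of the nonzero weights replaces $((0_{m},w_1,\dots,w_n))$ (with all $w_i\neq 0$) by $((0_{m},w_{i+1},\dots,w_n,w_1,\dots,w_i))$ for some $i$, and the reversion replaces it by $((0_{m},w_n,\dots,w_1))$. *)

theory Defs
  imports "HOL-Library.Multiset" "HOL-Library.Uprod"
begin

section \<open>Weighted graphs\<close>

text \<open>
  Edges form a multiset of unordered pairs: parallel edges are multiplicities, and
  \<open>Upair v v\<close> is a loop at \<open>v\<close>. Values of the weight function outside the vertex set are
  irrelevant, so graphs are always compared by the isomorphism relation below.
\<close>

record 'v wgraph =
  verts :: "'v set"
  edges :: "'v uprod multiset"
  weight :: "'v \<Rightarrow> int"

definition wgraph :: "'v wgraph \<Rightarrow> bool" where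
  "wgraph G \<longleftrightarrow>
     finite (verts G) \<and> verts G \<noteq> {} \<and> (\<forall>e \<in># edges G. set_uprod e \<subseteq> verts G)"

definition vertex_degree :: "'v wgraph \<Rightarrow> 'v \<Rightarrow> nat" where
  "vertex_degree G v =
     size {#e \<in># edges G. v \<in> set_uprod e#} + count (edges G) (Upair v v)"
  \<comment> \<open>the second summand counts the other end of each loop\<close>

definition branching :: "'v wgraph \<Rightarrow> 'v set" where
  "branching G = {v \<in> verts G. 3 \<le> vertex_degree G v}"

definition wgraph_iso :: "'v wgraph \<Rightarrow> 'w wgraph \<Rightarrow> bool"  (infix "\<cong>\<^sub>w" 50) where
  "G \<cong>\<^sub>w H \<longleftrightarrow> wgraph G \<and> wgraph H \<and>
     (\<exists>f. bij_betw f (verts G) (verts H) \<and>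
          image_mset (map_uprod f) (edges G) = edges H \<and>
          (\<forall>v \<in> verts G. weight H (f v) = weight G v))"

definition adjacency :: "'v wgraph \<Rightarrow> ('v \<times> 'v) set" where
  "adjacency G = {(u, v). Upair u v \<in># edges G}"

definition connected_wgraph :: "'v wgraph \<Rightarrow> bool" where
  "connected_wgraph G \<longleftrightarrow>
     wgraph G \<and> (\<forall>u \<in> verts G. \<forall>v \<in> verts G. (u, v) \<in> (adjacency G)\<^sup>*)"

definition induced_wgraph :: "'v wgraph \<Rightarrow> 'v set \<Rightarrow> 'v wgraph" where
  "induced_wgraph G S = \<lparr>verts = verts G \<inter> S,
                  edges = {#e \<in># edges G. set_uprod e \<subseteq> S#},
                  weight = weight G\<rparr>"

definition wgraph_components :: "'v wgraph \<Rightarrow> 'v wgraph set" where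
  "wgraph_components G = (\<lambda>u. induced_wgraph G ((adjacency G)\<^sup>* `` {u})) ` verts G"


section \<open>Birational equivalence\<close>

inductive blowup :: "'v wgraph \<Rightarrow> 'v wgraph \<Rightarrow> bool" where
  outer: "blowup G
    \<lparr>verts = insert x (verts G),
     edges = edges G + {#Upair v x#},
     weight = (weight G)(x := -1, v := weight G v - 1)\<rparr>"
  if "wgraph G" "v \<in> verts G" "x \<notin> verts G"
| inner: "blowup G
    \<lparr>verts = insert x (verts G),
     edges = edges G - {#Upair u v#} + {#Upair u x, Upair x v#},
     weight = (if u = v then (weight G)(x := -1, u := weight G u - 4)
               else (weight G)(x := -1, u := weight G u - 1, v := weight G v - 1))\<rparr>"
  if "wgraph G" "Upair u v \<in># edges G" "x \<notin> verts G"

definition birational_step :: "'v wgraph \<Rightarrow> 'v wgraph \<Rightarrow> bool" where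
  "birational_step G H \<longleftrightarrow> blowup G H \<or> blowup H G \<or> G \<cong>\<^sub>w H"

text \<open>
  The transformation is carried out on isomorphic copies with natural numbers as vertices, so
  that fresh vertices are always available, whatever the vertex types of the two graphs.
\<close>

definition birationally_equivalent :: "'v wgraph \<Rightarrow> 'w wgraph \<Rightarrow> bool" where
  "birationally_equivalent G G' \<longleftrightarrow>
     (\<exists>H H' :: nat wgraph. G \<cong>\<^sub>w H \<and> birational_step\<^sup>*\<^sup>* H H' \<and> H' \<cong>\<^sub>w G')"


section \<open>Linear and circular graphs, segments\<close>

definition path_edges :: "'v list \<Rightarrow> 'v uprod multiset" where
  "path_edges vs = mset (map2 Upair vs (tl vs))"

definition cycle_edges :: "'v list \<Rightarrow> 'v uprod multiset" where
  "cycle_edges vs = mset (map2 Upair vs (rotate1 vs))"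

definition linear_wgraph :: "int list \<Rightarrow> nat wgraph" where
  "linear_wgraph ws = \<lparr>verts = {..<length ws}, edges = path_edges [0..<length ws],
                weight = (\<lambda>i. ws ! i)\<rparr>"

definition circular_wgraph :: "int list \<Rightarrow> nat wgraph" where
  "circular_wgraph ws = \<lparr>verts = {..<length ws}, edges = cycle_edges [0..<length ws],
                  weight = (\<lambda>i. ws ! i)\<rparr>"

definition is_circular :: "'v wgraph \<Rightarrow> bool" where
  "is_circular G \<longleftrightarrow> (\<exists>ws. ws \<noteq> [] \<and> G \<cong>\<^sub>w circular_wgraph ws)"

definition non_circular :: "'v wgraph \<Rightarrow> bool" where
  "non_circular G \<longleftrightarrow> connected_wgraph G \<and> \<not> is_circular G"

definition segments :: "'v wgraph \<Rightarrow> 'v wgraph set" where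
  "segments G = wgraph_components (induced_wgraph G (verts G - branching G))"


section \<open>Standard graphs\<close>

abbreviation zeros :: "nat \<Rightarrow> int list" where
  "zeros m \<equiv> replicate m 0"

definition standard_chain :: "'v wgraph \<Rightarrow> bool" where
  "standard_chain L \<longleftrightarrow>
     (\<exists>k ws. (\<forall>w \<in> set ws. w \<le> -2) \<and> L \<cong>\<^sub>w linear_wgraph (zeros (2 * k) @ ws)) \<or>
     (\<exists>k. L \<cong>\<^sub>w linear_wgraph (zeros (2 * k + 1)))"

definition standard_non_circular :: "'v wgraph \<Rightarrow> bool" where
  "standard_non_circular G \<longleftrightarrow> non_circular G \<and> (\<forall>L \<in> segments G. standard_chain L)"

definition standard_circular :: "'v wgraph \<Rightarrow> bool" where
  "standard_circular G \<longleftrightarrow>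
     (\<exists>k ws. ws \<noteq> [] \<and> (\<forall>w \<in> set ws. w \<le> -2) \<and> G \<cong>\<^sub>w circular_wgraph (zeros (2 * k) @ ws)) \<or>
     (\<exists>l w. w \<le> 0 \<and> G \<cong>\<^sub>w circular_wgraph (zeros l @ [w])) \<or>
     (\<exists>k. G \<cong>\<^sub>w circular_wgraph (zeros (2 * k) @ [-1, -1]))"


section \<open>Reversions and changes of weights\<close>

definition chain_order :: "'v wgraph \<Rightarrow> 'v list \<Rightarrow> bool" where
  "chain_order L vs \<longleftrightarrow> distinct vs \<and> set vs = verts L \<and> edges L = path_edges vs"

text \<open>
  The weights \<open>(0\<^sub>2\<^sub>k, w\<^sub>1, \<dots>, w\<^sub>n)\<close> along one segment become \<open>(w\<^sub>1, \<dots>, w\<^sub>n, 0\<^sub>2\<^sub>k)\<close> on the same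
  vertices. The reversion of \<open>[[0\<^sub>2\<^sub>k\<^sub>+\<^sub>1]]\<close>, which changes nothing, is not a case of its own,
  since reversions are only used through the reflexive transitive closure.
\<close>

definition shift_zeros :: "'v wgraph \<Rightarrow> 'v wgraph \<Rightarrow> bool" where
  "shift_zeros G H \<longleftrightarrow> verts H = verts G \<and> edges H = edges G \<and>
     (\<exists>L \<in> segments G. \<exists>vs k ws. chain_order L vs \<and> (\<forall>w \<in> set ws. w \<le> -2) \<and>
        map (weight G) vs = zeros (2 * k) @ ws \<and>
        map (weight H) vs = ws @ zeros (2 * k) \<and>
        (\<forall>v \<in> verts G - verts L. weight H v = weight G v))"

definition segment_reversion :: "'v wgraph \<Rightarrow> 'v wgraph \<Rightarrow> bool" where
  "segment_reversion G H \<longleftrightarrow> shift_zeros G H \<or> shift_zeros H G"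

definition change_branching_weights :: "'v wgraph \<Rightarrow> 'v wgraph \<Rightarrow> bool" where
  "change_branching_weights G H \<longleftrightarrow> verts H = verts G \<and> edges H = edges G \<and>
     (\<forall>v \<in> verts G - branching G. weight H v = weight G v)"

definition cyclic_permutation :: "'v wgraph \<Rightarrow> 'w wgraph \<Rightarrow> bool" where
  "cyclic_permutation G H \<longleftrightarrow> (\<exists>m ws i. (\<forall>w \<in> set ws. w \<noteq> 0) \<and>
     G \<cong>\<^sub>w circular_wgraph (zeros m @ ws) \<and> H \<cong>\<^sub>w circular_wgraph (zeros m @ rotate i ws))"

definition circular_reversion :: "'v wgraph \<Rightarrow> 'w wgraph \<Rightarrow> bool" where
  "circular_reversion G H \<longleftrightarrow> (\<exists>m ws. (\<forall>w \<in> set ws. w \<noteq> 0) \<and>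
     G \<cong>\<^sub>w circular_wgraph (zeros m @ ws) \<and> H \<cong>\<^sub>w circular_wgraph (zeros m @ rev ws))"

end

theory Submission
  imports Defs Complex_Main
begin

text \<open>
  Attach to a chain of weights $w_1,\dots,w_n$ the product
  $S\,T^{w_1} S \cdots T^{w_n} S$ in $SL_2(\mathbb{Z}) \times \mathbb{Z}$ (which contains the
  braid group on three strands), where $S\,T^{-1} S = T\,S\,T$. This relation is exactly an inner
  blowup, once changes of the weights of the end vertices are identified with multiplication by
  powers of $T$. Hence a weighted graph becomes a graph with labelled edges, in which vertices of
  valence 2 can be merged into the edges and branches with label in
  $\langle T\rangle S \langle T\rangle$ (the ones created by outer blowups) can be pruned. This
  rewriting is confluent up to gauge equivalence, so its normal form is a birational invariant.
  A standard graph with a branching vertex becomes irreducible once its segments are merged, and a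
  standard segment is recovered, up to reversion, from its double coset modulo
  $\langle T\rangle$, by Hirzebruch--Jung continued fractions. A circular graph ends in a single
  loop whose label is determined up to conjugation. Conjugacy of the products of the
  hyperbolic and parabolic words is decided by the lattice vectors $v_i$ with
  $v_{i-1} + v_{i+1} = a_i v_i$, which form the Hilbert basis of a cone intrinsic to the matrix.
\<close>

section \<open>The group of labels\<close>

text \<open>In SL_2(Z) alone S^4 = 1, so the length of a string of zeros would be visible only
  modulo 4. The integer component repairs this: S^2 stays central but gets infinite order, and its
  power counts pairs of zeros. Centrality accounts for reversion, since pairs of zeros may stand at
  either end of a segment. It also accounts for the loss of the weights of branching vertices: an
  odd string of zeros has a central label, so a twist passes through it from one end to the other.

  The obstacle is that a graph reducing to a single node of valence 2 has no unique normal form up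
  to gauge equivalence. Which vertex survives depends on the order of the steps; only the value of
  the chain or cycle, up to its ends or its starting point and up to direction, is well defined.
  Confluence is therefore used through predicates on irreducible graphs: gauge equivalence to a
  fixed graph, or a fixed value of a chain or of a cycle. Connectedness enters because such a
  collapse then involves the whole graph.\<close>

text \<open>\<open>Label a b c d n\<close> is the matrix \<open>(a b; c d)\<close> together with an integer; only labels of
  determinant 1 matter. Below, \<open>twist w\<close> is $T^w$ and \<open>turn\<close> is $S$.\<close>

datatype label = Label int int int int int

instantiation label :: monoid_mult
begin

definition one_label :: label where "one_label = Label 1 0 0 1 0"

fun times_label :: "label \<Rightarrow> label \<Rightarrow> label" where
  "times_label (Label a b c d m) (Label a' b' c' d' n) =
     Label (a * a' + b * c') (a * b' + b * d') (c * a' + d * c') (c * b' + d * d') (m + n)"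

instance
proof
  fix x y z :: label
  show "x * y * z = x * (y * z)"
    by (cases x; cases y; cases z) (simp add: algebra_simps)
  show "1 * x = x" "x * 1 = x"
    by (cases x; simp add: one_label_def)+
qed

end

fun label_det :: "label \<Rightarrow> int" where
  "label_det (Label a b c d n) = a * d - b * c"

fun label_inverse :: "label \<Rightarrow> label" where
  "label_inverse (Label a b c d n) = Label d (-b) (-c) a (-n)"

text \<open>The anti-automorphism fixing \<open>twist w\<close> and \<open>turn\<close>, which reads a chain backwards.\<close>

fun reversal :: "label \<Rightarrow> label" where
  "reversal (Label a b c d n) = Label d b c a n"

definition twist :: "int \<Rightarrow> label" where "twist w = Label 1 w 0 1 w"

definition turn :: label where "turn = Label 0 1 (-1) 0 3"

lemma label_det_mult [simp]: "label_det (x * y) = label_det x * label_det y"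
  by (cases x; cases y) (simp add: algebra_simps)

lemma label_det_twist [simp]: "label_det (twist w) = 1" and label_det_turn [simp]: "label_det turn = 1" and label_det_1 [simp]: "label_det 1 = 1"
  by (simp_all add: twist_def turn_def one_label_def)

lemma label_inverse_mult: "label_det x = 1 \<Longrightarrow> label_inverse x * x = 1" "label_det x = 1 \<Longrightarrow> x * label_inverse x = 1"
  by (cases x; simp add: one_label_def algebra_simps)+

lemma label_det_label_inverse [simp]: "label_det (label_inverse x) = label_det x"
  by (cases x) (simp add: algebra_simps)

lemma label_det_reversal [simp]: "label_det (reversal x) = label_det x"
  by (cases x) (simp add: algebra_simps)

lemma reversal_mult [simp]: "reversal (x * y) = reversal y * reversal x"
  by (cases x; cases y) (simp add: algebra_simps)

lemma reversal_reversal [simp]: "reversal (reversal x) = x" by (cases x) simp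

lemma reversal_twist [simp]: "reversal (twist w) = twist w" and reversal_turn [simp]: "reversal turn = turn" and reversal_1 [simp]: "reversal 1 = 1"
  by (simp_all add: twist_def turn_def one_label_def)

lemma twist_0 [simp]: "twist 0 = 1" by (simp add: twist_def one_label_def)

lemma twist_twist: "twist i * twist j = twist (i + j)" by (simp add: twist_def)

lemma twist_twist_left: "twist i * (twist j * x) = twist (i + j) * x"
  by (simp add: twist_twist mult.assoc[symmetric])

text \<open>With T of exponent 1, comparing the integer components on both sides gives 2s - 1 = s +
  2 for the exponent s of \<open>turn\<close>. This is where the 3 in its definition comes
  from.\<close>

lemma turn_blowup: "turn * twist (-1) * turn = twist 1 * turn * twist 1"
  by (simp add: turn_def twist_def)

lemma twist_turn_twist_inject: "twist i * turn * twist j = twist i' * turn * twist j' \<longleftrightarrow> i = i' \<and> j = j'"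
  by (auto simp: turn_def twist_def)

section \<open>Values of chains\<close>

text \<open>There is one turn more than there are weights: the chain is valued together with the
  connection at each of its two ends. A bare edge is thus the empty chain, of value
  \<open>turn\<close>.\<close>

fun chain_value :: "int list \<Rightarrow> label" where
  "chain_value [] = turn"
| "chain_value (w # ws) = turn * twist w * chain_value ws"

lemma chain_value_append: "chain_value (xs @ w # ys) = chain_value xs * twist w * chain_value ys"
  by (induction xs) (simp_all add: mult.assoc)

lemma reversal_chain_value: "reversal (chain_value ws) = chain_value (rev ws)"
  by (induction ws) (simp_all add: chain_value_append mult.assoc)

lemma label_det_chain_value [simp]: "label_det (chain_value ws) = 1"
  by (induction ws) simp_all

text \<open>This is S^(2k), the contribution of 2k zeros. The sign determines k only modulo 2; the
  exponent 6k determines it completely.\<close>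

definition centre :: "nat \<Rightarrow> label" where "centre k = Label ((-1) ^ k) 0 0 ((-1) ^ k) (6 * int k)"

lemma centre_central: "centre k * x = x * centre k"
  by (cases x) (simp add: centre_def algebra_simps)

lemma centre_Suc: "centre (Suc k) = turn * turn * centre k"
  by (simp add: centre_def turn_def)

lemma centre_0 [simp]: "centre 0 = 1" by (simp add: centre_def one_label_def)

lemma chain_value_zeros: "chain_value (zeros (2 * k) @ us) = centre k * chain_value us"
proof (induction k)
  case (Suc k)
  have "zeros (2 * Suc k) @ us = 0 # 0 # (zeros (2 * k) @ us)" by simp
  then show ?case using Suc by (simp add: centre_Suc mult.assoc)
qed simp

lemma reversal_centre [simp]: "reversal (centre k) = centre k" by (simp add: centre_def)

lemma chain_value_zeros_right: "chain_value (us @ zeros (2 * k)) = centre k * chain_value us"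
proof -
  have "chain_value (us @ zeros (2 * k)) = reversal (chain_value (zeros (2 * k) @ rev us))"
    by (simp add: reversal_chain_value)
  also have "\<dots> = centre k * chain_value us"
    by (simp add: chain_value_zeros reversal_chain_value centre_central)
  finally show ?thesis .
qed

text \<open>An odd string of zeros has an even number of turns, so its value is central, in contrast
  to all other standard chains.\<close>

lemma chain_value_odd_zeros: "chain_value (zeros (2 * k + 1)) = centre (Suc k)"
proof -
  have "chain_value (zeros (2 * k) @ [0]) = centre k * (turn * turn)"
    by (subst chain_value_zeros) simp
  then show ?thesis by (simp add: centre_Suc centre_central replicate_append_same)
qed

text \<open>The fraction \<open>c / e\<close> is the Hirzebruch--Jung continued fraction of the negated weights.\<close>

lemma chain_value_column:
  assumes "\<forall>w\<in>set us. w \<le> -2"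
  shows "\<exists>e c q s n. chain_value us = Label (- e) q (- c) s n \<and> 0 \<le> e \<and> e < c"
  using assms
proof (induction us)
  case Nil
  then show ?case by (auto simp: turn_def intro!: exI[of _ 0] exI[of _ 1])
next
  case (Cons w us)
  then obtain e c q s n where h: "chain_value us = Label (- e) q (- c) s n" "0 \<le> e" "e < c" by auto
  have "w \<le> -2" using Cons by simp
  then have "c * (w + 2) \<le> 0" using h by (simp add: mult_nonneg_nonpos)
  then have "c < - w * c - e" using h by (simp add: algebra_simps)
  moreover have "chain_value (w # us) = Label (- c) s (- (- w * c - e)) (- q - w * s) (6 + w + n - 3)"
    using h by (simp add: turn_def twist_def algebra_simps)
  ultimately show ?case using h(2,3) by fastforce
qed

text \<open>The recursion on the first column is Euclidean division: the first weight is a quotient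
  and the column of the tail supplies divisor and remainder. Uniqueness of division with remainder
  peels off one weight at a time.\<close>

lemma chain_value_column_inj:
  assumes "\<forall>w\<in>set us. w \<le> -2" "\<forall>w\<in>set us'. w \<le> -2"
    and "chain_value us = Label e q c s n" "chain_value us' = Label e q' c s' n'"
  shows "us = us'"
  using assms
proof (induction us arbitrary: us' e c q s n q' s' n')
  case Nil
  show ?case
  proof (cases us')
    case (Cons w ws)
    obtain e0 c0 q0 s0 n0 where h: "chain_value ws = Label (- e0) q0 (- c0) s0 n0" "0 \<le> e0" "e0 < c0"
      using chain_value_column[of ws] Nil Cons by auto
    show ?thesis using Nil Cons h by (auto simp: turn_def twist_def)
  qed simp
next
  case (Cons w ws)
  obtain e0 c0 q0 s0 n0 where h: "chain_value ws = Label (- e0) q0 (- c0) s0 n0" "0 \<le> e0" "e0 < c0"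
    using chain_value_column[of ws] Cons.prems by auto
  show ?case
  proof (cases us')
    case Nil
    then show ?thesis using Cons.prems h by (auto simp: turn_def twist_def)
  next
    case u: (Cons w' ws')
    obtain e1 c1 q1 s1 n1 where h': "chain_value ws' = Label (- e1) q1 (- c1) s1 n1" "0 \<le> e1" "e1 < c1"
      using chain_value_column[of ws'] Cons.prems u by auto
    have c: "c1 = c0" and e: "w * c0 + e0 = w' * c1 + e1"
      using Cons.prems u h h' by (auto simp: turn_def twist_def)
    \<comment> \<open>Two remainders in the interval from 0 to \<open>c0\<close> differ by less than
      \<open>c0\<close>, so the quotients agree.\<close>
    have "(w - w') * c0 = e1 - e0" using c e by (simp add: algebra_simps)
    moreover have "\<bar>e1 - e0\<bar> < c0" using h h' c by auto
    ultimately have "\<bar>w - w'\<bar> * c0 < 1 * c0" using h(2,3) by (metis abs_mult abs_of_nonneg le_less_trans less_imp_le mult_1)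
    then have "w = w'" using h(2,3) by (simp add: mult_less_cancel_right)
    moreover have "e0 = e1" using e c calculation by simp
    ultimately show ?thesis
      using Cons.IH[of ws'] Cons.prems u h(1) h'(1) c by auto
  qed
qed

section \<open>Double cosets of standard chains\<close>

definition std_list :: "int list \<Rightarrow> bool" where
  "std_list ws \<longleftrightarrow>
     (\<exists>k us. (\<forall>w\<in>set us. w \<le> -2) \<and> (ws = zeros (2 * k) @ us \<or> ws = us @ zeros (2 * k))) \<or>
     (\<exists>k. ws = zeros (2 * k + 1))"

text \<open>Reversion on fixed vertices: the zeros change ends while the other weights keep their
  order. Zeros are allowed at either end on both sides, because the direction in which a segment is
  read is not under control.\<close>

definition shift_equiv :: "int list \<Rightarrow> int list \<Rightarrow> bool" where
  "shift_equiv A B \<longleftrightarrow> A = B \<or>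
     (\<exists>k us. (\<forall>w\<in>set us. w \<le> -2) \<and>
        (A = zeros (2 * k) @ us \<or> A = us @ zeros (2 * k)) \<and>
        (B = zeros (2 * k) @ us \<or> B = us @ zeros (2 * k)))"

text \<open>A left twist by i adds i * c to the entry e of the first column, and 0 \<le> e < c
  leaves only i = 0. The column then determines the weights, the lower right entry forces j = 0, and
  the integer component gives k.\<close>

lemma even_parts_unique:
  assumes us: "\<forall>w\<in>set us. w \<le> -2" and us': "\<forall>w\<in>set us'. w \<le> -2"
    and eq: "centre k' * chain_value us' = twist i * (centre k * chain_value us) * twist j"
  shows "k' = k \<and> us' = us"
proof -
  obtain e c q s n where h: "chain_value us = Label (- e) q (- c) s n" "0 \<le> e" "e < c"
    using chain_value_column[OF us] by auto
  obtain e' c' q' s' n' where h': "chain_value us' = Label (- e') q' (- c') s' n'" "0 \<le> e'" "e' < c'"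
    using chain_value_column[OF us'] by auto
  let ?x = "(-1) ^ k :: int" and ?y = "(-1) ^ k' :: int"
  have xy: "?x = 1 \<or> ?x = -1" "?y = 1 \<or> ?y = -1"
    by (cases "even k"; simp) (cases "even k'"; simp)
  have eqs: "?y * e' = ?x * e + i * (?x * c)" "?y * c' = ?x * c"
       "?y * s' = - (?x * c) * j + ?x * s" "6 * int k' + n' = i + 6 * int k + n + j"
    using eq h(1) h'(1) by (auto simp: centre_def twist_def algebra_simps)
  \<comment> \<open>Both c and c' are positive, so their equality up to sign also identifies the
    signs of the central factors.\<close>
  have sg: "?x = ?y" and cc: "c' = c"
    using eqs(2) xy h(2,3) h'(2,3) by auto
  have "e' = e + i * c" using eqs(1) sg xy by auto
  then have "\<bar>i\<bar> * c = \<bar>e' - e\<bar>" using h(2,3) by (simp add: abs_mult)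
  also have "\<dots> < 1 * c" using h h' cc by auto
  finally have i: "i = 0" using h(2,3) by (simp add: mult_less_cancel_right)
  then have ee: "e' = e" using \<open>e' = e + i * c\<close> by simp
  have us_eq: "us' = us"
    using chain_value_column_inj[OF us' us] h(1) h'(1) ee cc by simp
  then have "s' = s" "n' = n" using h(1) h'(1) by auto
  then have "j = 0" using eqs(3) sg xy h(2,3) by auto
  then have "k' = k" using eqs(4) i \<open>n' = n\<close> by simp
  then show ?thesis using us_eq by simp
qed

text \<open>Twists on either side do not touch the lower left entry. It vanishes for a central label
  and is nonzero for a list of weights at most -2.\<close>

lemma even_odd_distinct:
  assumes us: "\<forall>w\<in>set us. w \<le> -2"
  shows "centre k' \<noteq> twist i * (centre k * chain_value us) * twist j" "centre k' * chain_value us \<noteq> twist i * centre k * twist j"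
proof -
  obtain e c q s n where h: "chain_value us = Label (- e) q (- c) s n" "0 \<le> e" "e < c"
    using chain_value_column[OF us] by auto
  then show "centre k' \<noteq> twist i * (centre k * chain_value us) * twist j" "centre k' * chain_value us \<noteq> twist i * centre k * twist j"
    by (auto simp: centre_def twist_def)
qed

lemma odd_parts_unique:
  assumes "centre k' = twist i * centre k * twist j"
  shows "k' = k"
proof -
  let ?x = "(-1) ^ k :: int" and ?y = "(-1) ^ k' :: int"
  have "?y = ?x" "0 = ?x * j + i * ?x" "6 * int k' = i + 6 * int k + j"
    using assms by (auto simp: centre_def twist_def)
  moreover have "?x = 1 \<or> ?x = -1" by (cases "even k"; simp)
  ultimately show ?thesis by auto
qed

lemma std_list_cases:
  assumes "std_list A"
  obtains k us where "\<forall>w\<in>set us. w \<le> -2" "A = zeros (2 * k) @ us \<or> A = us @ zeros (2 * k)"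
      "chain_value A = centre k * chain_value us"
  | k where "A = zeros (2 * k + 1)" "chain_value A = centre (Suc k)"
  using assms unfolding std_list_def
  by (metis chain_value_zeros chain_value_zeros_right chain_value_odd_zeros)

theorem chain_value_determines:
  assumes "std_list A" "std_list B" "chain_value B = twist i * chain_value A * twist j"
  shows "shift_equiv A B"
proof (rule std_list_cases[OF assms(1)]; rule std_list_cases[OF assms(2)])
  fix k us k' us'
  assume h: "\<forall>w\<in>set us. w \<le> -2" "A = zeros (2 * k) @ us \<or> A = us @ zeros (2 * k)"
    "chain_value A = centre k * chain_value us"
   "\<forall>w\<in>set us'. w \<le> -2" "B = zeros (2 * k') @ us' \<or> B = us' @ zeros (2 * k')"
    "chain_value B = centre k' * chain_value us'"
  then have "k' = k \<and> us' = us" using even_parts_unique[OF h(1,4), of k' i k j] assms(3) by metis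
  then show ?thesis using h unfolding shift_equiv_def by blast
next
  fix k us k'
  assume "\<forall>w\<in>set us. w \<le> -2" "chain_value A = centre k * chain_value us" "chain_value B = centre (Suc k')"
  then show ?thesis using even_odd_distinct assms(3) by metis
next
  fix k us k'
  assume "\<forall>w\<in>set us. w \<le> -2" "chain_value B = centre k * chain_value us" "chain_value A = centre (Suc k')"
  then show ?thesis using even_odd_distinct assms(3) by metis
next
  fix k k'
  assume "A = zeros (2 * k + 1)" "B = zeros (2 * k' + 1)"
     "chain_value A = centre (Suc k)" "chain_value B = centre (Suc k')"
  then show ?thesis using odd_parts_unique[of "Suc k'" i "Suc k" j] assms(3)
    by (simp add: shift_equiv_def)
qed

text \<open>Its purpose is to forbid pruning: a leg labelled by a nonempty standard chain is not in
  the double coset of the empty chain.\<close>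

lemma std_list_nontrivial:
  assumes "std_list A" "A \<noteq> []"
  shows "chain_value A \<noteq> twist i * turn * twist j"
proof
  assume "chain_value A = twist i * turn * twist j"
  moreover have "std_list []" by (auto simp: std_list_def intro!: exI[of _ 0])
  ultimately have "shift_equiv [] A"
    using chain_value_determines[of "[]" A i j] assms by simp
  then show False using assms(2) by (auto simp: shift_equiv_def)
qed

section \<open>Periodic second order recurrences\<close>

locale recurrence =
  fixes a :: "int \<Rightarrow> int"
  assumes a_ge_2: "2 \<le> a i"
begin

definition solution :: "(int \<Rightarrow> int) \<Rightarrow> bool" where
  "solution x \<longleftrightarrow> (\<forall>i. x (i + 1) = a i * x i - x (i - 1))"

lemma solutionD: "solution x \<Longrightarrow> x (i + 1) = a i * x i - x (i - 1)"
  unfolding solution_def by blast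

lemma solution_unique:
  assumes x: "solution x" and y: "solution y" and "x 0 = y 0" "x (-1) = y (-1)"
  shows "x i = y i"
proof -
  have "x i = y i \<and> x (i - 1) = y (i - 1)"
  proof (induction i rule: int_induct[where k = 0])
    case base
    then show ?case using assms by simp
  next
    case (step1 i)
    then show ?case using solutionD[OF x, of i] solutionD[OF y, of i] by simp
  next
    case (step2 i)
    then show ?case using solutionD[OF x, of "i - 1"] solutionD[OF y, of "i - 1"] by simp
  qed
  then show ?thesis by simp
qed

lemma solution_exists: "\<exists>x. solution x \<and> x 0 = c \<and> x (-1) = e"
proof -
  \<comment> \<open>\<open>f k\<close> carries the pair of values at k and k - 1 forwards,
    \<open>g k\<close> the pair at -1 - k and -k backwards.\<close>
  define f where "f = rec_nat (c, e) (\<lambda>k u. (a (int k) * fst u - snd u, fst u))"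
  define g where "g = rec_nat (e, c) (\<lambda>k u. (a (- 1 - int k) * fst u - snd u, fst u))"
  have f: "f 0 = (c, e)" "\<And>k. f (Suc k) = (a (int k) * fst (f k) - snd (f k), fst (f k))"
    unfolding f_def by simp_all
  have g: "g 0 = (e, c)" "\<And>k. g (Suc k) = (a (- 1 - int k) * fst (g k) - snd (g k), fst (g k))"
    unfolding g_def by simp_all
  define x where "x i = (if i \<ge> 0 then fst (f (nat i)) else fst (g (nat (- 1 - i))))" for i
  have xf: "x (int k) = fst (f k)" for k by (simp add: x_def)
  have xg: "x (- 1 - int k) = fst (g k)" for k by (simp add: x_def)
  have sf: "snd (f k) = x (int k - 1)" for k
    by (cases k) (simp_all add: f g x_def)
  have sg: "snd (g k) = x (- int k)" for k
    by (cases k) (simp_all add: f g x_def algebra_simps)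
  have "x (i + 1) = a i * x i - x (i - 1)" for i
  proof (cases "i \<ge> 0")
    case True
    then obtain k where k: "i = int k" using nonneg_int_cases by blast
    have "x (int (Suc k)) = a (int k) * x (int k) - x (int k - 1)"
      using xf[of "Suc k"] f(2)[of k] sf[of k] xf[of k] by simp
    then show ?thesis using k by (simp add: add.commute)
  next
    case False
    define k where "k = nat (- 1 - i)"
    have k: "i = - 1 - int k" using False by (simp add: k_def)
    have eq: "x (- 1 - int (Suc k)) = a (- 1 - int k) * x (- 1 - int k) - x (- int k)"
      using xg[of "Suc k"] g(2)[of k] sg[of k] xg[of k] by simp
    have e: "- 1 - int (Suc k) = i - 1" "- int k = i + 1" using k by auto
    have "x (i - 1) = a i * x i - x (i + 1)"
      using eq by (simp only: e k[symmetric])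
    then show ?thesis by simp
  qed
  then have "solution x" unfolding solution_def by blast
  moreover have "x 0 = c" "x (-1) = e" by (simp_all add: x_def f g)
  ultimately show ?thesis by blast
qed

text \<open>Coefficients at least 2 make a solution convex as long as it is nonnegative: increments
  never decrease, so a nonnegative first increment \<delta> bounds all later ones from
  below.\<close>

lemma growth_up:
  assumes x: "solution x" and "0 \<le> x (i - 1)" "0 \<le> \<delta>" "\<delta> \<le> x i - x (i - 1)"
  shows "\<delta> \<le> x (i + int n) - x (i + int n - 1) \<and> x i + int n * \<delta> \<le> x (i + int n)"
proof (induction n)
  case 0
  then show ?case using assms by simp
next
  case (Suc n)
  define j where "j = i + int n"
  have ih: "\<delta> \<le> x j - x (j - 1)" "x i + int n * \<delta> \<le> x j"
    using Suc by (simp_all add: j_def)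
  have "0 \<le> x j" using ih(2) assms(2-4) by (smt (verit) mult_nonneg_nonneg of_nat_0_le_iff)
  then have "2 * x j \<le> a j * x j" using a_ge_2[of j] by (simp add: mult_right_mono)
  then have "x j - x (j - 1) \<le> x (j + 1) - x j" using solutionD[OF x, of j] by simp
  then have "\<delta> \<le> x (j + 1) - x j" using ih by simp
  moreover have "j + 1 = i + int (Suc n)" by (simp add: j_def)
  ultimately show ?case using ih(2) by (simp add: algebra_simps j_def)
qed

lemma solution_lin:
  assumes x: "solution x" and y: "solution y"
  shows "solution (\<lambda>i. c * x i + d * y i)"
  unfolding solution_def
  by (simp only: solutionD[OF x] solutionD[OF y]) (simp add: algebra_simps)

text \<open>A positive solution is convex on all integers. Since its values are positive integers,
  it can be strictly decreasing neither all the way to the right nor all the way to the left;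
  convexity then fixes the direction far out on each side.\<close>

lemma positive_solution_shape:
  assumes x: "solution x" and pos: "\<And>i. 0 < x i"
  obtains i0 i1 where "\<And>i. i \<le> i0 \<Longrightarrow> x i \<le> x (i - 1)" "\<And>i. i1 \<le> i \<Longrightarrow> x (i - 1) \<le> x i"
proof -
  have mono1: "x i - x (i - 1) \<le> x (i + 1) - x i" for i
  proof -
    have "2 * x i \<le> a i * x i" using a_ge_2[of i] pos[of i] by (simp add: mult_right_mono)
    then show ?thesis using solutionD[OF x, of i] by simp
  qed
  have mono: "x i - x (i - 1) \<le> x (i + int n) - x (i + int n - 1)" for i n
  proof (induction n)
    case (Suc n)
    then show ?case using mono1[of "i + int n"] by (simp add: algebra_simps)
  qed simp
  have mono': "x i - x (i - 1) \<le> x j - x (j - 1)" if "i \<le> j" for i j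
    using mono[of i "nat (j - i)"] that by simp
  have ex0: "\<exists>i0. x i0 \<le> x (i0 - 1)"
  proof (rule ccontr)
    assume "\<not> ?thesis"
    then have lt: "x (i - 1) < x i" for i by (meson not_le)
    have "x (- int n) \<le> x 0 - int n" for n
    proof (induction n)
      case (Suc n)
      moreover have "x (- int (Suc n)) = x (- int n - 1)" by (rule arg_cong[where f = x]) simp
      ultimately show ?case using lt[of "- int n"] by simp
    qed simp
    from this[of "nat (x 0)"] pos[of "- int (nat (x 0))"] show False using pos[of 0] by simp
  qed
  have ex1: "\<exists>i1. x (i1 - 1) \<le> x i1"
  proof (rule ccontr)
    assume "\<not> ?thesis"
    then have lt: "x i < x (i - 1)" for i by (meson not_le)
    have "x (int n) \<le> x 0 - int n" for n
    proof (induction n)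
      case (Suc n)
      then show ?case using lt[of "int n + 1"] by (simp add: algebra_simps)
    qed simp
    from this[of "nat (x 0)"] pos[of "int (nat (x 0))"] show False using pos[of 0] by simp
  qed
  from ex0 ex1 obtain i0 i1 where "x i0 \<le> x (i0 - 1)" "x (i1 - 1) \<le> x i1" by blast
  then have "\<And>i. i \<le> i0 \<Longrightarrow> x i \<le> x (i - 1)" "\<And>i. i1 \<le> i \<Longrightarrow> x (i - 1) \<le> x i"
    using mono' by fastforce+
  then show ?thesis using that by blast
qed

end

section \<open>Reversed sequences and fans of lattice vectors\<close>

context recurrence
begin

lemma reversed: "recurrence (\<lambda>i. a (- i))" using a_ge_2 by unfold_locales

lemma solution_reversed:
  assumes "solution x" shows "recurrence.solution (\<lambda>i. a (- i)) (\<lambda>i. x (- i))"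
proof -
  interpret r: recurrence "\<lambda>i. a (- i)" by (rule reversed)
  show ?thesis unfolding r.solution_def
  proof
    fix i
    show "x (- (i + 1)) = a (- i) * x (- i) - x (- (i - 1))"
    proof -
      have e: "- (i + 1) = - i - 1" "- (i - 1) = - i + 1" by simp_all
      show ?thesis unfolding e using solutionD[OF assms, of "- i"] by linarith
    qed
  qed
qed

end

text \<open>A bi-infinite sequence of lattice vectors \<open>(p i, q i)\<close>, consecutive ones forming a basis.\<close>

locale fan = recurrence a for a :: "int \<Rightarrow> int" +
  fixes p q :: "int \<Rightarrow> int"
  assumes sol_p: "solution p" and sol_q: "solution q"
    and unimodular: "p 0 * q (-1) - q 0 * p (-1) = 1"
begin

definition fan_det :: "int \<Rightarrow> int \<Rightarrow> int" where "fan_det i j = p i * q j - q i * p j"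

lemma solution_det: "solution (\<lambda>i. p i * z2 - q i * z1)"
  using solution_lin[OF sol_p sol_q, of z2 "- z1"] by (simp add: algebra_simps)

lemma solution_fan_det: "solution (\<lambda>i. fan_det i j)"
  unfolding fan_det_def by (rule solution_det)

lemma fan_det_swap: "fan_det i j = - fan_det j i" by (simp add: fan_det_def)

lemma fan_det_step: "fan_det (i + 1) i = fan_det i (i - 1)"
  unfolding fan_det_def
  by (simp only: solutionD[OF sol_p] solutionD[OF sol_q]) (simp add: algebra_simps)

lemma fan_det_pred: "fan_det i (i - 1) = 1"
proof (induction i rule: int_induct[where k = 0])
  case base
  then show ?case using unimodular by (simp add: fan_det_def)
next
  case (step1 i)
  then show ?case using fan_det_step[of i] by simp
next
  case (step2 i)
  then show ?case using fan_det_step[of "i - 1"] by simp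
qed

lemma fan_det_Suc: "fan_det (i + 1) i = 1" using fan_det_pred[of "i + 1"] by simp

text \<open>The determinant against the vector at i is itself a solution, with values 0 at i and 1
  at i + 1, so convexity makes it grow at least linearly. Consequently determinants 0 and 1 reveal
  equal and consecutive indices.\<close>

lemma fan_det_growth: "int n \<le> fan_det (i + int n) i"
proof -
  have 0: "fan_det i i = 0" by (simp add: fan_det_def)
  have "1 + int k \<le> fan_det (i + 1 + int k) i" for k
    using growth_up[OF solution_fan_det[of i], of "i + 1" 1 k] 0 by (simp add: fan_det_Suc)
  then have "1 + int k \<le> fan_det (i + int (Suc k)) i" for k
    by (metis add.assoc of_nat_Suc)
  then show ?thesis using 0 by (cases n) auto
qed

lemma fan_det_ge: "j \<le> i \<Longrightarrow> i - j \<le> fan_det i j"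
  using fan_det_growth[of "nat (i - j)" j] by simp

lemma fan_det_eq_1_iff: "fan_det i j = 1 \<longleftrightarrow> i = j + 1"
proof
  assume "fan_det i j = 1"
  show "i = j + 1"
  proof (cases "j \<le> i")
    case True
    then have "i - j \<le> 1" using fan_det_ge \<open>fan_det i j = 1\<close> by metis
    moreover have "i \<noteq> j" using \<open>fan_det i j = 1\<close> by (auto simp: fan_det_def)
    ultimately show ?thesis using True by simp
  next
    case False
    then show ?thesis using fan_det_ge[of i j] fan_det_swap[of i j] \<open>fan_det i j = 1\<close> by simp
  qed
qed (simp add: fan_det_Suc)

lemma fan_det_eq_0_iff: "fan_det i j = 0 \<longleftrightarrow> i = j"
proof
  assume "fan_det i j = 0"
  then show "i = j" using fan_det_ge[of i j] fan_det_ge[of j i] fan_det_swap[of i j] by linarith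
qed (simp add: fan_det_def)

text \<open>Cramer's rule in the basis formed by the vectors i and i - 1.\<close>

lemma expand:
  "z1 = - (p (i - 1) * z2 - q (i - 1) * z1) * p i + (p i * z2 - q i * z1) * p (i - 1)"
  "z2 = - (p (i - 1) * z2 - q (i - 1) * z1) * q i + (p i * z2 - q i * z1) * q (i - 1)"
proof -
  have d: "p i * q (i - 1) = 1 + q i * p (i - 1)" using fan_det_pred[of i] by (simp add: fan_det_def)
  have "- (p (i - 1) * z2 - q (i - 1) * z1) * p i + (p i * z2 - q i * z1) * p (i - 1)
    = z1 * (p i * q (i - 1) - q i * p (i - 1))" by (simp add: algebra_simps)
  then show "z1 = - (p (i - 1) * z2 - q (i - 1) * z1) * p i + (p i * z2 - q i * z1) * p (i - 1)"
    using d by simp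
  have "- (p (i - 1) * z2 - q (i - 1) * z1) * q i + (p i * z2 - q i * z1) * q (i - 1)
    = z2 * (p i * q (i - 1) - q i * p (i - 1))" by (simp add: algebra_simps)
  then show "z2 = - (p (i - 1) * z2 - q (i - 1) * z1) * q i + (p i * z2 - q i * z1) * q (i - 1)"
    using d by simp
qed

text \<open>The functional with value 1 on the vectors \<open>j\<close> and \<open>j - 1\<close> restricts to a convex sequence.\<close>

lemma functional_ge_1: "1 \<le> (p j - p (j - 1)) * q k - (q j - q (j - 1)) * p k"
proof -
  define x where "x k = (p j - p (j - 1)) * q k - (q j - q (j - 1)) * p k" for k
  have x: "solution x" unfolding x_def
    using solution_lin[OF sol_p sol_q, of "- (q j - q (j - 1))" "p j - p (j - 1)"]
    by (simp add: algebra_simps)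
  have x1: "x j = 1" "x (j - 1) = 1"
    using fan_det_pred[of j] by (simp_all add: x_def fan_det_def algebra_simps)
  show ?thesis
  proof (cases "j \<le> k")
    case True
    then show ?thesis using growth_up[OF x, of j 0 "nat (k - j)"] x1 by (simp add: x_def)
  next
    case False
    interpret r: recurrence "\<lambda>i. a (- i)" by (rule reversed)
    show ?thesis
      using r.growth_up[OF solution_reversed[OF x], of "1 - j" 0 "nat (j - 1 - k)"] x1 False
      by (simp add: x_def)
  qed
qed

text \<open>The quadratic form \<open>det (z, M z)\<close>, for \<open>M = (\<alpha> \<beta>; \<gamma> \<delta>)\<close>, describes the cone of the fan
  up to sign in terms of \<open>M\<close> alone. Outside the cone, \<open>z\<close> yields a positive convex sequence, whose
  successive quotients cannot decrease along the shift by \<open>n\<close>.\<close>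

lemma negative_in_cone:
  assumes shift: "\<And>i. \<alpha> * p i + \<beta> * q i = p (i + n)" "\<And>i. \<gamma> * p i + \<delta> * q i = q (i + n)"
    and det: "\<alpha> * \<delta> - \<beta> * \<gamma> = 1" and n: "0 < n"
    and neg: "z1 * (\<gamma> * z1 + \<delta> * z2) - z2 * (\<alpha> * z1 + \<beta> * z2) < 0"
  shows "\<exists>i s c d. (s = 1 \<or> s = -1) \<and> 0 \<le> c \<and> 0 \<le> d \<and>
     z1 = s * (c * p i + d * p (i - 1)) \<and> z2 = s * (c * q i + d * q (i - 1))"
proof -
  have main: False
    if pos: "\<And>i. 0 < p i * z2 - q i * z1"
      and neg: "z1 * (\<gamma> * z1 + \<delta> * z2) - z2 * (\<alpha> * z1 + \<beta> * z2) < 0" for z1 z2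
  proof -
    define x where "x i = p i * z2 - q i * z1" for i
    have x: "solution x" unfolding x_def by (rule solution_det)
    have xpos: "0 < x i" for i using pos by (simp add: x_def)
    define w1 where "w1 = \<alpha> * z1 + \<beta> * z2"
    define w2 where "w2 = \<gamma> * z1 + \<delta> * z2"
    \<comment> \<open>The matrix preserves determinants and shifts the fan by n, so pairing the fan
      with the image of z is pairing it with z at an index lowered by n.\<close>
    have xw: "p i * w2 - q i * w1 = x (i - n)" for i
    proof -
      have "p i = \<alpha> * p (i - n) + \<beta> * q (i - n)" "q i = \<gamma> * p (i - n) + \<delta> * q (i - n)"
        using shift[of "i - n"] by simp_all
      then have "p i * w2 - q i * w1 = (\<alpha> * \<delta> - \<beta> * \<gamma>) * x (i - n)"
        unfolding x_def w1_def w2_def by (simp only: algebra_simps)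
      then show ?thesis using det by simp
    qed
    \<comment> \<open>Negativity of the form, expanded in the basis at i, compares two successive
      quotients of x; shifting the index by n must strictly decrease them.\<close>
    have W: "x i * x (i - 1 - n) - x (i - 1) * x (i - n) < 0" for i
    proof -
      have e: "z1 = - x (i - 1) * p i + x i * p (i - 1)" "z2 = - x (i - 1) * q i + x i * q (i - 1)"
        using expand(1)[of z1 i z2] expand(2)[of z2 i z1] by (simp_all add: x_def)
      have "z1 * w2 - z2 * w1 =
          - x (i - 1) * (p i * w2 - q i * w1) + x i * (p (i - 1) * w2 - q (i - 1) * w1)"
        by (subst e(1), subst e(2)) (simp add: algebra_simps)
      then have "z1 * w2 - z2 * w1 = - x (i - 1) * x (i - n) + x i * x (i - 1 - n)"
        using xw by simp
      then show ?thesis using neg by (simp add: w1_def w2_def)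
    qed
    define \<rho> where "\<rho> i = real_of_int (x i) / real_of_int (x (i - 1))" for i
    have dec: "\<rho> (i + n) < \<rho> i" for i
    proof -
      have "x (i + n) * x (i - 1) < x i * x (i + n - 1)"
        using W[of "i + n"] by (simp add: algebra_simps)
      then have "real_of_int (x (i + n)) * real_of_int (x (i - 1)) <
          real_of_int (x i) * real_of_int (x (i + n - 1))"
        by (metis of_int_less_iff of_int_mult)
      then show ?thesis using xpos[of "i - 1"] xpos[of "i + n - 1"]
        by (simp add: \<rho>_def field_simps)
    qed
    have dec': "\<rho> (i + int (Suc k) * n) < \<rho> i" for i k
    proof (induction k)
      case (Suc k)
      then show ?case using dec[of "i + int (Suc k) * n"] by (simp add: algebra_simps)
    qed (use dec in simp)
    obtain i0 i1 where i0: "\<And>i. i \<le> i0 \<Longrightarrow> x i \<le> x (i - 1)" and i1: "\<And>i. i1 \<le> i \<Longrightarrow> x (i - 1) \<le> x i"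
      using positive_solution_shape[OF x xpos] by blast
    \<comment> \<open>The index i0 + k + 1 lies past i1 for this k. There quotients are at least 1,
      while the one at i0 is at most 1, against the strict decrease along multiples of n.\<close>
    define k where "k = nat (\<bar>i1\<bar> + \<bar>i0\<bar>)"
    have "i1 \<le> i0 + int (Suc k)" unfolding k_def by simp
    also have "\<dots> \<le> i0 + int (Suc k) * n"
      using n mult_left_mono[of 1 n "int (Suc k)"] by simp
    finally have "1 \<le> \<rho> (i0 + int (Suc k) * n)"
      unfolding \<rho>_def using i1[of "i0 + int (Suc k) * n"] xpos[of "i0 + int (Suc k) * n - 1"]
      by (simp add: field_simps)
    moreover have "\<rho> i0 \<le> 1" using i0[of i0] xpos[of "i0 - 1"] by (simp add: \<rho>_def field_simps)
    ultimately show False using dec'[of i0 k] by simp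
  qed
  define x where "x i = p i * z2 - q i * z1" for i
  \<comment> \<open>A sequence of constant strict sign is excluded by \<open>main\<close>, applied
    to z or to its negative. At a change of sign the two coordinates of z in the basis i, i - 1 have
    equal sign, so z lies in that cone up to sign.\<close>
  have "\<exists>i. (x (i - 1) \<le> 0 \<and> 0 \<le> x i) \<or> (0 \<le> x (i - 1) \<and> x i \<le> 0)"
  proof (rule ccontr)
    assume "\<not> ?thesis"
    then have same: "0 < x (i - 1) \<and> 0 < x i \<or> x (i - 1) < 0 \<and> x i < 0" for i
      by (meson linorder_less_linear order_less_imp_le order.refl order.eq_iff not_le)
    have "(0 < x i) = (0 < x 0)" for i
    proof (induction i rule: int_induct[where k = 0])
      case (step1 i)
      then show ?case using same[of "i + 1"] by auto
    next
      case (step2 i)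
      then show ?case using same[of i] by auto
    qed simp
    moreover have "x i \<noteq> 0" for i using same[of i] by auto
    ultimately have "(\<forall>i. 0 < x i) \<or> (\<forall>i. 0 < - x i)" by (metis linorder_neqE neg_0_less_iff_less)
    then show False
    proof
      assume "\<forall>i. 0 < x i"
      then show False using main[of z2 z1] neg by (simp add: x_def)
    next
      assume "\<forall>i. 0 < - x i"
      then show False using main[of "- z2" "- z1"] neg by (simp add: x_def algebra_simps)
    qed
  qed
  then obtain i where "(x (i - 1) \<le> 0 \<and> 0 \<le> x i) \<or> (0 \<le> x (i - 1) \<and> x i \<le> 0)" by blast
  moreover have "z1 = - x (i - 1) * p i + x i * p (i - 1)" "z2 = - x (i - 1) * q i + x i * q (i - 1)"
    using expand(1)[of z1 i z2] expand(2)[of z2 i z1] by (simp_all add: x_def)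
  ultimately consider
    "0 \<le> - x (i - 1)" "0 \<le> x i" "z1 = 1 * ((- x (i - 1)) * p i + x i * p (i - 1))"
       "z2 = 1 * ((- x (i - 1)) * q i + x i * q (i - 1))" |
    "0 \<le> x (i - 1)" "0 \<le> - x i" "z1 = -1 * (x (i - 1) * p i + (- x i) * p (i - 1))"
       "z2 = -1 * (x (i - 1) * q i + (- x i) * q (i - 1))"
    by fastforce
  then show ?thesis
    by cases blast+
qed

end

text \<open>The form determined by the matrix is negative on the vectors of both fans, so each
  vector of one fan lies, up to sign, in a cone of the other. Being minimal generators, the vectors
  then have to coincide up to a common sign and a translation of the index.\<close>

theorem fan_unique:
  assumes v: "fan a p q" and y: "fan b r s"
    and pq: "\<And>i. \<alpha> * p i + \<beta> * q i = p (i + n)" "\<And>i. \<gamma> * p i + \<delta> * q i = q (i + n)"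
    and rs: "\<And>i. \<alpha> * r i + \<beta> * s i = r (i + m)" "\<And>i. \<gamma> * r i + \<delta> * s i = s (i + m)"
    and det: "\<alpha> * \<delta> - \<beta> * \<gamma> = 1" and n: "0 < n" and m: "0 < m"
  shows "n = m \<and> (\<exists>t. \<forall>j. b j = a (j + t))"
proof -
  interpret v: fan a p q by (rule v)
  interpret y: fan b r s by (rule y)
  have "\<exists>k \<sigma> c d. (\<sigma> = 1 \<or> \<sigma> = -1) \<and> 0 \<le> c \<and> 0 \<le> d \<and>
      p i = \<sigma> * (c * r k + d * r (k - 1)) \<and> q i = \<sigma> * (c * s k + d * s (k - 1))" for i
  proof (rule y.negative_in_cone[OF rs det m])
    have "p i * q (i + n) - q i * p (i + n) < 0"
      using v.fan_det_ge[of i "i + n"] v.fan_det_swap[of i "i + n"] n unfolding v.fan_det_def[of i "i + n"] by linarith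
    then show "p i * (\<gamma> * p i + \<delta> * q i) - q i * (\<alpha> * p i + \<beta> * q i) < 0"
      by (simp add: pq)
  qed
  then obtain k \<sigma> c d where
    \<sigma>: "\<And>i. \<sigma> i = 1 \<or> \<sigma> i = -1" and c0: "\<And>i. 0 \<le> c i" and d0: "\<And>i. 0 \<le> d i" and
    p_eq: "\<And>i. p i = \<sigma> i * (c i * r (k i) + d i * r (k i - 1))" and
    q_eq: "\<And>i. q i = \<sigma> i * (c i * s (k i) + d i * s (k i - 1))"
    by metis
  have push: "p (i + int K * n) = \<sigma> i * (c i * r (k i + int K * m) + d i * r (k i - 1 + int K * m)) \<and>
     q (i + int K * n) = \<sigma> i * (c i * s (k i + int K * m) + d i * s (k i - 1 + int K * m))" for i K
  proof (induction K)
    case 0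
    then show ?case using p_eq[of i] q_eq[of i] by simp
  next
    case (Suc K)
    have e: "x + int (Suc K) * l = (x + int K * l) + l" for x l by (simp add: algebra_simps)
    show ?case unfolding e pq[symmetric] rs[symmetric] conjunct1[OF Suc] conjunct2[OF Suc]
      by (simp add: algebra_simps)
  qed
  \<comment> \<open>For large K the indices in the second fan belonging to i - 1, pushed forward K
    periods, lie beyond those belonging to i. Opposite signs would then make the determinant of the
    vectors i and i - 1 + K * n nonnegative, although it is negative in the first fan.\<close>
  have sign_step: "\<sigma> i = \<sigma> (i - 1)" for i
  proof (rule ccontr)
    assume ne: "\<sigma> i \<noteq> \<sigma> (i - 1)"
    define K where "K = nat (\<bar>k i\<bar> + \<bar>k (i - 1)\<bar> + 2)"
    define k' where "k' = k (i - 1)"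
    define u where "u = k' + int K * m"
    define u' where "u' = k' - 1 + int K * m"
    have iK: "int K = \<bar>k i\<bar> + \<bar>k (i - 1)\<bar> + 2" unfolding K_def by simp
    have "int K * 1 \<le> int K * n" "int K * 1 \<le> int K * m"
      using n m by (intro mult_left_mono; simp)+
    then have Kn: "2 \<le> int K * n" and Km: "k i + 1 \<le> u'"
      using iK abs_ge_zero[of "k i"] abs_ge_zero[of "k (i - 1)"] abs_ge_self[of "k i"]
        abs_ge_minus_self[of "k (i - 1)"] unfolding u'_def k'_def by linarith+
    have "v.fan_det i (i - 1 + int K * n) < 0"
      using v.fan_det_ge[of i "i - 1 + int K * n"] v.fan_det_swap[of i "i - 1 + int K * n"] Kn by simp
    moreover have "v.fan_det i (i - 1 + int K * n) = \<sigma> i * \<sigma> (i - 1) *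
       (c i * c (i - 1) * y.fan_det (k i) u + c i * d (i - 1) * y.fan_det (k i) u' +
        d i * c (i - 1) * y.fan_det (k i - 1) u + d i * d (i - 1) * y.fan_det (k i - 1) u')"
      unfolding v.fan_det_def y.fan_det_def conjunct1[OF push] conjunct2[OF push] u_def u'_def k'_def
      by (subst p_eq, subst q_eq) (simp add: algebra_simps)
    moreover have "\<sigma> i * \<sigma> (i - 1) = -1" using ne \<sigma>[of i] \<sigma>[of "i - 1"] by auto
    moreover have neg: "y.fan_det g h \<le> 0" if "g \<le> h" for g h
      using y.fan_det_ge[of g h] y.fan_det_swap[of g h] that by simp
    have "c i * c (i - 1) * y.fan_det (k i) u \<le> 0" "c i * d (i - 1) * y.fan_det (k i) u' \<le> 0"
        "d i * c (i - 1) * y.fan_det (k i - 1) u \<le> 0" "d i * d (i - 1) * y.fan_det (k i - 1) u' \<le> 0"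
      using Km c0 d0 by (auto intro!: mult_nonneg_nonpos neg simp: u_def u'_def)
    ultimately show False by simp
  qed
  have sign: "\<sigma> i = \<sigma> 0" for i
  proof (induction i rule: int_induct[where k = 0])
    case (step1 i)
    then show ?case using sign_step[of "i + 1"] by simp
  next
    case (step2 i)
    then show ?case using sign_step[of i] by simp
  qed simp
  have \<sigma>0: "\<sigma> 0 * \<sigma> 0 = 1" using \<sigma>[of 0] by auto
  \<comment> \<open>The functional \<open>l\<close> is 1 on the vector j of the second fan and at
    least 1 on every signed vector of the first. As vector j is a nonnegative combination of two of
    the latter up to sign, the value 1 leaves a single term with coefficient 1.\<close>
  have "\<exists>i. r j = \<sigma> 0 * p i \<and> s j = \<sigma> 0 * q i" for j
  proof -
    define l where "l z1 z2 = (r j - r (j - 1)) * z2 - (s j - s (j - 1)) * z1" for z1 z2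
    have lv: "1 \<le> \<sigma> 0 * l (p i) (q i)" for i
    proof -
      have "p i = \<sigma> 0 * (c i * r (k i) + d i * r (k i - 1))"
           "q i = \<sigma> 0 * (c i * s (k i) + d i * s (k i - 1))"
        using p_eq[of i] q_eq[of i] sign[of i] by simp_all
      then have "l (p i) (q i) = \<sigma> 0 * (c i * l (r (k i)) (s (k i)) + d i * l (r (k i - 1)) (s (k i - 1)))"
        unfolding l_def by (simp only: algebra_simps)
      then have eq: "\<sigma> 0 * l (p i) (q i) = c i * l (r (k i)) (s (k i)) + d i * l (r (k i - 1)) (s (k i - 1))"
        using \<sigma>0 by (simp add: mult.assoc[symmetric])
      have ge: "1 \<le> l (r h) (s h)" for h
        unfolding l_def by (rule y.functional_ge_1)
      have "c i * 1 + d i * 1 \<le> \<sigma> 0 * l (p i) (q i)"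
        unfolding eq by (intro add_mono mult_left_mono ge c0 d0)
      moreover have "c i \<noteq> 0 \<or> d i \<noteq> 0"
      proof (rule ccontr)
        assume "\<not> ?thesis"
        then have "p i = 0" "q i = 0" using p_eq[of i] q_eq[of i] by simp_all
        then show False using v.fan_det_pred[of i] by (simp add: v.fan_det_def)
      qed
      ultimately show ?thesis using c0[of i] d0[of i] by linarith
    qed
    have "\<exists>i \<tau> c d. (\<tau> = 1 \<or> \<tau> = -1) \<and> 0 \<le> c \<and> 0 \<le> d \<and>
      r j = \<tau> * (c * p i + d * p (i - 1)) \<and> s j = \<tau> * (c * q i + d * q (i - 1))"
    proof (rule v.negative_in_cone[OF pq det n])
      have "r j * s (j + m) - s j * r (j + m) < 0"
        using y.fan_det_ge[of j "j + m"] y.fan_det_swap[of j "j + m"] m unfolding y.fan_det_def[of j "j + m"] by linarith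
      then show "r j * (\<gamma> * r j + \<delta> * s j) - s j * (\<alpha> * r j + \<beta> * s j) < 0"
        by (simp add: rs)
    qed
    then obtain i \<tau> c' d' where h: "\<tau> = 1 \<or> \<tau> = -1" "0 \<le> c'" "0 \<le> d'"
      "r j = \<tau> * (c' * p i + d' * p (i - 1))" "s j = \<tau> * (c' * q i + d' * q (i - 1))" by blast
    have lin: "l (t * (f * u + g * w)) (t * (f * u' + g * w')) = t * (f * l u u' + g * l w w')"
      for t f g u w u' w' unfolding l_def by (simp add: algebra_simps)
    have "l (r j) (s j) = 1"
      using y.fan_det_pred[of j] by (simp add: l_def y.fan_det_def algebra_simps)
    moreover have "l (r j) (s j) = \<tau> * (c' * l (p i) (q i) + d' * l (p (i - 1)) (q (i - 1)))"
      by (simp only: h(4,5) lin)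
    ultimately have 1: "1 = \<tau> * (c' * l (p i) (q i) + d' * l (p (i - 1)) (q (i - 1)))" by simp
    define A where "A = \<sigma> 0 * l (p i) (q i)"
    define B where "B = \<sigma> 0 * l (p (i - 1)) (q (i - 1))"
    have AB: "1 \<le> A" "1 \<le> B" unfolding A_def B_def using lv by blast+
    have "\<tau> * \<sigma> 0 * (c' * A + d' * B) =
        (\<sigma> 0 * \<sigma> 0) * (\<tau> * (c' * l (p i) (q i) + d' * l (p (i - 1)) (q (i - 1))))"
      unfolding A_def B_def by (simp only: algebra_simps)
    then have 2: "\<tau> * \<sigma> 0 * (c' * A + d' * B) = 1" using 1 \<sigma>0 by simp
    have ge: "c' * 1 + d' * 1 \<le> c' * A + d' * B"
      using AB h by (intro add_mono mult_left_mono) auto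
    have "\<tau> * \<sigma> 0 = 1 \<or> \<tau> * \<sigma> 0 = -1" using h(1) \<sigma>[of 0] by auto
    then have ts: "\<tau> * \<sigma> 0 = 1" and "c' * A + d' * B = 1" using 2 ge h(2,3) by auto
    then have "c' + d' \<le> 1" using ge by simp
    moreover have "\<not> (c' = 0 \<and> d' = 0)" using \<open>c' * A + d' * B = 1\<close> by auto
    ultimately have cd: "(c' = 1 \<and> d' = 0) \<or> (c' = 0 \<and> d' = 1)" using h(2,3) by linarith
    have "\<tau> = \<sigma> 0" using ts h(1) \<sigma>[of 0] by auto
    then show ?thesis using cd h(4,5) by auto
  qed
  then obtain \<tau> where r_eq: "\<And>j. r j = \<sigma> 0 * p (\<tau> j)" and s_eq: "\<And>j. s j = \<sigma> 0 * q (\<tau> j)"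
    by metis
  have dt_eq: "y.fan_det i j = v.fan_det (\<tau> i) (\<tau> j)" for i j
  proof -
    have "y.fan_det i j = (\<sigma> 0 * \<sigma> 0) * v.fan_det (\<tau> i) (\<tau> j)"
      unfolding y.fan_det_def v.fan_det_def r_eq s_eq by (simp only: algebra_simps)
    then show ?thesis using \<sigma>0 by simp
  qed
  \<comment> \<open>Consecutive vectors have determinant 1, and in a fan only consecutive ones do;
    so \<tau> is a translation.\<close>
  have step: "\<tau> j = \<tau> (j - 1) + 1" for j
    using dt_eq[of j "j - 1"] y.fan_det_pred[of j] v.fan_det_eq_1_iff by simp
  have \<tau>: "\<tau> j = j + \<tau> 0" for j
  proof (induction j rule: int_induct[where k = 0])
    case (step1 i)
    then show ?case using step[of "i + 1"] by simp
  next
    case (step2 i)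
    then show ?case using step[of i] by simp
  qed simp
  have "b j = a (j + \<tau> 0)" for j
  proof -
    have "r (j + 1) + r (j - 1) = b j * r j" "s (j + 1) + s (j - 1) = b j * s j"
      using y.solutionD[OF y.sol_p, of j] y.solutionD[OF y.sol_q, of j] by simp_all
    then have "\<sigma> 0 * (p (j + \<tau> 0 + 1) + p (j + \<tau> 0 - 1)) = \<sigma> 0 * (b j * p (j + \<tau> 0))"
      "\<sigma> 0 * (q (j + \<tau> 0 + 1) + q (j + \<tau> 0 - 1)) = \<sigma> 0 * (b j * q (j + \<tau> 0))"
      unfolding r_eq s_eq \<tau>[of "j + 1"] \<tau>[of "j - 1"] \<tau>[of j] by (simp_all add: algebra_simps)
    then have "p (j + \<tau> 0 + 1) + p (j + \<tau> 0 - 1) = b j * p (j + \<tau> 0)"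
      "q (j + \<tau> 0 + 1) + q (j + \<tau> 0 - 1) = b j * q (j + \<tau> 0)"
      using \<sigma>0 by (metis mult.assoc mult_1)+
    then have "a (j + \<tau> 0) * p (j + \<tau> 0) = b j * p (j + \<tau> 0)"
       "a (j + \<tau> 0) * q (j + \<tau> 0) = b j * q (j + \<tau> 0)"
      using v.solutionD[OF v.sol_p, of "j + \<tau> 0"] v.solutionD[OF v.sol_q, of "j + \<tau> 0"] by simp_all
    moreover have "p (j + \<tau> 0) \<noteq> 0 \<or> q (j + \<tau> 0) \<noteq> 0"
      using v.fan_det_pred[of "j + \<tau> 0"] by (auto simp: v.fan_det_def)
    ultimately show ?thesis by auto
  qed
  \<comment> \<open>The image of the vector \<tau> 0 under the matrix is computed in both fans;
    equal vectors have determinant 0, hence equal index.\<close>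
  moreover have "n = m"
  proof -
    have "p (\<tau> 0 + n) = p (\<tau> 0 + m)"
    proof -
      have "\<sigma> 0 * (\<alpha> * p (\<tau> 0) + \<beta> * q (\<tau> 0)) = \<sigma> 0 * p (\<tau> 0 + m)"
        using rs(1)[of 0] \<tau>[of m] by (simp add: r_eq s_eq algebra_simps)
      then have "\<sigma> 0 * p (\<tau> 0 + m) = \<sigma> 0 * p (\<tau> 0 + n)"
        unfolding pq by (rule sym)
      then show ?thesis using \<sigma>0 by (metis mult.assoc mult_1)
    qed
    moreover have "q (\<tau> 0 + n) = q (\<tau> 0 + m)"
    proof -
      have "\<sigma> 0 * (\<gamma> * p (\<tau> 0) + \<delta> * q (\<tau> 0)) = \<sigma> 0 * q (\<tau> 0 + m)"
        using rs(2)[of 0] \<tau>[of m] by (simp add: r_eq s_eq algebra_simps)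
      then have "\<sigma> 0 * q (\<tau> 0 + m) = \<sigma> 0 * q (\<tau> 0 + n)"
        unfolding pq by (rule sym)
      then show ?thesis using \<sigma>0 by (metis mult.assoc mult_1)
    qed
    ultimately have "v.fan_det (\<tau> 0 + n) (\<tau> 0 + m) = 0" by (simp add: v.fan_det_def)
    then show ?thesis using v.fan_det_eq_0_iff by simp
  qed
  ultimately show ?thesis by blast
qed


section \<open>Values of cycles\<close>

text \<open>A cycle has as many edges as vertices, so here each weight brings exactly one
  turn.\<close>

fun cycle_value :: "int list \<Rightarrow> label" where
  "cycle_value [] = 1"
| "cycle_value (w # ws) = twist w * turn * cycle_value ws"

lemma cycle_value_append: "cycle_value (xs @ ys) = cycle_value xs * cycle_value ys"
  by (induction xs) (simp_all add: mult.assoc)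

lemma label_det_cycle_value [simp]: "label_det (cycle_value ws) = 1"
  by (induction ws) simp_all

lemma cycle_value_Cons_chain: "cycle_value (w # ws) = twist w * chain_value ws"
proof (induction ws arbitrary: w)
  case (Cons v ws)
  have "cycle_value (w # v # ws) = twist w * turn * cycle_value (v # ws)" by simp
  then show ?case using Cons[of v] by (simp only: chain_value.simps mult.assoc)
qed simp

section \<open>Hyperbolic and parabolic words\<close>

fun matrix_part :: "label \<Rightarrow> label" where "matrix_part (Label a b c d n) = Label a b c d 0"

lemma matrix_part_mult [simp]: "matrix_part (x * y) = matrix_part x * matrix_part y"
  by (cases x; cases y) simp

definition list_seq :: "int list \<Rightarrow> int \<Rightarrow> int" where
  "list_seq us i = - us ! nat (i mod int (length us))"

text \<open>Start with the standard basis as the vectors 0 and -1. The product over the first k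
  weights then has the vectors k and k - 1 as columns, and the product over one full period shifts
  the whole fan by that period.\<close>

lemma fan_of_list:
  assumes us: "us \<noteq> []" "\<forall>w\<in>set us. w \<le> -2"
  obtains p q e where "fan (list_seq us) p q"
    "cycle_value us = Label (p (int (length us))) (p (int (length us) - 1))
        (q (int (length us))) (q (int (length us) - 1)) e"
    "\<And>i. p (int (length us)) * p i + p (int (length us) - 1) * q i = p (i + int (length us))"
    "\<And>i. q (int (length us)) * p i + q (int (length us) - 1) * q i = q (i + int (length us))"
proof -
  define n where "n = int (length us)"
  define a where "a = list_seq us"
  have n: "0 < n" using us by (simp add: n_def)
  interpret recurrence a
  proof
    fix i
    have "nat (i mod n) < length us" using n unfolding n_def by (simp add: nat_less_iff)
    then have "us ! nat (i mod n) \<le> -2" using us(2) nth_mem by blast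
    then show "2 \<le> a i" by (simp add: a_def list_seq_def n_def)
  qed
  have per: "a (i + n) = a i" for i by (simp add: a_def list_seq_def n_def)
  obtain p where p: "solution p" "p 0 = 1" "p (-1) = 0" using solution_exists by blast
  obtain q where q: "solution q" "q 0 = 0" "q (-1) = 1" using solution_exists by blast
  have fan: "fan a p q" by unfold_locales (use p q in auto)
  have shift_sol: "solution (\<lambda>i. x (i + n))" if "solution x" for x
    unfolding solution_def
  proof
    fix i
    have e: "i + 1 + n = (i + n) + 1" "i - 1 + n = (i + n) - 1" by simp_all
    then show "x (i + 1 + n) = a i * x (i + n) - x (i - 1 + n)"
      unfolding e using solutionD[OF that, of "i + n"] per[of i] by simp
  qed
  have shift: "x n * p i + x (n - 1) * q i = x (i + n)" if "solution x" for x i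
    using solution_unique[OF solution_lin[OF p(1) q(1), of "x n" "x (n - 1)"] shift_sol[OF that]] p q
    by simp
  have val: "\<exists>e. cycle_value (map (\<lambda>i. - a (int i)) [0..<k]) =
    Label (p (int k)) (p (int k - 1)) (q (int k)) (q (int k - 1)) e" for k
  proof (induction k)
    case 0
    then show ?case using p q by (simp add: one_label_def)
  next
    case (Suc k)
    then obtain e where "cycle_value (map (\<lambda>i. - a (int i)) [0..<k]) =
        Label (p (int k)) (p (int k - 1)) (q (int k)) (q (int k - 1)) e" by blast
    then show ?case
      using solutionD[OF p(1), of "int k"] solutionD[OF q(1), of "int k"]
      by (simp add: cycle_value_append twist_def turn_def algebra_simps)
        (rule exI[of _ "e + 3 - a (int k)"], simp)
  qed
  have "map (\<lambda>i. - a (int i)) [0..<length us] = us"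
    by (rule nth_equalityI) (simp_all add: a_def list_seq_def)
  then obtain e where "cycle_value us = Label (p n) (p (n - 1)) (q n) (q (n - 1)) e"
    using val[of "length us"] by (auto simp: n_def)
  then show ?thesis
    using that[of p q e] fan shift[OF p(1)] shift[OF q(1)] unfolding a_def n_def by blast
qed

text \<open>X transports the fan of \<open>us'\<close> to a fan that is shifted by the matrix of
  \<open>us\<close>. By uniqueness of the fan of a matrix, the two periodic coefficient sequences
  differ by a translation, which is a rotation of the list.\<close>

theorem cycle_value_conjugate_rotate:
  assumes us: "us \<noteq> []" "\<forall>w\<in>set us. w \<le> -2" and us': "us' \<noteq> []" "\<forall>w\<in>set us'. w \<le> -2"
    and X: "label_det X = 1" and eq: "matrix_part (X * cycle_value us') = matrix_part (cycle_value us * X)"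
  shows "\<exists>i. us' = rotate i us"
proof -
  define n where "n = int (length us)"
  define m where "m = int (length us')"
  obtain p q e where v: "fan (list_seq us) p q"
    and M: "cycle_value us = Label (p n) (p (n - 1)) (q n) (q (n - 1)) e"
    and pq: "\<And>i. p n * p i + p (n - 1) * q i = p (i + n)" "\<And>i. q n * p i + q (n - 1) * q i = q (i + n)"
    using fan_of_list[OF us] unfolding n_def by metis
  obtain r0 s0 e' where y0: "fan (list_seq us') r0 s0"
    and M': "cycle_value us' = Label (r0 m) (r0 (m - 1)) (s0 m) (s0 (m - 1)) e'"
    and rs0: "\<And>i. r0 m * r0 i + r0 (m - 1) * s0 i = r0 (i + m)"
       "\<And>i. s0 m * r0 i + s0 (m - 1) * s0 i = s0 (i + m)"
    using fan_of_list[OF us'] unfolding m_def by metis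
  obtain x1 x2 x3 x4 xe where XX: "X = Label x1 x2 x3 x4 xe" by (cases X)
  have detX: "x1 * x4 - x2 * x3 = 1" using X XX by simp
  define r where "r i = x1 * r0 i + x2 * s0 i" for i
  define s where "s i = x3 * r0 i + x4 * s0 i" for i
  interpret y0: fan "list_seq us'" r0 s0 by (rule y0)
  have y: "fan (list_seq us') r s"
  proof
    show "y0.solution r" "y0.solution s"
      unfolding r_def s_def by (rule y0.solution_lin[OF y0.sol_p y0.sol_q])+
    have "r 0 * s (-1) - s 0 * r (-1) = (x1 * x4 - x2 * x3) * (r0 0 * s0 (-1) - s0 0 * r0 (-1))"
      unfolding r_def s_def by (simp only: algebra_simps)
    then show "r 0 * s (-1) - s 0 * r (-1) = 1" using detX y0.unimodular by simp
  qed
  have eqs: "x1 * r0 m + x2 * s0 m = p n * x1 + p (n - 1) * x3"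
       "x1 * r0 (m - 1) + x2 * s0 (m - 1) = p n * x2 + p (n - 1) * x4"
       "x3 * r0 m + x4 * s0 m = q n * x1 + q (n - 1) * x3"
       "x3 * r0 (m - 1) + x4 * s0 (m - 1) = q n * x2 + q (n - 1) * x4"
    using eq M M' XX by simp_all
  have rs: "p n * r i + p (n - 1) * s i = r (i + m)" for i
  proof -
    have "p n * r i + p (n - 1) * s i =
        (p n * x1 + p (n - 1) * x3) * r0 i + (p n * x2 + p (n - 1) * x4) * s0 i"
      unfolding r_def s_def by (simp only: algebra_simps)
    also have "\<dots> = x1 * (r0 m * r0 i + r0 (m - 1) * s0 i) + x2 * (s0 m * r0 i + s0 (m - 1) * s0 i)"
      unfolding eqs[symmetric] by (simp only: algebra_simps)
    finally show ?thesis unfolding rs0 r_def .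
  qed
  have rs': "q n * r i + q (n - 1) * s i = s (i + m)" for i
  proof -
    have "q n * r i + q (n - 1) * s i =
        (q n * x1 + q (n - 1) * x3) * r0 i + (q n * x2 + q (n - 1) * x4) * s0 i"
      unfolding r_def s_def by (simp only: algebra_simps)
    also have "\<dots> = x3 * (r0 m * r0 i + r0 (m - 1) * s0 i) + x4 * (s0 m * r0 i + s0 (m - 1) * s0 i)"
      unfolding eqs[symmetric] by (simp only: algebra_simps)
    finally show ?thesis unfolding rs0 s_def .
  qed
  have detM: "p n * q (n - 1) - p (n - 1) * q n = 1" using label_det_cycle_value[of us] M by simp
  have "0 < n" "0 < m" using us us' by (simp_all add: n_def m_def)
  then obtain t where nm: "n = m" and t: "\<And>j. list_seq us' j = list_seq us (j + t)"
    using fan_unique[OF v y pq rs rs' detM] by blast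
  have len: "length us' = length us" using nm by (simp add: n_def m_def)
  have "us' = rotate (nat (t mod n)) us"
  proof (rule nth_equalityI)
    fix j assume j: "j < length us'"
    have "us' ! j = us ! nat ((int j + t) mod n)"
      using t[of "int j"] j by (simp add: list_seq_def n_def len nat_mod_as_int)
    moreover have "nat ((int j + t) mod n) = (nat (t mod n) + j) mod length us"
    proof -
      have "int ((nat (t mod n) + j) mod length us) = (t mod n + int j) mod n"
        using \<open>0 < n\<close> by (simp add: zmod_int n_def)
      also have "\<dots> = (int j + t) mod n" by (simp add: mod_simps add.commute)
      finally show ?thesis by (metis nat_int)
    qed
    ultimately show "us' ! j = rotate (nat (t mod n)) us ! j"
      using j len by (simp add: nth_rotate)
  qed (simp add: len)
  then show ?thesis by blast
qed


section \<open>Conjugacy of labels and its invariants\<close>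

definition conjugate :: "label \<Rightarrow> label \<Rightarrow> bool" where
  "conjugate P Q \<longleftrightarrow> (\<exists>X. label_det X = 1 \<and> X * P = Q * X)"

lemma conjugate_refl [simp]: "conjugate P P"
  unfolding conjugate_def by (rule exI[of _ 1]) simp

lemma conjugate_sym: "conjugate P Q \<Longrightarrow> conjugate Q P"
  unfolding conjugate_def
proof clarify
  fix X assume X: "label_det X = 1" and eq: "X * P = Q * X"
  have "label_inverse X * Q = label_inverse X * (Q * X) * label_inverse X" by (simp add: mult.assoc label_inverse_mult[OF X])
  also have "\<dots> = (label_inverse X * X) * P * label_inverse X" by (simp only: eq[symmetric] mult.assoc)
  also have "\<dots> = P * label_inverse X" by (simp add: label_inverse_mult[OF X])
  finally show "\<exists>X. label_det X = 1 \<and> X * Q = P * X" using X by (intro exI[of _ "label_inverse X"]) simp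
qed

lemma conjugate_trans: "conjugate P Q \<Longrightarrow> conjugate Q R \<Longrightarrow> conjugate P R"
  unfolding conjugate_def
proof clarify
  fix X Y assume "label_det X = 1" "X * P = Q * X" "label_det Y = 1" "Y * Q = R * Y"
  then have "label_det (Y * X) = 1 \<and> (Y * X) * P = R * (Y * X)"
    by (metis label_det_mult mult_1 mult.assoc)
  then show "\<exists>X. label_det X = 1 \<and> X * P = R * X" by blast
qed

lemma conjugate_swap: "label_det B = 1 \<Longrightarrow> conjugate (A * B) (B * A)"
  unfolding conjugate_def by (rule exI[of _ B]) (simp add: mult.assoc)

lemma conjugate_reversal: "conjugate P Q \<Longrightarrow> conjugate (reversal P) (reversal Q)"
proof -
  assume "conjugate P Q"
  then obtain X where "label_det X = 1" "X * P = Q * X" unfolding conjugate_def by blast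
  then have "reversal X * reversal Q = reversal P * reversal X" by (metis reversal_mult)
  moreover have "label_det (reversal X) = 1" using \<open>label_det X = 1\<close> by simp
  ultimately show ?thesis using conjugate_sym unfolding conjugate_def by metis
qed

lemma conjugate_cycle_value_rotate: "conjugate (cycle_value ws) (cycle_value (rotate i ws))"
proof (induction i)
  case (Suc i)
  have "conjugate (cycle_value us) (cycle_value (rotate1 us))" for us
    by (cases us) (simp_all add: cycle_value_append conjugate_sym[OF conjugate_swap])
  then show ?case using Suc conjugate_trans by (metis rotate_Suc)
qed simp

lemma conjugate_reversal_cycle_value: "conjugate (reversal (cycle_value ws)) (cycle_value (rev ws))"
proof (cases ws)
  case (Cons w us)
  have "reversal (cycle_value ws) = chain_value (rev us) * twist w"
    using Cons by (simp add: cycle_value_Cons_chain reversal_chain_value del: cycle_value.simps)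
  moreover have "conjugate (chain_value (rev us) * twist w) (twist w * chain_value (rev us))"
    by (rule conjugate_swap) simp
  moreover have "twist w * chain_value (rev us) = cycle_value (w # rev us)"
    by (simp only: cycle_value_Cons_chain)
  moreover have "conjugate (cycle_value (w # rev us)) (cycle_value (rev ws))"
    using conjugate_cycle_value_rotate[of "w # rev us" 1] Cons by simp
  ultimately show ?thesis using conjugate_trans by metis
qed simp

fun label_trace :: "label \<Rightarrow> int" where "label_trace (Label a b c d n) = a + d"
fun exponent :: "label \<Rightarrow> int" where "exponent (Label a b c d n) = n"

lemma label_trace_swap: "label_trace (x * y) = label_trace (y * x)"
  by (cases x; cases y) simp

lemma exponent_mult: "exponent (x * y) = exponent x + exponent y"
  by (cases x; cases y) simp

lemma conjugate_invariants:
  assumes "conjugate P Q" shows "label_trace P = label_trace Q" "exponent P = exponent Q"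
proof -
  obtain X where X: "label_det X = 1" "X * P = Q * X" using assms unfolding conjugate_def by blast
  have "P = label_inverse X * X * P" by (simp add: label_inverse_mult[OF X(1)])
  also have "\<dots> = label_inverse X * (Q * X)" by (simp only: X(2) mult.assoc)
  finally have "label_trace P = label_trace (Q * X * label_inverse X)" using label_trace_swap by metis
  then show "label_trace P = label_trace Q" by (simp add: mult.assoc label_inverse_mult[OF X(1)])
  show "exponent P = exponent Q" using X(2) exponent_mult by (metis add.commute add_right_imp_eq)
qed

lemma label_trace_centre: "label_trace (centre k * x) = (-1) ^ k * label_trace x" and exponent_centre: "exponent (centre k * x) = 6 * int k + exponent x"
  by (cases x; simp add: centre_def algebra_simps)+

lemma cycle_value_zeros: "cycle_value (zeros (2 * k) @ us) = centre k * cycle_value us"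
proof (induction k)
  case (Suc k)
  have "zeros (2 * Suc k) @ us = 0 # 0 # (zeros (2 * k) @ us)" by simp
  then show ?case using Suc by (simp add: centre_Suc mult.assoc)
qed simp

text \<open>The inequalities are chosen to survive appending a weight at most -2. What matters later
  is that they give p - r' \<ge> 2 for the trace and r > 0.\<close>

lemma cycle_value_shape:
  assumes "us \<noteq> []" "\<forall>w\<in>set us. w \<le> -2"
  shows "\<exists>p p' r r' n. cycle_value us = Label p p' (- r) (- r') n \<and> 1 \<le> r' + 1 \<and> r' + 1 \<le> r \<and>
    p' + 1 \<le> p \<and> p' - r' \<le> p - r \<and> 1 \<le> p' - r'"
  using assms
proof (induction us rule: rev_nonempty_induct)
  case (single w)
  then show ?case by (simp add: twist_def turn_def)
next
  case (snoc w us)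
  then obtain p p' r r' n where h: "cycle_value us = Label p p' (- r) (- r') n" "1 \<le> r' + 1" "r' + 1 \<le> r"
    "p' + 1 \<le> p" "p' - r' \<le> p - r" "1 \<le> p' - r'" by auto
  have w: "2 \<le> - w" using snoc by simp
  have m: "2 * p \<le> (- w) * p" "2 * r \<le> (- w) * r" "2 * (p - r) \<le> (- w) * (p - r)"
    using w h by (intro mult_right_mono; simp)+
  have "cycle_value (us @ [w]) = Label ((- w) * p - p') p (- ((- w) * r - r')) (- r) (n + w + 3)"
    using h(1) by (simp add: cycle_value_append twist_def turn_def algebra_simps)
  moreover have "1 \<le> r + 1" "r + 1 \<le> (- w) * r - r'" "p + 1 \<le> (- w) * p - p'" "1 \<le> p - r"
     using m h by linarith+
  moreover have "p - r \<le> ((- w) * p - p') - ((- w) * r - r')"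
    using m(3) h by (simp add: algebra_simps)
  ultimately show ?case by blast
qed

text \<open>In a cycle with a single vertex the edge is a loop, which lowers the effective weight by 2.\<close>

definition eff_cycle :: "int list \<Rightarrow> int list" where
  "eff_cycle W = (if length W = 1 then [hd W - 2] else W)"

section \<open>Conjugacy classes of standard cycles\<close>

definition std_cycle :: "int list \<Rightarrow> bool" where
  "std_cycle W \<longleftrightarrow>
     (\<exists>k us. us \<noteq> [] \<and> (\<forall>w\<in>set us. w \<le> -2) \<and> W = zeros (2 * k) @ us) \<or>
     (\<exists>l w. w \<le> 0 \<and> W = zeros l @ [w]) \<or> (\<exists>k. W = zeros (2 * k) @ [-1, -1])"

text \<open>The kinds are the conjugacy types up to a central factor: words with trace at least 2
  (A), powers of T (B), and elliptic elements of trace 0 or 1 (C) and -1 (D). In (B) the value is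
  only conjugate to the normal form, because one zero is moved across the cut.\<close>

lemma std_cycle_cases:
  assumes "std_cycle W"
  obtains (A) k us where "us \<noteq> []" "\<forall>w\<in>set us. w \<le> -2" "eff_cycle W = zeros (2 * k) @ us"
      "cycle_value (eff_cycle W) = centre k * cycle_value us"
  | (B) k w where "w \<le> 0" "W = zeros (2 * k + 1) @ [w]" "conjugate (cycle_value (eff_cycle W)) (centre (Suc k) * twist w)"
  | (C) k w where "w = 0 \<or> w = -1" "W = zeros (2 * Suc k) @ [w]"
      "cycle_value (eff_cycle W) = centre (Suc k) * (twist w * turn)"
  | (D) k where "W = zeros (2 * k) @ [-1, -1]"
      "cycle_value (eff_cycle W) = centre k * (twist (-1) * turn * twist (-1) * turn)"
proof -
  \<comment> \<open>The loop lowers the weight of the only vertex to w - 2, so every one-vertex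
    standard cycle is of kind (A), whatever its own weight.\<close>
  have sing: thesis if "W = [w]" "w \<le> 0" for w
    using A[of "[w - 2]" 0] that by (simp add: eff_cycle_def)
  consider (1) k us where "us \<noteq> []" "\<forall>w\<in>set us. w \<le> -2" "W = zeros (2 * k) @ us"
    | (2) l w where "w \<le> 0" "W = zeros l @ [w]" | (3) k where "W = zeros (2 * k) @ [-1, -1]"
    using assms unfolding std_cycle_def by blast
  then show thesis
  proof cases
    case 1
    show thesis
    proof (cases "length W = 1")
      case True
      then obtain w where "W = [w]" by (auto simp: length_Suc_conv)
      moreover have "w \<in> set us" using 1 \<open>W = [w]\<close> by (cases k) auto
      ultimately show thesis using sing 1(2) by fastforce
    next
      case False
      then have "eff_cycle W = zeros (2 * k) @ us" using 1 by (simp add: eff_cycle_def)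
      then show thesis using A[OF 1(1,2)] cycle_value_zeros by metis
    qed
  next
    case 2
    show thesis
    proof (cases "l = 0")
      case True
      then show thesis using sing[of w] 2 by simp
    next
      case l: False
      then have e: "eff_cycle W = W" using 2 by (simp add: eff_cycle_def)
      show thesis
      proof (cases "odd l")
        case True
        then obtain k where k: "l = 2 * k + 1" by (elim oddE)
        have "W = zeros (2 * k) @ [0, w]" using 2 k by (simp add: replicate_append_same[symmetric])
        then have "cycle_value (eff_cycle W) = centre k * (turn * twist w * turn)"
          using e cycle_value_zeros by (simp add: mult.assoc)
        moreover have "conjugate (centre k * (turn * twist w) * turn) (turn * (centre k * (turn * twist w)))" by (rule conjugate_swap) simp
        moreover have "turn * (centre k * (turn * twist w)) = centre (Suc k) * twist w"
          using centre_central[of k turn] by (simp add: centre_Suc mult.assoc) (metis mult.assoc centre_central)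
        ultimately show thesis using B[of w k] 2 k by (simp add: mult.assoc)
      next
        case False
        then obtain k where k: "l = 2 * Suc k" using l by (metis evenE mult_0_right not0_implies_Suc)
        have v: "cycle_value (eff_cycle W) = centre (Suc k) * cycle_value [w]"
          using e 2 k cycle_value_zeros by metis
        show thesis
        proof (cases "w = 0 \<or> w = -1")
          case True
          then show thesis using C[of w k] 2 k v by simp
        next
          case False
          then have "w \<le> -2" using 2 by simp
          then show thesis using A[of "[w]" "Suc k"] 2 k v e by simp
        qed
      qed
    qed
  next
    case 3
    then have "eff_cycle W = W" by (simp add: eff_cycle_def)
    then show thesis using D[of k] 3 cycle_value_zeros[of k "[-1,-1]"] by (simp add: mult.assoc)
  qed
qed

lemma sign_power: "((-1) ^ k :: int) = 1 \<or> ((-1) ^ k :: int) = -1"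
  by (cases "even k") simp_all

lemma matrix_part_centre_cancel:
  assumes "((-1) ^ k :: int) = (-1) ^ k'" "X * (centre k * P) = (centre k' * Q) * X"
  shows "matrix_part (X * P) = matrix_part (Q * X)"
proof -
  have "matrix_part (centre k * (X * P)) = matrix_part (centre k' * (Q * X))"
    using assms(2) centre_central by (metis mult.assoc)
  then show ?thesis using assms(1) sign_power[of k]
    by (cases X; cases P; cases Q) (auto simp: centre_def)
qed

text \<open>Both words have trace at least 2, so the signs of the central factors agree and can be
  cancelled. Rotating a word keeps its exponent, so the exponents give k.\<close>

lemma conjugate_A_A:
  assumes us: "us \<noteq> []" "\<forall>w\<in>set us. w \<le> -2" and us': "us' \<noteq> []" "\<forall>w\<in>set us'. w \<le> -2"
    and c: "conjugate (centre k * cycle_value us) (centre k' * cycle_value us')"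
  shows "k = k' \<and> (\<exists>i. us' = rotate i us)"
proof -
  have label_trace: "2 \<le> label_trace (cycle_value us)" "2 \<le> label_trace (cycle_value us')"
    using cycle_value_shape[OF us] cycle_value_shape[OF us'] by force+
  have "(-1) ^ k * label_trace (cycle_value us) = (-1) ^ k' * label_trace (cycle_value us')"
    using conjugate_invariants(1)[OF c] by (simp add: label_trace_centre)
  then have sg: "((-1) ^ k :: int) = (-1) ^ k'"
    using label_trace sign_power[of k] sign_power[of k'] by auto
  obtain X where X: "label_det X = 1" "X * (centre k' * cycle_value us') = (centre k * cycle_value us) * X"
    using conjugate_sym[OF c] unfolding conjugate_def by blast
  obtain i where i: "us' = rotate i us"
    using cycle_value_conjugate_rotate[OF us us' X(1) matrix_part_centre_cancel[OF sg[symmetric] X(2)]] by blast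
  have "exponent (cycle_value us) = exponent (cycle_value us')"
    using conjugate_invariants(2)[OF conjugate_cycle_value_rotate] i by metis
  then have "k = k'" using conjugate_invariants(2)[OF c] by (simp add: exponent_centre)
  then show ?thesis using i by blast
qed

text \<open>The trace cannot separate these, since words in -2 alone are parabolic. But the lower
  left entry of X^-1 T^w X is -w * z^2, where z is the lower left entry of X; this is nonnegative
  for w \<le> 0, while the word has -r < 0 there.\<close>

lemma not_conjugate_A_B:
  assumes us: "us \<noteq> []" "\<forall>w\<in>set us. w \<le> -2" and w: "w \<le> 0"
  shows "\<not> conjugate (centre k * cycle_value us) (centre k' * twist w)"
proof
  assume c: "conjugate (centre k * cycle_value us) (centre k' * twist w)"
  obtain p p' r r' n where h: "cycle_value us = Label p p' (- r) (- r') n" "1 \<le> r' + 1" "r' + 1 \<le> r"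
    "p' + 1 \<le> p" "p' - r' \<le> p - r" "1 \<le> p' - r'"
    using cycle_value_shape[OF us] by blast
  have "(-1) ^ k * (p - r') = (-1) ^ k' * 2"
    using conjugate_invariants(1)[OF c] h(1) by (simp add: label_trace_centre twist_def)
  moreover have "2 \<le> p - r'" using h by linarith
  ultimately have sg: "((-1) ^ k :: int) = (-1) ^ k'"
    using sign_power[of k] sign_power[of k'] by auto
  obtain X where X: "label_det X = 1" "X * (centre k * cycle_value us) = (centre k' * twist w) * X"
    using c unfolding conjugate_def by blast
  obtain x y z t e where XX: "X = Label x y z t e" by (cases X)
  have eq: "matrix_part (X * cycle_value us) = matrix_part (twist w * X)" by (rule matrix_part_centre_cancel[OF sg X(2)])
  have 1: "x * p - y * r = x + w * z" "z * p - t * r = z" and det: "x * t - y * z = 1"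
    using eq XX h(1) X(1) by (simp_all add: twist_def)
  have "- r = - r * (x * t - y * z)" using det by simp
  also have "\<dots> = x * (z * p - t * r) - z * (x * p - y * r)" by (simp add: algebra_simps)
  also have "\<dots> = - w * (z * z)" unfolding 1 by (simp add: algebra_simps)
  finally have "- r = - w * (z * z)" .
  moreover have "0 \<le> - w * (z * z)" by (rule mult_nonneg_nonneg) (use w in auto)
  ultimately show False using h by simp
qed

lemma conjugate_B_B:
  assumes c: "conjugate (centre k * twist w) (centre k' * twist w')"
  shows "k = k' \<and> w = w'"
proof -
  have sg: "((-1) ^ k :: int) = (-1) ^ k'"
    using conjugate_invariants(1)[OF c] by (simp add: label_trace_centre twist_def)
  obtain X where X: "label_det X = 1" "X * (centre k * twist w) = (centre k' * twist w') * X"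
    using c unfolding conjugate_def by blast
  obtain x y z t e where XX: "X = Label x y z t e" by (cases X)
  have eq: "matrix_part (X * twist w) = matrix_part (twist w' * X)" by (rule matrix_part_centre_cancel[OF sg X(2)])
  then have 1: "w' * z = 0" "x * w + y = y + w' * t" "z * w = 0" and det: "x * t - y * z = 1"
    using XX X(1) by (simp_all add: twist_def)
  have "w = w'"
  proof (cases "z = 0")
    case True
    then have "x = 1 \<and> t = 1 \<or> x = -1 \<and> t = -1" using det by (simp add: zmult_eq_1_iff)
    then show ?thesis using 1(2) by auto
  qed (use 1 in auto)
  then show ?thesis using conjugate_invariants(2)[OF c] by (simp add: exponent_centre)
qed

lemma label_trace_C: "label_trace (twist w * turn) = - w" and exponent_C: "exponent (twist w * turn) = w + 3"
  by (simp_all add: twist_def turn_def)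

lemma label_trace_D: "label_trace (twist (-1) * turn * twist (-1) * turn) = -1" and exponent_D: "exponent (twist (-1) * turn * twist (-1) * turn) = 4"
  by (simp_all add: twist_def turn_def)

lemma label_trace_twist: "label_trace (twist w) = 2" by (simp add: twist_def)

lemma label_trace_cycle_value: "us \<noteq> [] \<Longrightarrow> \<forall>w\<in>set us. w \<le> -2 \<Longrightarrow> 2 \<le> label_trace (cycle_value us)"
  using cycle_value_shape[of us] by force

definition same_cycle :: "int list \<Rightarrow> int list \<Rightarrow> bool" where
  "same_cycle W W' \<longleftrightarrow>
     (\<exists>m us i. (\<forall>w\<in>set us. w \<noteq> 0) \<and> W = zeros m @ us \<and> W' = zeros m @ rotate i us)"

lemma same_cycle_refl: "\<forall>w\<in>set us. w \<noteq> 0 \<Longrightarrow> same_cycle (zeros m @ us) (zeros m @ us)"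
  unfolding same_cycle_def by (metis rotate0 id_apply)

theorem conjugate_std_cycles:
  assumes W: "std_cycle W" and W': "std_cycle W'"
    and c: "conjugate (cycle_value (eff_cycle W)) (cycle_value (eff_cycle W'))"
  shows "same_cycle W W'"
  using W
proof (cases rule: std_cycle_cases)
  case a: (A k us)
  note trA = label_trace_cycle_value[OF a(1,2)]
  show ?thesis using W'
  proof (cases rule: std_cycle_cases)
    case a': (A k' us')
    then obtain i where i: "k = k'" "us' = rotate i us"
      using conjugate_A_A[OF a(1,2) a'(1,2), of k k'] c a(4) a'(4) by auto
    show ?thesis
    \<comment> \<open>A one-vertex cycle is compared through its shifted effective weight and needs
      its own treatment; if its weight is 0 it has no nonzero weight to permute.\<close>
    proof (cases "length (eff_cycle W) = 1")
      case True
      then have "length (eff_cycle W') = 1" using a(3) a'(3) i by simp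
      then obtain x x' where x: "W = [x]" "W' = [x']" using True
        by (auto simp: eff_cycle_def length_Suc_conv split: if_splits)
      have "k = 0" "us = [x - 2]" using a(1,3) x by (cases k; auto simp: eff_cycle_def)+
      then have "x = x'" using a'(3) i x by (simp add: eff_cycle_def)
      then show ?thesis using same_cycle_refl[of "[]" 1] same_cycle_refl[of "[x]" 0] x
        by (cases "x = 0") auto
    next
      case False
      then have "eff_cycle W = W" by (simp add: eff_cycle_def split: if_splits)
      moreover have "length (eff_cycle W') \<noteq> 1" using False a(3) a'(3) i by simp
      then have "eff_cycle W' = W'" by (simp add: eff_cycle_def split: if_splits)
      ultimately show ?thesis unfolding same_cycle_def
        using a(2,3) a'(3) i by (intro exI[of _ "2 * k"] exI[of _ us] exI[of _ i]) auto
    qed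
  next
    case (B k' w)
    then show ?thesis using not_conjugate_A_B[OF a(1,2) B(1)] c a(4) conjugate_trans by metis
  next
    case (C k' w)
    then show ?thesis using conjugate_invariants(1)[OF c] a(4) trA sign_power[of k] sign_power[of "Suc k'"]
      unfolding C(3) a(4) by (auto simp: label_trace_centre label_trace_C simp del: power_Suc)
  next
    case (D k')
    then show ?thesis using conjugate_invariants(1)[OF c] a(4) trA sign_power[of k] sign_power[of k']
      unfolding D(2) a(4) by (auto simp: label_trace_centre label_trace_D simp del: power_Suc)
  qed
next
  case b: (B k w)
  have cb: "conjugate (centre (Suc k) * twist w) (cycle_value (eff_cycle W'))"
    using b(3) c conjugate_sym conjugate_trans by metis
  show ?thesis using W'
  proof (cases rule: std_cycle_cases)
    case (A k' us)
    then show ?thesis using not_conjugate_A_B[OF A(1,2) b(1)] conjugate_sym[OF cb] by metis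
  next
    case (B k' w')
    then have eq: "k = k'" "w = w'" using conjugate_B_B conjugate_trans[OF cb B(3)] by blast+
    have "same_cycle W W"
    proof (cases "w = 0")
      case True
      then have "W = zeros (2 * k + 2) @ []" using b(2) by (simp add: replicate_append_same)
      then show ?thesis using same_cycle_refl[of "[]" "2 * k + 2"] by simp
    next
      case False
      then show ?thesis using same_cycle_refl[of "[w]" "2 * k + 1"] unfolding b(2) by simp
    qed
    then show ?thesis using b(2) B(2) eq by simp
  next
    case (C k' w')
    then show ?thesis using conjugate_invariants(1)[OF cb] sign_power[of "Suc k"] sign_power[of "Suc k'"]
      unfolding C(3) by (auto simp: label_trace_centre label_trace_C label_trace_twist simp del: power_Suc)
  next
    case (D k')
    then show ?thesis using conjugate_invariants(1)[OF cb] sign_power[of "Suc k"] sign_power[of k']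
      unfolding D(2) by (auto simp: label_trace_centre label_trace_D label_trace_twist simp del: power_Suc)
  qed
next
  case cc: (C k w)
  show ?thesis using W'
  proof (cases rule: std_cycle_cases)
    case (A k' us)
    then show ?thesis
      using conjugate_invariants(1)[OF c] label_trace_cycle_value[OF A(1,2)] sign_power[of "Suc k"] sign_power[of k'] cc(1)
      unfolding A(4) cc(3) by (auto simp: label_trace_centre label_trace_C simp del: power_Suc)
  next
    case (B k' w')
    then show ?thesis
      using conjugate_invariants(1)[OF conjugate_trans[OF c B(3)]] sign_power[of "Suc k"] sign_power[of "Suc k'"] cc(1)
      unfolding cc(3) by (auto simp: label_trace_centre label_trace_C label_trace_twist simp del: power_Suc)
  next
    case (C k' w')
    have "w = w'" using conjugate_invariants(1)[OF c] cc(1) C(1) sign_power[of "Suc k"] sign_power[of "Suc k'"]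
      unfolding cc(3) C(3) by (auto simp: label_trace_centre label_trace_C simp del: power_Suc)
    moreover have "k = k'" using conjugate_invariants(2)[OF c] calculation
      unfolding cc(3) C(3) by (simp add: exponent_centre exponent_C)
    moreover have "same_cycle W W"
    proof (cases "w = 0")
      case True
      then have "W = zeros (2 * Suc k + 1) @ []" using cc(2) by (simp add: replicate_append_same)
      then show ?thesis using same_cycle_refl[of "[]" "2 * Suc k + 1"] by simp
    next
      case False
      then show ?thesis using same_cycle_refl[of "[w]" "2 * Suc k"] unfolding cc(2) by simp
    qed
    ultimately show ?thesis using cc(2) C(2) by simp
  next
    case (D k')
    \<comment> \<open>Traces 1 and -1 agree up to the central sign, so the exponent has to decide:
      modulo 6 it is w + 3, that is 2 or 3, against 4.\<close>
    have "6 * int (Suc k) + w + 3 = 6 * int k' + 4"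
      using conjugate_invariants(2)[OF c] unfolding cc(3) D(2) by (simp add: exponent_centre exponent_C exponent_D)
    then have False using cc(1) by presburger
    then show ?thesis ..
  qed
next
  case d: (D k)
  show ?thesis using W'
  proof (cases rule: std_cycle_cases)
    case (A k' us)
    then show ?thesis
      using conjugate_invariants(1)[OF c] label_trace_cycle_value[OF A(1,2)] sign_power[of k] sign_power[of k']
      unfolding A(4) d(2) by (auto simp: label_trace_centre label_trace_D simp del: power_Suc)
  next
    case (B k' w')
    then show ?thesis
      using conjugate_invariants(1)[OF conjugate_trans[OF c B(3)]] sign_power[of k] sign_power[of "Suc k'"]
      unfolding d(2) by (auto simp: label_trace_centre label_trace_D label_trace_twist simp del: power_Suc)
  next
    case (C k' w)
    have "6 * int (Suc k') + w + 3 = 6 * int k + 4"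
      using conjugate_invariants(2)[OF c] unfolding C(3) d(2) by (simp add: exponent_centre exponent_C exponent_D)
    then have False using C(1) by presburger
    then show ?thesis ..
  next
    case (D k')
    have "k = k'" using conjugate_invariants(2)[OF c] unfolding d(2) D(2) by (simp add: exponent_centre exponent_D)
    then show ?thesis using d(1) D(1) same_cycle_refl[of "[-1,-1]" "2 * k"] by simp
  qed
qed

section \<open>Labelled dart graphs\<close>

text \<open>Edges are pairs of darts exchanged by \<open>mate\<close>. A dart with \<open>mate X d = d\<close> is a leg, an open
  end labelled by the chain it replaces.\<close>

record ('v, 'd) dart_graph =
  nodes :: "'v set"
  darts :: "'d set"
  base :: "'d \<Rightarrow> 'v"
  mate :: "'d \<Rightarrow> 'd"
  eff :: "'v \<Rightarrow> int"
  lab :: "'d \<Rightarrow> label"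

definition darts_at :: "('v, 'd) dart_graph \<Rightarrow> 'v \<Rightarrow> 'd set" where
  "darts_at X v = {d \<in> darts X. base X d = v}"

text \<open>A leg is read only outwards from its base, so its label need not be symmetric under
  \<open>reversal\<close>.\<close>

definition wf_dart_graph :: "('v, 'd) dart_graph \<Rightarrow> bool" where
  "wf_dart_graph X \<longleftrightarrow> finite (nodes X) \<and> finite (darts X) \<and> nodes X \<noteq> {} \<and>
     (\<forall>d\<in>darts X. base X d \<in> nodes X \<and> mate X d \<in> darts X \<and> mate X (mate X d) = d \<and>
        label_det (lab X d) = 1 \<and> (mate X d \<noteq> d \<longrightarrow> lab X (mate X d) = reversal (lab X d))) \<and>
     (\<forall>v\<in>nodes X. 2 \<le> card (darts_at X v))"

text \<open>Stated through closed sets of nodes instead of paths of darts, which behaves better when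
  nodes are removed.\<close>

definition connected_dart_graph :: "('v, 'd) dart_graph \<Rightarrow> bool" where
  "connected_dart_graph X \<longleftrightarrow>
     (\<forall>U. U \<subseteq> nodes X \<and> U \<noteq> {} \<and> (\<forall>d\<in>darts X. base X d \<in> U \<longrightarrow> base X (mate X d) \<in> U)
        \<longrightarrow> U = nodes X)"

text \<open>Excluded are a loop at v and two legs at v: removing v would leave an edge or a segment
  without any node.\<close>

definition can_merge :: "('v, 'd) dart_graph \<Rightarrow> 'v \<Rightarrow> 'd \<Rightarrow> 'd \<Rightarrow> bool" where
  "can_merge X v a b \<longleftrightarrow> v \<in> nodes X \<and> darts_at X v = {a, b} \<and> a \<noteq> b \<and> mate X a \<noteq> b \<and>
     \<not> (mate X a = a \<and> mate X b = b)"

text \<open>The far dart of one side is matched with the far dart of the other; if the other side is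
  a leg, it becomes a leg itself.\<close>

definition merge :: "('v, 'd) dart_graph \<Rightarrow> 'v \<Rightarrow> 'd \<Rightarrow> 'd \<Rightarrow> ('v, 'd) dart_graph" where
  "merge X v a b = X
     \<lparr>nodes := nodes X - {v}, darts := darts X - {a, b},
      mate := (\<lambda>d. if mate X d = a then (if mate X b = b then d else mate X b)
                   else if mate X d = b then (if mate X a = a then d else mate X a)
                   else mate X d),
      lab := (\<lambda>d. if mate X d = a then lab X d * twist (eff X v) * lab X b
                  else if mate X d = b then lab X d * twist (eff X v) * lab X a
                  else lab X d)\<rparr>"

text \<open>Valence at least 3 leaves valence at least 2 behind. The power m sits at the free end
  and is arbitrary, while j sits at the node and is added to its weight by
  \<open>prune\<close>.\<close>

definition can_prune :: "('v, 'd) dart_graph \<Rightarrow> 'd \<Rightarrow> int \<Rightarrow> bool" where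
  "can_prune X d j \<longleftrightarrow> d \<in> darts X \<and> mate X d = d \<and> 3 \<le> card (darts_at X (base X d)) \<and>
     (\<exists>m. lab X d = twist j * turn * twist m)"

definition prune :: "('v, 'd) dart_graph \<Rightarrow> 'd \<Rightarrow> int \<Rightarrow> ('v, 'd) dart_graph" where
  "prune X d j = X\<lparr>darts := darts X - {d}, eff := (eff X)(base X d := eff X (base X d) + j)\<rparr>"

inductive step :: "('v, 'd) dart_graph \<Rightarrow> ('v, 'd) dart_graph \<Rightarrow> bool" where
  merge: "can_merge X v a b \<Longrightarrow> step X (merge X v a b)"
| prune: "can_prune X d j \<Longrightarrow> step X (prune X d j)"

lemma wfD:
  assumes "wf_dart_graph X"
  shows "finite (nodes X)" "finite (darts X)" "nodes X \<noteq> {}"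
    "d \<in> darts X \<Longrightarrow> base X d \<in> nodes X" "d \<in> darts X \<Longrightarrow> mate X d \<in> darts X"
    "d \<in> darts X \<Longrightarrow> mate X (mate X d) = d" "d \<in> darts X \<Longrightarrow> label_det (lab X d) = 1"
    "d \<in> darts X \<Longrightarrow> mate X d \<noteq> d \<Longrightarrow> lab X (mate X d) = reversal (lab X d)"
    "v \<in> nodes X \<Longrightarrow> 2 \<le> card (darts_at X v)"
  using assms unfolding wf_dart_graph_def by blast+

lemma merge_simps [simp]:
  "nodes (merge X v a b) = nodes X - {v}" "darts (merge X v a b) = darts X - {a, b}"
  "base (merge X v a b) = base X" "eff (merge X v a b) = eff X"
  by (simp_all add: merge_def)

lemma mate_merge: "mate (merge X v a b) d =
   (if mate X d = a then (if mate X b = b then d else mate X b)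
    else if mate X d = b then (if mate X a = a then d else mate X a) else mate X d)"
  by (simp add: merge_def)

lemma lab_merge: "lab (merge X v a b) d =
   (if mate X d = a then lab X d * twist (eff X v) * lab X b
    else if mate X d = b then lab X d * twist (eff X v) * lab X a else lab X d)"
  by (simp add: merge_def)

lemma prune_simps [simp]:
  "nodes (prune X d j) = nodes X" "darts (prune X d j) = darts X - {d}"
  "base (prune X d j) = base X" "mate (prune X d j) = mate X" "lab (prune X d j) = lab X"
  "eff (prune X d j) = (eff X)(base X d := eff X (base X d) + j)"
  by (simp_all add: prune_def)

lemma merge_commute_ab: "a \<noteq> b \<Longrightarrow> merge X v a b = merge X v b a"
  unfolding merge_def by (intro dart_graph.equality) (auto simp: fun_eq_iff)

lemma can_merge_commute_ab: "wf_dart_graph X \<Longrightarrow> can_merge X v a b \<Longrightarrow> can_merge X v b a"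
  unfolding can_merge_def darts_at_def wf_dart_graph_def by (auto simp: insert_commute)

lemma can_mergeD:
  assumes "can_merge X v a b"
  shows "v \<in> nodes X" "darts_at X v = {a, b}" "a \<noteq> b" "mate X a \<noteq> b"
    "\<not> (mate X a = a \<and> mate X b = b)" "a \<in> darts X" "b \<in> darts X" "base X a = v" "base X b = v"
  using assms unfolding can_merge_def darts_at_def by auto

lemma darts_at_merge:
  assumes "can_merge X v a b"
  shows "darts_at (merge X v a b) u = (if u = v then {} else darts_at X u)"
proof -
  have "darts_at (merge X v a b) u = darts_at X u - {a, b}"
    unfolding darts_at_def by auto
  moreover have "darts_at X u \<inter> {a, b} = {}" if "u \<noteq> v"
    using can_mergeD(8,9)[OF assms] that unfolding darts_at_def by auto
  ultimately show ?thesis using can_mergeD(2)[OF assms] by auto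
qed

lemma wf_merge:
  assumes wf: "wf_dart_graph X" and cm: "can_merge X v a b"
  shows "wf_dart_graph (merge X v a b)"
proof -
  note m = can_mergeD[OF cm]
  let ?Y = "merge X v a b"
  have inv: "mate X d = e \<longleftrightarrow> d = mate X e" if "d \<in> darts X" "e \<in> darts X" for d e
    using wfD(6)[OF wf] that by metis
  have ba: "mate X b \<noteq> a" using m inv by metis
  have "nodes X - {v} \<noteq> {}"
  proof -
    have "base X (mate X a) \<noteq> v \<or> base X (mate X b) \<noteq> v"
    proof (rule ccontr)
      assume "\<not> ?thesis"
      then have "mate X a \<in> {a, b}" "mate X b \<in> {a, b}"
        using m(2) wfD(5)[OF wf] m(6,7) unfolding darts_at_def by auto
      then show False using m ba by auto
    qed
    then show ?thesis using wfD(4,5)[OF wf] m(6,7) by blast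
  qed
  moreover have "base X d \<in> nodes X - {v} \<and> mate ?Y d \<in> darts X - {a, b} \<and> mate ?Y (mate ?Y d) = d \<and>
     label_det (lab ?Y d) = 1 \<and> (mate ?Y d \<noteq> d \<longrightarrow> lab ?Y (mate ?Y d) = reversal (lab ?Y d))"
    if d: "d \<in> darts X - {a, b}" for d
  proof -
    have dX: "d \<in> darts X" using d by simp
    have "d \<notin> darts_at X v" using d m(2) by simp
    then have 1: "base X d \<in> nodes X - {v}"
      using d wfD(4)[OF wf dX] unfolding darts_at_def by simp
    have 2: "label_det (lab ?Y d) = 1"
      using wfD(7)[OF wf] dX m(6,7) by (simp add: lab_merge)
    consider "mate X d = a" | "mate X d = b" | "mate X d \<noteq> a" "mate X d \<noteq> b" by blast
    then show ?thesis
    proof cases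
      case 1
      then have da: "d = mate X a" using inv dX m(6) by blast
      have la: "lab X a = reversal (lab X d)" using wfD(8)[OF wf dX] 1 d by auto
      show ?thesis
      proof (cases "mate X b = b")
        case True
        then show ?thesis using \<open>base X d \<in> _\<close> 2 1 d by (auto simp: mate_merge)
      next
        case False
        have db: "mate X b \<in> darts X - {a, b}" using False ba wfD(5)[OF wf m(7)] by auto
        have mb: "mate X (mate X b) = b" using wfD(6)[OF wf m(7)] .
        have lb: "lab X (mate X b) = reversal (lab X b)" using wfD(8)[OF wf m(7) False] .
        have ne: "mate X b \<noteq> d" using da wfD(6)[OF wf m(6)] wfD(6)[OF wf m(7)] m(3) by metis
        show ?thesis using \<open>base X d \<in> _\<close> 2 1 d db mb lb la da m False
          by (auto simp: mate_merge lab_merge mult.assoc)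
      qed
    next
      case 2
      then have db: "d = mate X b" using inv dX m(7) by blast
      have lb: "lab X b = reversal (lab X d)" using wfD(8)[OF wf dX] 2 d by auto
      show ?thesis
      proof (cases "mate X a = a")
        case True
        then show ?thesis using \<open>base X d \<in> _\<close> \<open>label_det _ = 1\<close> 2 d m by (auto simp: mate_merge)
      next
        case False
        have da: "mate X a \<in> darts X - {a, b}" using False m wfD(5)[OF wf m(6)] by auto
        have ma: "mate X (mate X a) = a" using wfD(6)[OF wf m(6)] .
        have la: "lab X (mate X a) = reversal (lab X a)" using wfD(8)[OF wf m(6) False] .
        show ?thesis using \<open>base X d \<in> _\<close> \<open>label_det _ = 1\<close> 2 d db ma lb la da m False
          by (auto simp: mate_merge lab_merge mult.assoc)
      qed
    next
      case 3
      have "mate X d \<in> darts X" "mate X (mate X d) = d" using wfD(5,6)[OF wf dX] by auto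
      then show ?thesis using 1 2 3 d wfD(8)[OF wf dX]
        by (auto simp: mate_merge lab_merge)
    qed
  qed
  moreover have "2 \<le> card (darts_at ?Y u)" if "u \<in> nodes X - {v}" for u
    using that darts_at_merge[OF cm, of u] wfD(9)[OF wf, of u] by simp
  ultimately show ?thesis
    using wfD(1,2)[OF wf] unfolding wf_dart_graph_def by simp
qed

lemma darts_at_prune: "darts_at (prune X d j) u = darts_at X u - {d}"
  unfolding darts_at_def by auto

lemma can_pruneD:
  assumes "can_prune X d j"
  shows "d \<in> darts X" "mate X d = d" "3 \<le> card (darts_at X (base X d))" "\<exists>m. lab X d = twist j * turn * twist m"
    "d \<in> darts_at X (base X d)"
  using assms unfolding can_prune_def darts_at_def by auto

lemma finite_darts_at: "wf_dart_graph X \<Longrightarrow> finite (darts_at X v)"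
  by (simp add: darts_at_def wfD(2))

lemma card_darts_at_prune:
  assumes "wf_dart_graph X" "can_prune X d j"
  shows "card (darts_at (prune X d j) u) = (if u = base X d then card (darts_at X u) - 1 else card (darts_at X u))"
proof (cases "u = base X d")
  case True
  then show ?thesis using can_pruneD(5)[OF assms(2)] by (simp add: darts_at_prune)
next
  case False
  then have "d \<notin> darts_at X u" unfolding darts_at_def by auto
  then show ?thesis using False by (simp add: darts_at_prune)
qed

lemma wf_prune:
  assumes wf: "wf_dart_graph X" and cp: "can_prune X d j"
  shows "wf_dart_graph (prune X d j)"
proof -
  note p = can_pruneD[OF cp]
  have "mate X e \<noteq> d" if "e \<in> darts X" "e \<noteq> d" for e
    using wfD(6)[OF wf that(1)] p(2) that by metis
  then show ?thesis
    using wf card_darts_at_prune[OF wf cp] p(3)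
    unfolding wf_dart_graph_def by auto
qed

lemma wf_step: "step X Y \<Longrightarrow> wf_dart_graph X \<Longrightarrow> wf_dart_graph Y"
  by (cases rule: step.cases) (auto intro: wf_merge wf_prune)

lemma connected_merge_iff:
  assumes wf: "wf_dart_graph X" and cm: "can_merge X v a b"
  shows "connected_dart_graph (merge X v a b) \<longleftrightarrow> connected_dart_graph X"
proof -
  note m = can_mergeD[OF cm]
  let ?Y = "merge X v a b"
  have wfY: "wf_dart_graph ?Y" by (rule wf_merge[OF wf cm])
  have inv: "mate X d = e \<longleftrightarrow> d = mate X e" if "d \<in> darts X" "e \<in> darts X" for d e
    using wfD(6)[OF wf] that by metis
  have ba: "mate X b \<noteq> a" using m inv by metis
  have basev: "base X d = v \<longleftrightarrow> d = a \<or> d = b" if "d \<in> darts X" for d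
    using m(2) that unfolding darts_at_def by blast
  show ?thesis
  proof
    assume conn: "connected_dart_graph ?Y"
    show "connected_dart_graph X"
      unfolding connected_dart_graph_def
    proof (intro allI impI, elim conjE)
      fix U assume U: "U \<subseteq> nodes X" "U \<noteq> {}" and cl: "\<forall>d\<in>darts X. base X d \<in> U \<longrightarrow> base X (mate X d) \<in> U"
      have cl': "base X d \<in> U \<longleftrightarrow> base X (mate X d) \<in> U" if "d \<in> darts X" for d
        using cl wfD(5,6)[OF wf that] that by metis
      have "base ?Y (mate ?Y d) \<in> U - {v}" if "d \<in> darts ?Y" "base ?Y d \<in> U - {v}" for d
      proof -
        have d: "d \<in> darts X" "base X d \<in> U" using that by auto
        have md: "base X (mate X d) \<in> U" using cl d by blast
        have "base X (mate X b) \<in> U" if "mate X d = a"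
          using cl'[OF m(7)] m(8,9) md that by simp
        moreover have "base X (mate X a) \<in> U" if "mate X d = b"
          using cl'[OF m(6)] m(8,9) md that by simp
        ultimately have "base X (mate ?Y d) \<in> U"
          using d md unfolding mate_merge by (auto split: if_splits)
        moreover have "base ?Y (mate ?Y d) \<in> nodes ?Y" using wfD(4,5)[OF wfY] that(1) by blast
        ultimately show ?thesis by simp
      qed
      moreover have "U - {v} \<noteq> {}"
      proof
        assume "U - {v} = {}"
        then have "U = {v}" using U by auto
        then have "base X (mate X a) = v" "base X (mate X b) = v"
          using cl m(6-9) by auto
        then have "mate X a \<in> {a, b}" "mate X b \<in> {a, b}" using basev wfD(5)[OF wf] m(6,7) by auto
        then show False using m(4,5) ba by blast
      qed
      ultimately have Ueq: "U - {v} = nodes X - {v}"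
        using conn U(1) unfolding connected_dart_graph_def merge_simps
        by (metis (no_types, lifting) Diff_mono subset_refl)
      have "v \<in> U"
      proof -
        obtain c where c: "c = a \<or> c = b" "mate X c \<noteq> c" using m(5) by blast
        then have "mate X c \<noteq> a" "mate X c \<noteq> b" using m(4) ba by auto
        then have "base X (mate X c) \<in> nodes X - {v}"
          using c m(6,7) basev wfD(4,5)[OF wf] by auto
        then have "base X (mate X c) \<in> U" using Ueq by auto
        then show ?thesis using cl' c m(6-9) by metis
      qed
      then show "U = nodes X" using Ueq m(1) U by auto
    qed
  next
    assume conn: "connected_dart_graph X"
    show "connected_dart_graph ?Y"
      unfolding connected_dart_graph_def
    proof (intro allI impI, elim conjE)
      fix U assume U: "U \<subseteq> nodes ?Y" "U \<noteq> {}"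
        and cl: "\<forall>d\<in>darts ?Y. base ?Y d \<in> U \<longrightarrow> base ?Y (mate ?Y d) \<in> U"
      have cl': "base ?Y d \<in> U \<longleftrightarrow> base ?Y (mate ?Y d) \<in> U" if "d \<in> darts ?Y" for d
        using cl wfD(5,6)[OF wfY that] that by metis
      \<comment> \<open>A closed set after the merge extends to one before it by adding v exactly
        when a neighbour of v belongs to it; if v has two neighbouring edge ends, these agree by
        \<open>far\<close>.\<close>
      define A where "A = (if (mate X a \<noteq> a \<and> base X (mate X a) \<in> U) \<or> (mate X b \<noteq> b \<and> base X (mate X b) \<in> U) then {v} else {})"
      have far: "base X (mate X a) \<in> U \<longleftrightarrow> base X (mate X b) \<in> U" if "mate X a \<noteq> a" "mate X b \<noteq> b"
      proof -
        have "mate X a \<in> darts ?Y" using that m wfD(5)[OF wf m(6)] by auto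
        moreover have "mate ?Y (mate X a) = mate X b"
          using that wfD(6)[OF wf m(6)] by (simp add: mate_merge)
        ultimately show ?thesis using cl' by fastforce
      qed
      have vU: "v \<notin> U" using U by auto
      have "base X (mate X d) \<in> U \<union> A" if d: "d \<in> darts X" "base X d \<in> U \<union> A" for d
      proof (cases "d = a \<or> d = b")
        case True
        then have Av: "A = {v}" using d(2) vU m(8,9) by (auto simp: A_def split: if_splits)
        show ?thesis
        proof (cases "mate X d = d")
          case True
          then show ?thesis using d(2) by simp
        next
          case False
          have "(mate X a \<noteq> a \<and> base X (mate X a) \<in> U) \<or> (mate X b \<noteq> b \<and> base X (mate X b) \<in> U)"
            using Av unfolding A_def by (metis insert_not_empty)
          then have "base X (mate X d) \<in> U \<or> base X (mate X d) = v"
            using False True far m(8,9) by metis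
          then show ?thesis using Av by blast
        qed
      next
        case False
        then have dU: "base X d \<in> U" using d basev[OF d(1)] by (auto simp: A_def split: if_splits)
        have dY: "d \<in> darts ?Y" using d False by auto
        show ?thesis
        proof (cases "mate X d = a \<or> mate X d = b")
          case True
          then have "(mate X a \<noteq> a \<and> base X (mate X a) \<in> U) \<or> (mate X b \<noteq> b \<and> base X (mate X b) \<in> U)"
            using inv d(1) m(6,7) dU False by metis
          then show ?thesis using True m(8,9) by (auto simp: A_def)
        next
          case f: False
          then show ?thesis using cl dY dU by (auto simp: mate_merge)
        qed
      qed
      moreover have "U \<union> A \<subseteq> nodes X" using U m(1) by (auto simp: A_def)
      ultimately have "U \<union> A = nodes X" using conn U(2)
        unfolding connected_dart_graph_def by blast
      then show "U = nodes ?Y" using U vU by (auto simp: A_def split: if_splits)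
    qed
  qed
qed

lemma connected_prune_iff:
  assumes wf: "wf_dart_graph X" and cp: "can_prune X d j"
  shows "connected_dart_graph (prune X d j) \<longleftrightarrow> connected_dart_graph X"
proof -
  have "(\<forall>e\<in>darts X - {d}. base X e \<in> U \<longrightarrow> base X (mate X e) \<in> U) \<longleftrightarrow>
     (\<forall>e\<in>darts X. base X e \<in> U \<longrightarrow> base X (mate X e) \<in> U)" for U
    using can_pruneD(2)[OF cp] by fastforce
  then show ?thesis unfolding connected_dart_graph_def prune_simps by simp
qed

lemma connected_step_iff:
  "step X Y \<Longrightarrow> wf_dart_graph X \<Longrightarrow> connected_dart_graph Y \<longleftrightarrow> connected_dart_graph X"
  by (cases rule: step.cases) (auto simp: connected_merge_iff connected_prune_iff)


section \<open>Gauge equivalence\<close>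

text \<open>The integers \<open>k d\<close> move twists between the labels and the weights of the nodes. The label of
  a leg matters only up to a twist at its free end, since an outer blowup at an end vertex
  changes it by such a twist.\<close>

definition sim_via ::
  "('v, 'd) dart_graph \<Rightarrow> ('w, 'e) dart_graph \<Rightarrow> ('v \<Rightarrow> 'w) \<Rightarrow> ('d \<Rightarrow> 'e) \<Rightarrow> ('d \<Rightarrow> int) \<Rightarrow> bool" where
  "sim_via X Y \<phi> \<psi> k \<longleftrightarrow> bij_betw \<phi> (nodes X) (nodes Y) \<and> bij_betw \<psi> (darts X) (darts Y) \<and>
     (\<forall>d\<in>darts X. base Y (\<psi> d) = \<phi> (base X d) \<and> mate Y (\<psi> d) = \<psi> (mate X d) \<and>
        (mate X d = d \<longrightarrow> (\<exists>m. lab Y (\<psi> d) = twist (- k d) * lab X d * twist m)) \<and>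
        (mate X d \<noteq> d \<longrightarrow> lab Y (\<psi> d) = twist (- k d) * lab X d * twist (- k (mate X d)))) \<and>
     (\<forall>v\<in>nodes X. eff Y (\<phi> v) = eff X v + (\<Sum>d\<in>darts_at X v. k d))"

definition sim :: "('v, 'd) dart_graph \<Rightarrow> ('w, 'e) dart_graph \<Rightarrow> bool" where
  "sim X Y \<longleftrightarrow> (\<exists>\<phi> \<psi> k. sim_via X Y \<phi> \<psi> k)"

lemma sim_viaD:
  assumes "sim_via X Y \<phi> \<psi> k"
  shows "bij_betw \<phi> (nodes X) (nodes Y)" "bij_betw \<psi> (darts X) (darts Y)"
    "d \<in> darts X \<Longrightarrow> base Y (\<psi> d) = \<phi> (base X d)" "d \<in> darts X \<Longrightarrow> mate Y (\<psi> d) = \<psi> (mate X d)"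
    "d \<in> darts X \<Longrightarrow> mate X d = d \<Longrightarrow> \<exists>m. lab Y (\<psi> d) = twist (- k d) * lab X d * twist m"
    "d \<in> darts X \<Longrightarrow> mate X d \<noteq> d \<Longrightarrow> lab Y (\<psi> d) = twist (- k d) * lab X d * twist (- k (mate X d))"
    "v \<in> nodes X \<Longrightarrow> eff Y (\<phi> v) = eff X v + (\<Sum>d\<in>darts_at X v. k d)"
  using assms unfolding sim_via_def by blast+

lemma sim_via_inj:
  assumes "sim_via X Y \<phi> \<psi> k"
  shows "d \<in> darts X \<Longrightarrow> e \<in> darts X \<Longrightarrow> \<psi> d = \<psi> e \<longleftrightarrow> d = e"
    "u \<in> nodes X \<Longrightarrow> v \<in> nodes X \<Longrightarrow> \<phi> u = \<phi> v \<longleftrightarrow> u = v"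
    "d \<in> darts X \<Longrightarrow> \<psi> d \<in> darts Y" "u \<in> nodes X \<Longrightarrow> \<phi> u \<in> nodes Y"
  using sim_viaD(1,2)[OF assms] unfolding bij_betw_def inj_on_def by blast+

lemma darts_at_sim:
  assumes wf: "wf_dart_graph X" and s: "sim_via X Y \<phi> \<psi> k" and v: "v \<in> nodes X"
  shows "darts_at Y (\<phi> v) = \<psi> ` darts_at X v"
proof -
  have "darts Y = \<psi> ` darts X" using sim_viaD(2)[OF s] by (simp add: bij_betw_def)
  then show ?thesis
    using sim_viaD(3)[OF s] sim_via_inj(2)[OF s _ v] wfD(4)[OF wf]
    unfolding darts_at_def by auto
qed

lemma inj_on_darts_at: "sim_via X Y \<phi> \<psi> k \<Longrightarrow> inj_on \<psi> (darts_at X v)"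
  using sim_viaD(2) unfolding bij_betw_def darts_at_def by (metis (no_types, lifting) inj_on_subset mem_Collect_eq subsetI)

lemma sim_agree:
  assumes "nodes X = nodes Y" "darts X = darts Y"
    and "\<And>d. d \<in> darts X \<Longrightarrow> base X d = base Y d \<and> mate X d = mate Y d"
    and "\<And>d. d \<in> darts X \<Longrightarrow> lab X d = lab Y d \<or> (mate X d = d \<and> (\<exists>m. lab Y d = lab X d * twist m))"
    and "\<And>v. v \<in> nodes X \<Longrightarrow> eff X v = eff Y v"
  shows "sim X Y"
proof -
  have "sim_via X Y id id (\<lambda>_. 0)"
    unfolding sim_via_def
    using assms by (auto intro: exI[of _ 0]) (metis twist_0 mult.right_neutral)+
  then show ?thesis unfolding sim_def by blast
qed

lemma sim_refl: "sim X X" by (rule sim_agree) auto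

lemma sim_sym:
  assumes wf: "wf_dart_graph X" and "sim X Y"
  shows "sim Y X"
proof -
  obtain \<phi> \<psi> k where s: "sim_via X Y \<phi> \<psi> k" using assms(2) unfolding sim_def by blast
  define \<phi>' where "\<phi>' = the_inv_into (nodes X) \<phi>"
  define \<psi>' where "\<psi>' = the_inv_into (darts X) \<psi>"
  have i: "inj_on \<phi> (nodes X)" "inj_on \<psi> (darts X)"
    and im: "nodes Y = \<phi> ` nodes X" "darts Y = \<psi> ` darts X"
    using sim_viaD(1,2)[OF s] by (simp_all add: bij_betw_def)
  have f: "\<phi>' (\<phi> v) = v" if "v \<in> nodes X" for v
    using that i by (simp add: \<phi>'_def the_inv_into_f_f)
  have g: "\<psi>' (\<psi> d) = d" if "d \<in> darts X" for d
    using that i by (simp add: \<psi>'_def the_inv_into_f_f)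
  have "sim_via Y X \<phi>' \<psi>' (\<lambda>d. - k (\<psi>' d))"
    unfolding sim_via_def
  proof (intro conjI ballI impI)
    show "bij_betw \<phi>' (nodes Y) (nodes X)" "bij_betw \<psi>' (darts Y) (darts X)"
      using sim_viaD(1,2)[OF s] unfolding \<phi>'_def \<psi>'_def by (simp_all add: bij_betw_the_inv_into)
  next
    fix e assume "e \<in> darts Y"
    then obtain d where d: "d \<in> darts X" "e = \<psi> d" using im by auto
    note D = wfD(4,5)[OF wf d(1)] sim_viaD(3,4)[OF s d(1)] g[OF d(1)]
    show "base X (\<psi>' e) = \<phi>' (base Y e)" "mate X (\<psi>' e) = \<psi>' (mate Y e)"
      using D f g d(2) by simp_all
    show "\<exists>m. lab X (\<psi>' e) = twist (- (- k (\<psi>' e))) * lab Y e * twist m" if "mate Y e = e"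
    proof -
      have "mate X d = d" using that D d g by metis
      then obtain m where "lab Y e = twist (- k d) * lab X d * twist m"
        using sim_viaD(5)[OF s d(1)] d(2) by blast
      then show ?thesis using D d(2)
        by (intro exI[of _ "- m"]) (simp add: mult.assoc twist_twist twist_twist_left)
    qed
    show "lab X (\<psi>' e) = twist (- (- k (\<psi>' e))) * lab Y e * twist (- (- k (\<psi>' (mate Y e))))" if "mate Y e \<noteq> e"
    proof -
      have "mate X d \<noteq> d" using that D d by metis
      then have "lab Y e = twist (- k d) * lab X d * twist (- k (mate X d))"
        using sim_viaD(6)[OF s d(1)] d(2) by blast
      then show ?thesis using D d(2) g[of "mate X d"]
        by (simp add: mult.assoc twist_twist twist_twist_left)
    qed
  next
    fix w assume "w \<in> nodes Y"
    then obtain v where v: "v \<in> nodes X" "w = \<phi> v" using im by auto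
    have "(\<Sum>e\<in>darts_at Y w. - k (\<psi>' e)) = (\<Sum>d\<in>darts_at X v. - k (\<psi>' (\<psi> d)))"
      using darts_at_sim[OF wf s v(1)] inj_on_darts_at[OF s] v(2) by (simp add: sum.reindex)
    also have "\<dots> = (\<Sum>d\<in>darts_at X v. - k d)"
      by (rule sum.cong) (auto simp: g darts_at_def)
    finally show "eff X (\<phi>' w) = eff Y w + (\<Sum>e\<in>darts_at Y w. - k (\<psi>' e))"
      using sim_viaD(7)[OF s v(1)] v f by (simp add: sum_negf)
  qed
  then show ?thesis unfolding sim_def by blast
qed

lemma sim_trans:
  assumes wf: "wf_dart_graph X" and "sim X Y" "sim Y W"
  shows "sim X W"
proof -
  obtain \<phi> \<psi> k where s: "sim_via X Y \<phi> \<psi> k" using assms(2) unfolding sim_def by blast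
  obtain \<phi>' \<psi>' k' where s': "sim_via Y W \<phi>' \<psi>' k'" using assms(3) unfolding sim_def by blast
  have "sim_via X W (\<phi>' \<circ> \<phi>) (\<psi>' \<circ> \<psi>) (\<lambda>d. k d + k' (\<psi> d))"
    unfolding sim_via_def
  proof (intro conjI ballI impI)
    show "bij_betw (\<phi>' \<circ> \<phi>) (nodes X) (nodes W)" "bij_betw (\<psi>' \<circ> \<psi>) (darts X) (darts W)"
      using sim_viaD(1,2)[OF s] sim_viaD(1,2)[OF s'] bij_betw_trans by blast+
  next
    fix d assume d: "d \<in> darts X"
    note D = sim_viaD(3,4)[OF s d] sim_via_inj(3)[OF s d]
    note E = sim_viaD(3,4)[OF s' D(3)]
    show "base W ((\<psi>' \<circ> \<psi>) d) = (\<phi>' \<circ> \<phi>) (base X d)" "mate W ((\<psi>' \<circ> \<psi>) d) = (\<psi>' \<circ> \<psi>) (mate X d)"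
      using D E by simp_all
    have iff: "mate Y (\<psi> d) = \<psi> d \<longleftrightarrow> mate X d = d"
      using D sim_via_inj(1)[OF s] wfD(5)[OF wf d] d by metis
    show "\<exists>m. lab W ((\<psi>' \<circ> \<psi>) d) = twist (- (k d + k' (\<psi> d))) * lab X d * twist m" if l: "mate X d = d"
    proof -
      obtain m where "lab Y (\<psi> d) = twist (- k d) * lab X d * twist m" using sim_viaD(5)[OF s d l] by blast
      moreover obtain m' where "lab W (\<psi>' (\<psi> d)) = twist (- k' (\<psi> d)) * lab Y (\<psi> d) * twist m'"
        using sim_viaD(5)[OF s' D(3)] iff l by blast
      ultimately show ?thesis
        by (intro exI[of _ "m + m'"]) (simp add: mult.assoc twist_twist twist_twist_left algebra_simps)
    qed
    show "lab W ((\<psi>' \<circ> \<psi>) d) = twist (- (k d + k' (\<psi> d))) * lab X d * twist (- (k (mate X d) + k' (\<psi> (mate X d))))"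
      if l: "mate X d \<noteq> d"
      using sim_viaD(6)[OF s d l] sim_viaD(6)[OF s' D(3)] iff l D
      by (simp add: mult.assoc twist_twist twist_twist_left algebra_simps)
  next
    fix v assume v: "v \<in> nodes X"
    have "(\<Sum>e\<in>darts_at Y (\<phi> v). k' e) = (\<Sum>d\<in>darts_at X v. k' (\<psi> d))"
      using darts_at_sim[OF wf s v] inj_on_darts_at[OF s] by (simp add: sum.reindex)
    then show "eff W ((\<phi>' \<circ> \<phi>) v) = eff X v + (\<Sum>d\<in>darts_at X v. k d + k' (\<psi> d))"
      using sim_viaD(7)[OF s v] sim_viaD(7)[OF s' sim_via_inj(4)[OF s v]] by (simp add: sum.distrib)
  qed
  then show ?thesis unfolding sim_def by blast
qed

lemma bij_betw_remove: "bij_betw f A B \<Longrightarrow> C \<subseteq> A \<Longrightarrow> bij_betw f (A - C) (B - f ` C)"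
  unfolding bij_betw_def by (auto simp: inj_on_def)

lemma sim_merge:
  assumes wf: "wf_dart_graph X" and s: "sim_via X Y \<phi> \<psi> k" and cm: "can_merge X v a b"
  shows "can_merge Y (\<phi> v) (\<psi> a) (\<psi> b)" "sim_via (merge X v a b) (merge Y (\<phi> v) (\<psi> a) (\<psi> b)) \<phi> \<psi> k"
proof -
  note m = can_mergeD[OF cm]
  note inj = sim_via_inj(1)[OF s]
  have mt: "mate Y (\<psi> d) = \<psi> (mate X d)" if "d \<in> darts X" for d using sim_viaD(4)[OF s that] .
  have md: "mate X d \<in> darts X" if "d \<in> darts X" for d using wfD(5)[OF wf that] .
  show cmY: "can_merge Y (\<phi> v) (\<psi> a) (\<psi> b)"
    unfolding can_merge_def
    using darts_at_sim[OF wf s m(1)] m sim_via_inj(4)[OF s m(1)] mt[OF m(6)] mt[OF m(7)] inj md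
    by auto
  let ?X = "merge X v a b" and ?Y = "merge Y (\<phi> v) (\<psi> a) (\<psi> b)"
  have bij: "bij_betw \<phi> (nodes X - {v}) (nodes Y - {\<phi> v})"
    using bij_betw_remove[OF sim_viaD(1)[OF s], of "{v}"] m(1) by simp
  have bij': "bij_betw \<psi> (darts X - {a, b}) (darts Y - {\<psi> a, \<psi> b})"
    using bij_betw_remove[OF sim_viaD(2)[OF s], of "{a, b}"] m(6,7) by simp
  have eqs: "\<psi> (mate X d) = \<psi> c \<longleftrightarrow> mate X d = c" if "d \<in> darts X" "c \<in> darts X" for d c
    using inj md that by blast
  have inv: "mate X d = e \<longleftrightarrow> d = mate X e" if "d \<in> darts X" "e \<in> darts X" for d e
    using wfD(6)[OF wf] that by metis
  have ba: "mate X b \<noteq> a" using m inv by metis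
  \<comment> \<open>The twists taken from the two labels at v are exactly those added to its weight,
    so they cancel in the product that becomes the merged label.\<close>
  have effv: "eff Y (\<phi> v) = eff X v + k a + k b"
    using sim_viaD(7)[OF s m(1)] m(2,3) by simp
  have D: "base ?Y (\<psi> d) = \<phi> (base ?X d) \<and> mate ?Y (\<psi> d) = \<psi> (mate ?X d) \<and>
        (mate ?X d = d \<longrightarrow> (\<exists>m. lab ?Y (\<psi> d) = twist (- k d) * lab ?X d * twist m)) \<and>
        (mate ?X d \<noteq> d \<longrightarrow> lab ?Y (\<psi> d) = twist (- k d) * lab ?X d * twist (- k (mate ?X d)))"
    if "d \<in> darts X - {a, b}" for d
  proof -
    have d: "d \<in> darts X" "d \<noteq> a" "d \<noteq> b" using that by auto
    have 1: "base ?Y (\<psi> d) = \<phi> (base ?X d)" using sim_viaD(3)[OF s d(1)] by simp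
    have 2: "mate ?Y (\<psi> d) = \<psi> (mate ?X d)"
      using d m mt eqs inj by (simp add: mate_merge)
    have thru: "lab ?Y (\<psi> d) = twist (- k d) * (lab X d * twist (eff X v) * lab X c) * twist (- k (mate X c)) \<and>
        mate X c \<noteq> d"
      if c: "c \<in> darts X" "c' \<in> darts X" "mate X d = c'" "mate X c \<noteq> c" "{c, c'} = {a, b}" for c c'
    proof -
      have "lab ?Y (\<psi> d) = lab Y (\<psi> d) * twist (eff Y (\<phi> v)) * lab Y (\<psi> c)"
        using c d m mt eqs inj by (auto simp: lab_merge doubleton_eq_iff)
      moreover have "lab Y (\<psi> d) = twist (- k d) * lab X d * twist (- k c')"
        using sim_viaD(6)[OF s d(1)] c d by (auto simp: doubleton_eq_iff)
      moreover have "lab Y (\<psi> c) = twist (- k c) * lab X c * twist (- k (mate X c))"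
        using sim_viaD(6)[OF s c(1,4)] .
      moreover have "eff Y (\<phi> v) = eff X v + k c + k c'" using effv c(5) m(3) by (auto simp: doubleton_eq_iff)
      moreover have "mate X c \<noteq> d" using inv[OF c(1) d(1)] c(3,5) m(3) by (auto simp: doubleton_eq_iff)
      ultimately show ?thesis by (simp add: mult.assoc twist_twist_left)
    qed
    have leg: "\<exists>m. lab ?Y (\<psi> d) = twist (- k d) * (lab X d * twist (eff X v) * lab X c) * twist m"
      if c: "c \<in> darts X" "c' \<in> darts X" "mate X d = c'" "mate X c = c" "{c, c'} = {a, b}" for c c'
    proof -
      have "lab ?Y (\<psi> d) = lab Y (\<psi> d) * twist (eff Y (\<phi> v)) * lab Y (\<psi> c)"
        using c d m mt eqs inj by (auto simp: lab_merge doubleton_eq_iff)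
      moreover have "lab Y (\<psi> d) = twist (- k d) * lab X d * twist (- k c')"
        using sim_viaD(6)[OF s d(1)] c d by (auto simp: doubleton_eq_iff)
      moreover obtain m where "lab Y (\<psi> c) = twist (- k c) * lab X c * twist m"
        using sim_viaD(5)[OF s c(1,4)] by blast
      moreover have "eff Y (\<phi> v) = eff X v + k c + k c'" using effv c(5) m(3) by (auto simp: doubleton_eq_iff)
      ultimately show ?thesis by (intro exI[of _ m]) (simp add: mult.assoc twist_twist_left)
    qed
    consider (a) "mate X d = a" | (b) "mate X d = b" | (n) "mate X d \<noteq> a" "mate X d \<noteq> b" by blast
    then show ?thesis
    proof cases
      case a
      show ?thesis
      proof (cases "mate X b = b")
        case True
        then show ?thesis using 1 2 leg[of b a] a m by (auto simp: mate_merge lab_merge[of X])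
      next
        case False
        then show ?thesis using 1 2 thru[of b a] a m by (auto simp: mate_merge lab_merge[of X])
      qed
    next
      case b
      show ?thesis
      proof (cases "mate X a = a")
        case True
        then show ?thesis using 1 2 leg[of a b] b m by (auto simp: mate_merge lab_merge[of X])
      next
        case False
        then show ?thesis using 1 2 thru[of a b] b m by (auto simp: mate_merge lab_merge[of X])
      qed
    next
      case n
      then have "lab ?Y (\<psi> d) = lab Y (\<psi> d)" "lab ?X d = lab X d" "mate ?X d = mate X d"
        using d m mt eqs by (simp_all add: lab_merge mate_merge)
      then show ?thesis using 1 2 sim_viaD(5,6)[OF s d(1)] by simp
    qed
  qed
  show "sim_via ?X ?Y \<phi> \<psi> k"
    unfolding sim_via_def
  proof (intro conjI)
    show "\<forall>u\<in>nodes ?X. eff ?Y (\<phi> u) = eff ?X u + (\<Sum>d\<in>darts_at ?X u. k d)"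
      using sim_viaD(7)[OF s] by (simp add: darts_at_merge[OF cm])
  qed (use bij bij' D in auto)
qed

text \<open>The gauge change has already moved \<open>k d\<close> from the label of the leg to the
  weight of its base, so only \<open>j - k d\<close> remains to be moved by pruning.\<close>

lemma sim_prune:
  assumes wf: "wf_dart_graph X" and s: "sim_via X Y \<phi> \<psi> k" and cp: "can_prune X d j"
  shows "can_prune Y (\<psi> d) (j - k d)" "sim_via (prune X d j) (prune Y (\<psi> d) (j - k d)) \<phi> \<psi> k"
proof -
  note p = can_pruneD[OF cp]
  have v: "base X d \<in> nodes X" using wfD(4)[OF wf p(1)] .
  obtain m where m: "lab X d = twist j * turn * twist m" using p(4) by blast
  obtain m' where m': "lab Y (\<psi> d) = twist (- k d) * lab X d * twist m'" using sim_viaD(5)[OF s p(1,2)] by blast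
  have "lab Y (\<psi> d) = twist (j - k d) * turn * twist (m + m')"
    using m m' by (simp add: mult.assoc twist_twist twist_twist_left)
  moreover have "card (darts_at Y (base Y (\<psi> d))) = card (darts_at X (base X d))"
    using darts_at_sim[OF wf s v] sim_viaD(3)[OF s p(1)] card_image[OF inj_on_darts_at[OF s]] by simp
  ultimately show "can_prune Y (\<psi> d) (j - k d)"
    using p sim_viaD(4)[OF s p(1)] sim_via_inj(3)[OF s p(1)] unfolding can_prune_def by auto
  have bij: "bij_betw \<psi> (darts X - {d}) (darts Y - {\<psi> d})"
    using bij_betw_remove[OF sim_viaD(2)[OF s], of "{d}"] p(1) by simp
  have E: "(if \<phi> u = base Y (\<psi> d) then eff Y (\<phi> u) + (j - k d) else eff Y (\<phi> u)) =
      (if u = base X d then eff X u + j else eff X u) + (\<Sum>e\<in>darts_at X u - {d}. k e)"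
    if u: "u \<in> nodes X" for u
  proof (cases "u = base X d")
    case True
    have "(\<Sum>e\<in>darts_at X u. k e) = k d + (\<Sum>e\<in>darts_at X u - {d}. k e)"
      using p(5) True finite_darts_at[OF wf] by (simp add: sum.remove)
    then show ?thesis using True sim_viaD(7)[OF s u] sim_viaD(3)[OF s p(1)] by simp
  next
    case False
    then have "d \<notin> darts_at X u" unfolding darts_at_def by auto
    then show ?thesis using False sim_viaD(7)[OF s u] sim_viaD(3)[OF s p(1)] sim_via_inj(2)[OF s u v]
      by simp
  qed
  show "sim_via (prune X d j) (prune Y (\<psi> d) (j - k d)) \<phi> \<psi> k"
    unfolding sim_via_def
  proof (intro conjI)
    show "\<forall>u\<in>nodes (prune X d j). eff (prune Y (\<psi> d) (j - k d)) (\<phi> u) =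
        eff (prune X d j) u + sum k (darts_at (prune X d j) u)"
    proof
      fix u assume "u \<in> nodes (prune X d j)"
      then show "eff (prune Y (\<psi> d) (j - k d)) (\<phi> u) =
          eff (prune X d j) u + sum k (darts_at (prune X d j) u)"
        using E[of u] by (auto simp: darts_at_prune)
    qed
  qed (use bij s[unfolded sim_via_def] in auto)
qed

text \<open>Gauge equivalence is a simulation for the rewriting, so it can be postponed past any
  number of steps.\<close>

lemma sim_step:
  assumes wf: "wf_dart_graph X" and "sim X Y" "step X X'"
  shows "\<exists>Y'. step Y Y' \<and> sim X' Y'"
  using assms(3)
proof cases
  case (merge v a b)
  then show ?thesis using sim_merge[OF wf] assms(2) unfolding sim_def by (metis step.merge)
next
  case (prune d j)
  then show ?thesis using sim_prune[OF wf] assms(2) unfolding sim_def by (metis step.prune)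
qed

lemma sim_steps:
  assumes "step\<^sup>*\<^sup>* X X'" "wf_dart_graph X" "sim X Y"
  shows "\<exists>Y'. step\<^sup>*\<^sup>* Y Y' \<and> sim X' Y'"
  using assms
proof (induction arbitrary: Y rule: converse_rtranclp_induct)
  case (step X1 X2)
  then obtain Y2 where "step Y Y2" "sim X2 Y2" using sim_step by blast
  then show ?case using step.IH[of Y2] wf_step[OF step.hyps(1)] step.prems
    by (meson converse_rtranclp_into_rtranclp)
qed blast

lemma wf_steps: "step\<^sup>*\<^sup>* X Y \<Longrightarrow> wf_dart_graph X \<Longrightarrow> wf_dart_graph Y"
  by (induction rule: rtranclp_induct) (auto intro: wf_step)

lemma connected_steps_iff:
  "step\<^sup>*\<^sup>* X Y \<Longrightarrow> wf_dart_graph X \<Longrightarrow> connected_dart_graph Y \<longleftrightarrow> connected_dart_graph X"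
  by (induction rule: rtranclp_induct) (auto simp: connected_step_iff wf_steps)


section \<open>Confluence\<close>

text \<open>A chain has two free ends, each carrying an arbitrary twist, and no preferred
  direction.\<close>

definition chain_equiv :: "label \<Rightarrow> label \<Rightarrow> bool" where
  "chain_equiv h h' \<longleftrightarrow> (\<exists>i j. h' = twist i * h * twist j \<or> h' = twist i * reversal h * twist j)"

text \<open>Conjugation accounts for the choice of a starting point on the cycle, reversal for the
  choice of a direction.\<close>

definition circle_equiv :: "label \<Rightarrow> label \<Rightarrow> bool" where
  "circle_equiv P Q \<longleftrightarrow> conjugate P Q \<or> conjugate (reversal P) Q"

text \<open>The product reads the chain from the free end of a through the node to the free end of
  b; labels of legs point outwards, hence the reversal on a.\<close>

definition chain_type :: "('v, 'd) dart_graph \<Rightarrow> label \<Rightarrow> bool" where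
  "chain_type X h \<longleftrightarrow> (\<exists>v a b. nodes X = {v} \<and> darts X = {a, b} \<and> a \<noteq> b \<and> base X a = v \<and> base X b = v \<and>
     mate X a = a \<and> mate X b = b \<and> chain_equiv (reversal (lab X a) * twist (eff X v) * lab X b) h)"

definition circle_type :: "('v, 'd) dart_graph \<Rightarrow> label \<Rightarrow> bool" where
  "circle_type X P \<longleftrightarrow> (\<exists>v a b. nodes X = {v} \<and> darts X = {a, b} \<and> a \<noteq> b \<and> base X a = v \<and> base X b = v \<and>
     mate X a = b \<and> mate X b = a \<and> circle_equiv (twist (eff X v) * lab X a) P)"

lemma chain_equiv_refl [simp]: "chain_equiv h h"
  unfolding chain_equiv_def by (rule exI[of _ 0], rule exI[of _ 0]) simp

lemma chain_equivI: "h' = twist i * h * twist j \<Longrightarrow> chain_equiv h h'"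
  unfolding chain_equiv_def by blast

lemma chain_equiv_reversal: "chain_equiv h (reversal h)"
  unfolding chain_equiv_def by (rule exI[of _ 0], rule exI[of _ 0]) simp

lemma chain_equiv_sym: "chain_equiv h h' \<Longrightarrow> chain_equiv h' h"
proof -
  assume "chain_equiv h h'"
  then obtain i j where "h' = twist i * h * twist j \<or> h' = twist i * reversal h * twist j" unfolding chain_equiv_def by blast
  then have "h = twist (- i) * h' * twist (- j) \<or> h = twist (- j) * reversal h' * twist (- i)"
    by (auto simp: mult.assoc twist_twist twist_twist_left)
  then show ?thesis unfolding chain_equiv_def by blast
qed

lemma chain_equiv_trans: "chain_equiv h h' \<Longrightarrow> chain_equiv h' h'' \<Longrightarrow> chain_equiv h h''"
proof -
  assume "chain_equiv h h'" "chain_equiv h' h''"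
  then obtain i j i' j' where "h' = twist i * h * twist j \<or> h' = twist i * reversal h * twist j"
    "h'' = twist i' * h' * twist j' \<or> h'' = twist i' * reversal h' * twist j'" unfolding chain_equiv_def by blast
  then have "h'' = twist (i' + i) * h * twist (j + j') \<or> h'' = twist (i' + j) * reversal h * twist (i + j') \<or>
     h'' = twist (i' + i) * reversal h * twist (j + j') \<or> h'' = twist (i' + j) * h * twist (i + j')"
    by (auto simp: mult.assoc twist_twist twist_twist_left)
  then show ?thesis unfolding chain_equiv_def by blast
qed

lemma circle_equiv_refl [simp]: "circle_equiv P P"
  by (simp add: circle_equiv_def)

lemma circle_equiv_sym: "circle_equiv P Q \<Longrightarrow> circle_equiv Q P"
  unfolding circle_equiv_def using conjugate_sym conjugate_reversal by (metis reversal_reversal)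

lemma circle_equiv_trans: "circle_equiv P Q \<Longrightarrow> circle_equiv Q R \<Longrightarrow> circle_equiv P R"
  unfolding circle_equiv_def using conjugate_trans conjugate_reversal by (metis reversal_reversal)

lemma chain_typeI:
  assumes "nodes X = {v}" "darts X = {a, b}" "a \<noteq> b" "base X a = v" "base X b = v"
    "mate X a = a" "mate X b = b" "reversal (lab X a) * twist (eff X v) * lab X b = h"
  shows "chain_type X h"
  unfolding chain_type_def using assms chain_equiv_refl by blast

lemma circle_typeI:
  assumes "nodes X = {v}" "darts X = {a, b}" "a \<noteq> b" "base X a = v" "base X b = v"
    "mate X a = b" "mate X b = a" "twist (eff X v) * lab X a = P"
  shows "circle_type X P"
  unfolding circle_type_def using assms circle_equiv_refl by blast

lemma chain_type_equiv: "chain_type X h \<Longrightarrow> chain_equiv h h' \<Longrightarrow> chain_type X h'"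
  unfolding chain_type_def using chain_equiv_trans by blast

lemma circle_type_equiv: "circle_type X P \<Longrightarrow> circle_equiv P Q \<Longrightarrow> circle_type X Q"
  unfolding circle_type_def using circle_equiv_trans by blast

lemma chain_type_unique:
  assumes "chain_type X h" "chain_type X h'"
  shows "chain_equiv h h'"
proof -
  obtain v a b where 1: "nodes X = {v}" "darts X = {a, b}" "a \<noteq> b"
    "chain_equiv (reversal (lab X a) * twist (eff X v) * lab X b) h"
    using assms(1) unfolding chain_type_def by blast
  obtain v' a' b' where 2: "nodes X = {v'}" "darts X = {a', b'}" "a' \<noteq> b'"
    "chain_equiv (reversal (lab X a') * twist (eff X v') * lab X b') h'"
    using assms(2) unfolding chain_type_def by blast
  have "v = v'" "a = a' \<and> b = b' \<or> a = b' \<and> b = a'"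
    using 1 2 by (auto simp: doubleton_eq_iff)
  moreover have "reversal (reversal (lab X a) * twist (eff X v) * lab X b) = reversal (lab X b) * twist (eff X v) * lab X a"
    by (simp add: mult.assoc)
  ultimately have "chain_equiv (reversal (lab X a) * twist (eff X v) * lab X b) (reversal (lab X a') * twist (eff X v') * lab X b')"
    using chain_equiv_reversal[of "reversal (lab X a) * twist (eff X v) * lab X b"] by auto
  then show ?thesis using 1(4) 2(4) chain_equiv_sym chain_equiv_trans by blast
qed

lemma circle_type_unique:
  assumes wf: "wf_dart_graph X" and "circle_type X P" "circle_type X P'"
  shows "circle_equiv P P'"
proof -
  obtain v a b where 1: "nodes X = {v}" "darts X = {a, b}" "a \<noteq> b" "mate X a = b"
    "circle_equiv (twist (eff X v) * lab X a) P"
    using assms(2) unfolding circle_type_def by blast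
  obtain v' a' b' where 2: "nodes X = {v'}" "darts X = {a', b'}" "a' \<noteq> b'"
    "circle_equiv (twist (eff X v') * lab X a') P'"
    using assms(3) unfolding circle_type_def by blast
  have "v = v'" "a' = a \<or> a' = b"
    using 1 2 by (auto simp: doubleton_eq_iff)
  moreover have "lab X b = reversal (lab X a)" "label_det (lab X a) = 1" using wfD(7,8)[OF wf, of a] 1 by auto
  moreover have "conjugate (reversal (twist (eff X v) * lab X a)) (twist (eff X v) * reversal (lab X a))"
    using conjugate_swap[of "twist (eff X v)" "reversal (lab X a)"] by simp
  ultimately have "circle_equiv (twist (eff X v) * lab X a) (twist (eff X v') * lab X a')"
    unfolding circle_equiv_def by auto
  then show ?thesis using 1(5) 2(4) circle_equiv_sym circle_equiv_trans by blast
qed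

lemma sim_chain_type:
  assumes wf: "wf_dart_graph X" and "sim X Y" and c: "chain_type X h"
  shows "chain_type Y h"
proof -
  obtain \<phi> \<psi> k where s: "sim_via X Y \<phi> \<psi> k" using assms(2) unfolding sim_def by blast
  obtain v a b where 1: "nodes X = {v}" "darts X = {a, b}" "a \<noteq> b" "base X a = v" "base X b = v"
    "mate X a = a" "mate X b = b" "chain_equiv (reversal (lab X a) * twist (eff X v) * lab X b) h"
    using c unfolding chain_type_def by blast
  have at: "darts_at X v = {a, b}" using 1 unfolding darts_at_def by auto
  have e: "eff Y (\<phi> v) = eff X v + k a + k b" using sim_viaD(7)[OF s, of v] 1 at by simp
  obtain m where m: "lab Y (\<psi> a) = twist (- k a) * lab X a * twist m" using sim_viaD(5)[OF s, of a] 1 by auto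
  obtain n where n: "lab Y (\<psi> b) = twist (- k b) * lab X b * twist n" using sim_viaD(5)[OF s, of b] 1 by auto
  have "reversal (lab Y (\<psi> a)) * twist (eff Y (\<phi> v)) * lab Y (\<psi> b) =
     twist m * (reversal (lab X a) * twist (eff X v) * lab X b) * twist n"
    using e m n by (simp add: mult.assoc twist_twist_left)
  then have "chain_equiv (reversal (lab Y (\<psi> a)) * twist (eff Y (\<phi> v)) * lab Y (\<psi> b)) h"
    using chain_equiv_trans[OF chain_equiv_sym[OF chain_equivI] 1(8)] by blast
  then show ?thesis
    unfolding chain_type_def
    using 1 sim_viaD(1-4)[OF s] sim_via_inj(1)[OF s, of a b]
    by (intro exI[of _ "\<phi> v"] exI[of _ "\<psi> a"] exI[of _ "\<psi> b"]) (auto simp: bij_betw_def)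
qed

lemma sim_circle_type:
  assumes wf: "wf_dart_graph X" and "sim X Y" and c: "circle_type X P"
  shows "circle_type Y P"
proof -
  obtain \<phi> \<psi> k where s: "sim_via X Y \<phi> \<psi> k" using assms(2) unfolding sim_def by blast
  obtain v a b where 1: "nodes X = {v}" "darts X = {a, b}" "a \<noteq> b" "base X a = v" "base X b = v"
    "mate X a = b" "mate X b = a" "circle_equiv (twist (eff X v) * lab X a) P"
    using c unfolding circle_type_def by blast
  have at: "darts_at X v = {a, b}" using 1 unfolding darts_at_def by auto
  have e: "eff Y (\<phi> v) = eff X v + k a + k b" using sim_viaD(7)[OF s, of v] 1 at by simp
  have m: "lab Y (\<psi> a) = twist (- k a) * lab X a * twist (- k b)" using sim_viaD(6)[OF s, of a] 1 by auto
  \<comment> \<open>A gauge change conjugates the value of the loop by the twist at b.\<close>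
  have "twist (eff Y (\<phi> v)) * lab Y (\<psi> a) = twist (k b) * (twist (eff X v) * lab X a * twist (- k b))"
    using e m by (simp add: mult.assoc twist_twist_left add.commute add.left_commute)
  moreover have "conjugate (twist (k b) * (twist (eff X v) * lab X a * twist (- k b)))
       (twist (eff X v) * lab X a * twist (- k b) * twist (k b))"
    using wfD(7)[OF wf, of a] 1 by (intro conjugate_swap) simp
  ultimately have "conjugate (twist (eff Y (\<phi> v)) * lab Y (\<psi> a)) (twist (eff X v) * lab X a)"
    by (simp add: mult.assoc twist_twist)
  then have "circle_equiv (twist (eff Y (\<phi> v)) * lab Y (\<psi> a)) P"
    using circle_equiv_trans[OF _ 1(8)] unfolding circle_equiv_def by blast
  then show ?thesis
    unfolding circle_type_def
    using 1 sim_viaD(1-4)[OF s] sim_via_inj(1)[OF s, of a b]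
    by (intro exI[of _ "\<phi> v"] exI[of _ "\<psi> a"] exI[of _ "\<psi> b"]) (auto simp: bij_betw_def)
qed

lemma step_special:
  assumes "step X Y"
  shows "\<not> chain_type X h" "\<not> circle_type X P"
  using assms
proof (atomize(full), cases)
  case (merge v a b)
  note m = can_mergeD[OF merge(2)]
  show "\<not> chain_type X h \<and> \<not> circle_type X P"
    using m unfolding chain_type_def circle_type_def by auto
next
  case (prune d j)
  note p = can_pruneD[OF prune(2)]
  have "card (darts_at X (base X d)) \<le> 2" if "darts X = {a, b}" for a b
  proof -
    have "card (darts_at X (base X d)) \<le> card {a, b}"
      using that unfolding darts_at_def by (intro card_mono) auto
    also have "\<dots> \<le> 2" by (simp add: card_insert_if)
    finally show ?thesis .
  qed
  then show "\<not> chain_type X h \<and> \<not> circle_type X P"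
    using p(3) unfolding chain_type_def circle_type_def by force
qed

text \<open>The two latter alternatives cover pairs of one-node graphs, which are irreducible and
  need not be related by \<open>sim\<close>.\<close>

definition joinable :: "('v, 'd) dart_graph \<Rightarrow> ('v, 'd) dart_graph \<Rightarrow> bool" where
  "joinable Y W \<longleftrightarrow> (\<exists>J J'. step\<^sup>*\<^sup>* Y J \<and> step\<^sup>*\<^sup>* W J' \<and> sim J J') \<or>
     (\<exists>h. chain_type Y h \<and> chain_type W h) \<or> (\<exists>P. circle_type Y P \<and> circle_type W P)"

lemma joinable_step: "step Y J \<Longrightarrow> step W J' \<Longrightarrow> sim J J' \<Longrightarrow> joinable Y W"
  unfolding joinable_def by blast

section \<open>Critical pairs\<close>

lemma connected_closed:
  assumes "connected_dart_graph X" "U \<subseteq> nodes X" "U \<noteq> {}"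
    "\<And>d. d \<in> darts X \<Longrightarrow> base X d \<in> U \<Longrightarrow> base X (mate X d) \<in> U"
  shows "nodes X = U"
  using assms unfolding connected_dart_graph_def by blast

lemma merge_merge_unlinked:
  assumes wf: "wf_dart_graph X" and cm: "can_merge X v a b" and cm': "can_merge X v' a' b'"
    and ne: "v \<noteq> v'" and unl: "mate X a \<notin> {a', b'}" "mate X b \<notin> {a', b'}"
  shows "joinable (merge X v a b) (merge X v' a' b')"
proof -
  note m = can_mergeD[OF cm] and m' = can_mergeD[OF cm']
  have dj: "a \<noteq> a'" "a \<noteq> b'" "b \<noteq> a'" "b \<noteq> b'" using m(8,9) m'(8,9) ne by metis+
  have inv: "mate X d = e \<longleftrightarrow> d = mate X e" if "d \<in> darts X" "e \<in> darts X" for d e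
    using wfD(6)[OF wf] that by metis
  have unl': "mate X a' \<notin> {a, b}" "mate X b' \<notin> {a, b}" using unl inv m(6,7) m'(6,7) by auto
  have 1: "can_merge (merge X v a b) v' a' b'"
    unfolding can_merge_def darts_at_merge[OF cm]
    using m(1-5) m'(1-5) ne unl' by (auto simp: mate_merge)
  have 2: "can_merge (merge X v' a' b') v a b"
    unfolding can_merge_def darts_at_merge[OF cm']
    using m(1-5) m'(1-5) ne unl by (auto simp: mate_merge)
  have "sim (merge (merge X v a b) v' a' b') (merge (merge X v' a' b') v a b)"
  proof (rule sim_agree)
    fix d assume "d \<in> darts (merge (merge X v a b) v' a' b')"
    then have d: "d \<in> darts X" "d \<notin> {a, b, a', b'}" by auto
    then show "base (merge (merge X v a b) v' a' b') d = base (merge (merge X v' a' b') v a b) d \<and>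
        mate (merge (merge X v a b) v' a' b') d = mate (merge (merge X v' a' b') v a b) d"
      using dj unl unl' by (simp add: mate_merge)
    show "lab (merge (merge X v a b) v' a' b') d = lab (merge (merge X v' a' b') v a b) d \<or>
       mate (merge (merge X v a b) v' a' b') d = d \<and>
       (\<exists>m. lab (merge (merge X v' a' b') v a b) d = lab (merge (merge X v a b) v' a' b') d * twist m)"
      using dj unl unl' d by (simp add: mate_merge lab_merge)
  qed auto
  then show ?thesis using joinable_step step.merge[OF 1] step.merge[OF 2] by blast
qed

text \<open>Adjacent nodes of valence 2 can be merged one after the other in either order, unless
  nothing lies beyond them. In that case connectedness makes them the whole graph, a cycle or a
  chain, and each merge leaves one node of the same value.\<close>

lemma merge_merge_linked:
  assumes wf: "wf_dart_graph X" and conn: "connected_dart_graph X"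
    and cm: "can_merge X v a b" and cm': "can_merge X v' a' b'"
    and ne: "v \<noteq> v'" and link: "mate X b = a'"
  shows "joinable (merge X v a b) (merge X v' a' b')"
proof -
  note m = can_mergeD[OF cm] and m' = can_mergeD[OF cm']
  have dj: "a \<noteq> a'" "a \<noteq> b'" "b \<noteq> a'" "b \<noteq> b'" using m(8,9) m'(8,9) ne by metis+
  have inv: "mate X d = e \<longleftrightarrow> d = mate X e" if "d \<in> darts X" "e \<in> darts X" for d e
    using wfD(6)[OF wf] that by metis
  have link': "mate X a' = b" using link inv m m' by metis
  have only: "nodes X = {v, v'} \<and> darts X = {a, b, a', b'}"
    if "mate X a \<in> {a, b'}" "mate X b' \<in> {b', a}"
  proof -
    have "nodes X = {v, v'}"
    proof (rule connected_closed[OF conn])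
      fix d assume d: "d \<in> darts X" "base X d \<in> {v, v'}"
      then have "d \<in> darts_at X v \<or> d \<in> darts_at X v'" unfolding darts_at_def by auto
      then have "d = a \<or> d = b \<or> d = a' \<or> d = b'" using m(2) m'(2) by auto
      then have "mate X d \<in> {a, b, a', b'}" using link link' that by auto
      then show "base X (mate X d) \<in> {v, v'}" using m(8,9) m'(8,9) by auto
    qed (use m(1) m'(1) in auto)
    moreover have "darts X = darts_at X v \<union> darts_at X v'"
      using calculation wfD(4)[OF wf] unfolding darts_at_def by auto
    ultimately show ?thesis using m(2) m'(2) by auto
  qed
  consider (circle) "mate X a = b'" | (chain) "mate X a = a" "mate X b' = b'"
    | (join) "mate X a \<noteq> b'" "\<not> (mate X a = a \<and> mate X b' = b')" by blast
  then show ?thesis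
  proof cases
    case circle
    then have "mate X b' = a" using inv m m' by metis
    have o: "nodes X = {v, v'}" "darts X = {a, b, a', b'}" using only circle \<open>mate X b' = a\<close> by auto
    have l: "lab X b' = reversal (lab X a)" "lab X a' = reversal (lab X b)" "label_det (lab X a) = 1" "label_det (lab X b) = 1"
      using wfD(7,8)[OF wf m(6)] wfD(7,8)[OF wf m(7)] unfolding link circle using dj by auto
    define A where "A = twist (eff X v) * lab X b"
    define B where "B = twist (eff X v') * lab X b'"
    have c1: "circle_type (merge X v a b) (B * A)"
    proof (rule circle_typeI[of _ v' b' a'])
      show "twist (eff (merge X v a b) v') * lab (merge X v a b) b' = B * A"
        using \<open>mate X b' = a\<close> by (simp add: lab_merge A_def B_def mult.assoc)
    qed (use o ne dj m(3) m'(3,8,9) link link' circle \<open>mate X b' = a\<close> in \<open>auto simp: mate_merge\<close>)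
    have c2: "circle_type (merge X v' a' b') (A * B)"
    proof (rule circle_typeI[of _ v b a])
      show "twist (eff (merge X v' a' b') v) * lab (merge X v' a' b') b = A * B"
        using link by (simp add: lab_merge A_def B_def mult.assoc)
    qed (use o ne dj m(3,8,9) m'(3) link link' \<open>mate X b' = a\<close> circle in \<open>auto simp: mate_merge\<close>)
    \<comment> \<open>The two merges cut the same cycle at different nodes, which permutes the
      product cyclically.\<close>
    have "circle_equiv (B * A) (A * B)"
      unfolding circle_equiv_def using conjugate_swap[of A B] l by (simp add: A_def)
    then have "circle_type (merge X v a b) (A * B)" using c1 circle_type_equiv by blast
    then show ?thesis using c2 unfolding joinable_def by blast
  next
    case chain
    have o: "nodes X = {v, v'}" "darts X = {a, b, a', b'}" using only chain by auto
    have l: "lab X a' = reversal (lab X b)"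
      using wfD(8)[OF wf m(7)] unfolding link using dj by auto
    define h where "h = reversal (lab X a) * twist (eff X v) * lab X b * twist (eff X v') * lab X b'"
    have "chain_type (merge X v a b) h"
    proof (rule chain_typeI[of _ v' a' b'])
      show "reversal (lab (merge X v a b) a') * twist (eff (merge X v a b) v') * lab (merge X v a b) b' = h"
        using link' chain dj m(3) by (simp add: lab_merge h_def l mult.assoc)
    qed (use o ne dj m(3) m'(3,8,9) link' chain in \<open>auto simp: mate_merge\<close>)
    moreover have "chain_type (merge X v' a' b') h"
    proof (rule chain_typeI[of _ v a b])
      show "reversal (lab (merge X v' a' b') a) * twist (eff (merge X v' a' b') v) * lab (merge X v' a' b') b = h"
        using link chain dj m'(3) by (simp add: lab_merge h_def mult.assoc)
    qed (use o ne dj m(3,8,9) m'(3) link chain in \<open>auto simp: mate_merge\<close>)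
    ultimately show ?thesis unfolding joinable_def by blast
  next
    case join
    have j': "mate X b' \<noteq> a" using join inv m m' by metis
    have bb: "mate X b' \<noteq> b" "mate X a \<noteq> a'" using link link' inv m m' dj by metis+
    have 1: "can_merge (merge X v a b) v' a' b'"
      unfolding can_merge_def darts_at_merge[OF cm]
      using m(1-5) m'(1-5) ne join j' bb link link' dj by (auto simp: mate_merge)
    have 2: "can_merge (merge X v' a' b') v a b"
      unfolding can_merge_def darts_at_merge[OF cm']
      using m(1-5) m'(1-5) ne join j' bb link link' dj by (auto simp: mate_merge)
    have "sim (merge (merge X v a b) v' a' b') (merge (merge X v' a' b') v a b)"
    proof (rule sim_agree)
      fix d assume "d \<in> darts (merge (merge X v a b) v' a' b')"
      then have d: "d \<in> darts X" "d \<notin> {a, b, a', b'}" by auto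
      then have "mate X d \<noteq> b" "mate X d \<noteq> a'" using link link' inv m(7) m'(6) by auto
      moreover have "mate X d = a \<Longrightarrow> mate X d \<noteq> b'" using dj by simp
      ultimately show "base (merge (merge X v a b) v' a' b') d = base (merge (merge X v' a' b') v a b) d \<and>
          mate (merge (merge X v a b) v' a' b') d = mate (merge (merge X v' a' b') v a b) d"
        "lab (merge (merge X v a b) v' a' b') d = lab (merge (merge X v' a' b') v a b) d \<or>
         mate (merge (merge X v a b) v' a' b') d = d \<and>
         (\<exists>m. lab (merge (merge X v' a' b') v a b) d = lab (merge (merge X v a b) v' a' b') d * twist m)"
        using dj join j' bb link link' m(3,4) m'(3,4) d by (simp_all add: mate_merge lab_merge mult.assoc)
    qed auto
    then show ?thesis using joinable_step step.merge[OF 1] step.merge[OF 2] by blast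
  qed
qed

lemma joinable_refl: "joinable Y Y"
  unfolding joinable_def using sim_refl by blast

lemma peak_merge_merge:
  assumes wf: "wf_dart_graph X" and conn: "connected_dart_graph X"
    and cm: "can_merge X v a b" and cm': "can_merge X v' a' b'"
  shows "joinable (merge X v a b) (merge X v' a' b')"
proof (cases "v = v'")
  case True
  note m = can_mergeD[OF cm] and m' = can_mergeD[OF cm']
  have "a = a' \<and> b = b' \<or> a = b' \<and> b = a'" using m m' True by (auto simp: doubleton_eq_iff)
  then show ?thesis using True merge_commute_ab[OF m(3)] joinable_refl by metis
next
  case False
  note m = can_mergeD[OF cm] and m' = can_mergeD[OF cm']
  note sw = merge_commute_ab[OF m(3)] merge_commute_ab[OF m'(3)]
    can_merge_commute_ab[OF wf cm] can_merge_commute_ab[OF wf cm']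
  consider "mate X a \<notin> {a', b'}" "mate X b \<notin> {a', b'}" | "mate X b = a'" | "mate X b = b'"
    | "mate X a = a'" | "mate X a = b'" by blast
  then show ?thesis
  proof cases
    case 1
    then show ?thesis using merge_merge_unlinked[OF wf cm cm' False] by blast
  next
    case 2
    then show ?thesis using merge_merge_linked[OF wf conn cm cm' False] by blast
  next
    case 3
    then show ?thesis using merge_merge_linked[OF wf conn cm sw(4) False] sw(2) by metis
  next
    case 4
    then show ?thesis using merge_merge_linked[OF wf conn sw(3) cm' False] sw(1) by metis
  next
    case 5
    then show ?thesis using merge_merge_linked[OF wf conn sw(3) sw(4) False] sw(1,2) by metis
  qed
qed

lemma joinable_sym:
  assumes "wf_dart_graph Y" "joinable Y W" shows "joinable W Y"
  using assms sim_sym wf_steps unfolding joinable_def by metis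

lemma peak_merge_prune:
  assumes wf: "wf_dart_graph X" and cm: "can_merge X v a b" and cp: "can_prune X d j"
  shows "joinable (merge X v a b) (prune X d j)"
proof -
  note m = can_mergeD[OF cm] and p = can_pruneD[OF cp]
  have ne: "base X d \<noteq> v" using p(3) m(2,3) by auto
  then have dab: "d \<noteq> a" "d \<noteq> b" using m by auto
  have md: "mate X d \<noteq> a" "mate X d \<noteq> b" using dab p(2) by auto
  have 1: "can_prune (merge X v a b) d j"
    unfolding can_prune_def using p m md dab ne by (simp add: mate_merge lab_merge darts_at_merge[OF cm])
  have "d \<notin> darts_at X v" using ne unfolding darts_at_def by simp
  then have 2: "can_merge (prune X d j) v a b"
    unfolding can_merge_def darts_at_prune using m by simp
  have "sim (prune (merge X v a b) d j) (merge (prune X d j) v a b)"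
    using ne by (intro sim_agree) (auto simp: mate_merge lab_merge)
  then show ?thesis using joinable_step step.prune[OF 1] step.merge[OF 2] by blast
qed

text \<open>The only conflict is between two legs at a node of valence 3, where pruning one drops
  the valence to 2 and the other can only be merged. If the third dart is a leg too, both results
  are chains of the same value; otherwise merging the node gives two graphs that differ by a twist
  at the free end of the resulting leg.\<close>

lemma peak_prune_prune:
  assumes wf: "wf_dart_graph X" and conn: "connected_dart_graph X"
    and cp: "can_prune X d j" and cp': "can_prune X d' j'"
  shows "joinable (prune X d j) (prune X d' j')"
proof -
  note p = can_pruneD[OF cp] and p' = can_pruneD[OF cp']
  obtain m m' where l: "lab X d = twist j * turn * twist m" "lab X d' = twist j' * turn * twist m'" using p(4) p'(4) by blast
  consider (same) "d = d'" | (free) "d \<noteq> d'" "base X d \<noteq> base X d' \<or> 4 \<le> card (darts_at X (base X d))"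
    | (three) "d \<noteq> d'" "base X d = base X d'" "card (darts_at X (base X d)) = 3"
    using p(3) by force
  then show ?thesis
  proof cases
    case same
    then have "j = j'" using l twist_turn_twist_inject by metis
    then show ?thesis using same joinable_refl by simp
  next
    case free
    have 1: "can_prune (prune X d j) d' j'"
      using p p' free card_darts_at_prune[OF wf cp, of "base X d'"] unfolding can_prune_def by auto
    have 2: "can_prune (prune X d' j') d j"
      using p p' free card_darts_at_prune[OF wf cp', of "base X d"] unfolding can_prune_def by auto
    have "sim (prune (prune X d j) d' j') (prune (prune X d' j') d j)"
      by (intro sim_agree) auto
    then show ?thesis using joinable_step step.prune[OF 1] step.prune[OF 2] by blast
  next
    case three
    define u where "u = base X d"
    have u: "u \<in> nodes X" using wfD(4)[OF wf p(1)] by (simp add: u_def)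
    have "card (darts_at X u - {d, d'}) = 1"
      using three p(5) p'(5) finite_darts_at[OF wf] by (simp add: u_def card_Diff_subset)
    then obtain f where "darts_at X u - {d, d'} = {f}" by (auto simp: card_1_singleton_iff)
    then have at: "darts_at X u = {d, d', f}" and f: "f \<noteq> d" "f \<noteq> d'"
      using p(5) p'(5) three u_def by auto
    have fX: "f \<in> darts X" "base X f = u" using at unfolding darts_at_def by auto
    have bd: "base X d = u" "base X d' = u" using three by (simp_all add: u_def)
    show ?thesis
    proof (cases "mate X f = f")
      case True
      have "nodes X = {u}"
      proof (rule connected_closed[OF conn])
        fix e assume "e \<in> darts X" "base X e \<in> {u}"
        then have "e \<in> {d, d', f}" using at unfolding darts_at_def by auto
        then show "base X (mate X e) \<in> {u}" using True p(2) p'(2) bd fX by auto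
      qed (use u in auto)
      moreover have "darts X = {d, d', f}"
        using calculation at wfD(4)[OF wf] unfolding darts_at_def by auto
      ultimately have o: "nodes X = {u}" "darts X = {d, d', f}" by auto
      define h where "h = turn * twist (eff X u + j + j') * lab X f"
      have "reversal (lab X d') * twist (eff X u + j) * lab X f = twist m' * h * twist 0"
        using l by (simp add: h_def mult.assoc twist_twist_left add.commute add.left_commute)
      then have eq: "chain_equiv (reversal (lab X d') * twist (eff X u + j) * lab X f) h"
        by (metis chain_equivI chain_equiv_sym)
      have "chain_type (prune X d j) (reversal (lab X d') * twist (eff X u + j) * lab X f)"
        by (rule chain_typeI[of _ u d' f]) (use o f three(1) p(2) p'(2) True bd fX in auto)
      then have "chain_type (prune X d j) h" using eq chain_type_equiv by blast
      moreover have "reversal (lab X d) * twist (eff X u + j') * lab X f = twist m * h * twist 0"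
        using l by (simp add: h_def mult.assoc twist_twist_left add.commute add.left_commute)
      then have eq: "chain_equiv (reversal (lab X d) * twist (eff X u + j') * lab X f) h"
        by (metis chain_equivI chain_equiv_sym)
      have "chain_type (prune X d' j') (reversal (lab X d) * twist (eff X u + j') * lab X f)"
        by (rule chain_typeI[of _ u d f]) (use o f three(1) p(2) p'(2) True bd fX in auto)
      then have "chain_type (prune X d' j') h" using eq chain_type_equiv by blast
      ultimately show ?thesis unfolding joinable_def by blast
    next
      case False
      have 1: "can_merge (prune X d j) u d' f"
        unfolding can_merge_def darts_at_prune using u at f three(1) p'(2) False by auto
      have 2: "can_merge (prune X d' j') u d f"
        unfolding can_merge_def darts_at_prune using u at f three(1) p(2) False by auto
      have "sim (merge (prune X d j) u d' f) (merge (prune X d' j') u d f)"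
      proof (rule sim_agree)
        fix e assume "e \<in> darts (merge (prune X d j) u d' f)"
        then have e: "e \<in> darts X" "e \<notin> {d, d', f}" by auto
        have "mate X e \<noteq> d" "mate X e \<noteq> d'"
          using wfD(6)[OF wf e(1)] p(2) p'(2) e(2) by auto
        then show "base (merge (prune X d j) u d' f) e = base (merge (prune X d' j') u d f) e \<and>
           mate (merge (prune X d j) u d' f) e = mate (merge (prune X d' j') u d f) e"
          using f p(2) p'(2) by (simp add: mate_merge)
        have *: "lab X e * twist (eff X u + j') * (twist j * turn * twist m) =
            lab X e * twist (eff X u + j) * (twist j' * turn * twist m') * twist (m - m')"
          by (simp add: mult.assoc twist_twist twist_twist_left add.commute add.left_commute)
        show "lab (merge (prune X d j) u d' f) e = lab (merge (prune X d' j') u d f) e \<or>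
          mate (merge (prune X d j) u d' f) e = e \<and>
          (\<exists>i. lab (merge (prune X d' j') u d f) e = lab (merge (prune X d j) u d' f) e * twist i)"
        proof (cases "mate X e = f")
          case True
          have "lab (merge (prune X d' j') u d f) e = lab (merge (prune X d j) u d' f) e * twist (m - m')"
            using True f p(2) p'(2) bd l * by (simp add: lab_merge)
          then show ?thesis using True f p(2) p'(2) by (auto simp: mate_merge)
        next
          case f': False
          then show ?thesis using \<open>mate X e \<noteq> d\<close> \<open>mate X e \<noteq> d'\<close> by (simp add: lab_merge)
        qed
      qed (use bd in auto)
      then show ?thesis using joinable_step step.merge[OF 1] step.merge[OF 2] by blast
    qed
  qed
qed

lemma local_confluence:
  assumes wf: "wf_dart_graph X" and conn: "connected_dart_graph X" and "step X Y" "step X W"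
  shows "joinable Y W"
  using assms(3,4) peak_merge_merge[OF wf conn] peak_merge_prune[OF wf] peak_prune_prune[OF wf conn]
    joinable_sym[OF wf_merge[OF wf]]
  by (auto elim!: step.cases)

section \<open>Termination and uniqueness of normal forms\<close>

definition graph_size :: "('v, 'd) dart_graph \<Rightarrow> nat" where
  "graph_size X = card (nodes X) + card (darts X)"

lemma step_size: "step X Y \<Longrightarrow> wf_dart_graph X \<Longrightarrow> graph_size Y < graph_size X"
proof (induction rule: step.induct)
  case (merge X v a b)
  have "card (nodes X - {v}) < card (nodes X)"
    using wfD(1)[OF merge(2)] can_mergeD(1)[OF merge(1)] by (rule card_Diff1_less)
  moreover have "card (darts X - {a, b}) \<le> card (darts X)"
    using wfD(2)[OF merge(2)] by (intro card_mono) auto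
  ultimately show ?case by (simp add: graph_size_def)
next
  case (prune X d j)
  have "card (darts X - {d}) < card (darts X)"
    using can_pruneD(1)[OF prune(1)] wfD(2)[OF prune(2)] by (rule card_Diff1_less[rotated])
  then show ?case by (simp add: graph_size_def)
qed

text \<open>The confluence argument of Newman's lemma, where the irreducible graphs with a single node,
  which are not unique up to \<open>sim\<close>, are compared through their values.\<close>

locale normal_form_property =
  fixes Q :: "('v, 'd) dart_graph \<Rightarrow> bool"
  assumes Q_sim: "wf_dart_graph K \<Longrightarrow> Q K \<Longrightarrow> sim K K' \<Longrightarrow> Q K'"
    and Q_chain: "chain_type K h \<Longrightarrow> chain_type K' h \<Longrightarrow> Q K \<Longrightarrow> Q K'"
    and Q_circle: "wf_dart_graph K \<Longrightarrow> circle_type K P \<Longrightarrow> circle_type K' P \<Longrightarrow> Q K \<Longrightarrow> Q K'"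
    and Q_irreducible: "wf_dart_graph K \<Longrightarrow> Q K \<Longrightarrow> \<not> step K K'"
begin

definition reaches :: "('v, 'd) dart_graph \<Rightarrow> bool" where
  "reaches X \<longleftrightarrow> (\<exists>K. step\<^sup>*\<^sup>* X K \<and> Q K)"

lemma reaches_sim:
  assumes "wf_dart_graph X" "sim X Y" "reaches X" shows "reaches Y"
  using assms sim_steps[OF _ assms(1,2)] Q_sim wf_steps unfolding reaches_def by metis

lemma reaches_backward: "step\<^sup>*\<^sup>* X Y \<Longrightarrow> reaches Y \<Longrightarrow> reaches X"
  unfolding reaches_def by (meson rtranclp_trans)

lemma reaches_step:
  assumes "wf_dart_graph X" "connected_dart_graph X" "reaches X" "step X Y"
  shows "reaches Y"
  using assms
proof (induction "graph_size X" arbitrary: X Y rule: less_induct)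
  case less
  note wf = less.prems(1) and conn = less.prems(2)
  obtain K where K: "step\<^sup>*\<^sup>* X K" "Q K" using less.prems(3) unfolding reaches_def by blast
  then obtain X1 where X1: "step X X1" "step\<^sup>*\<^sup>* X1 K"
    using Q_irreducible[OF wf] less.prems(4) by (metis converse_rtranclpE)
  note wf1 = wf_step[OF X1(1) wf]
  have conn1: "connected_dart_graph X1" using connected_step_iff[OF X1(1) wf] conn by blast
  \<comment> \<open>All graphs on the way from X1 are smaller than X, so the induction hypothesis
    applies to each single step.\<close>
  have steps: "reaches J" if "step\<^sup>*\<^sup>* X1 J" for J
    using that
  proof (induction rule: rtranclp_induct)
    case base
    then show ?case using X1(2) K(2) unfolding reaches_def by blast
  next
    case (step J J')
    have "graph_size J \<le> graph_size X1" using step(1)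
    proof (induction rule: rtranclp_induct)
      case (step J J')
      then show ?case using step_size wf_steps wf1 by (meson le_trans less_imp_le)
    qed simp
    then have "graph_size J < graph_size X" using step_size[OF X1(1) wf] by simp
    then show ?case
      using less.hyps step wf_steps[OF step(1) wf1] connected_steps_iff[OF step(1) wf1] conn1 by blast
  qed
  from local_confluence[OF wf conn X1(1) less.prems(4)] show ?case
    unfolding joinable_def
  proof (elim disjE exE conjE)
    fix J J' assume J: "step\<^sup>*\<^sup>* X1 J" "step\<^sup>*\<^sup>* Y J'" "sim J J'"
    then show ?thesis using steps reaches_sim wf_steps wf1 reaches_backward by blast
  next
    fix h assume h: "chain_type X1 h" "chain_type Y h"
    \<comment> \<open>Graphs of these types are irreducible, so the reduction from X1 to K has
      length 0.\<close>
    then have "K = X1" using X1(2) step_special(1) by (metis converse_rtranclpE)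
    then show ?thesis using h Q_chain K(2) unfolding reaches_def by blast
  next
    fix P assume P: "circle_type X1 P" "circle_type Y P"
    then have "K = X1" using X1(2) step_special(2) by (metis converse_rtranclpE)
    then show ?thesis using P Q_circle K(2) wf1 unfolding reaches_def by blast
  qed
qed

lemma reaches_steps:
  assumes "step\<^sup>*\<^sup>* X Y" "wf_dart_graph X" "connected_dart_graph X" "reaches X"
  shows "reaches Y"
  using assms
  by (induction rule: rtranclp_induct) (use reaches_step wf_steps connected_steps_iff in blast)+

end

section \<open>The dart graph of a weighted graph\<close>

definition edge_ends :: "'v wgraph \<Rightarrow> 'v \<Rightarrow> 'v \<Rightarrow> nat" where
  "edge_ends G u v = count (edges G) (Upair u v) * (if u = v then 2 else 1)"

definition total_ends :: "'v wgraph \<Rightarrow> 'v \<Rightarrow> nat" where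
  "total_ends G v = (\<Sum>u\<in>verts G. edge_ends G v u)"

text \<open>Each loop contributes two darts, with indices 2j and 2j + 1; this exchanges
  them.\<close>

definition flip :: "nat \<Rightarrow> nat" where
  "flip i = (if even i then i + 1 else i - 1)"

text \<open>Blowing up a loop lowers the weight by 4, but only by 2 after this correction: one for each
  end of the edge, as for other edges.\<close>

definition eff_weight :: "'v wgraph \<Rightarrow> 'v \<Rightarrow> int" where
  "eff_weight G v = weight G v - 2 * int (count (edges G) (Upair v v))"

text \<open>Darts \<open>(u, Some v, i)\<close> are edge ends at \<open>u\<close>; the legs \<open>(u, None, i)\<close> raise every valence to
  at least 2.\<close>

definition dg_of :: "'v wgraph \<Rightarrow> ('v, 'v \<times> 'v option \<times> nat) dart_graph" where
  "dg_of G = \<lparr>nodes = verts G,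
     darts = {(u, t, i). u \<in> verts G \<and>
        (case t of None \<Rightarrow> i < 2 - total_ends G u | Some v \<Rightarrow> v \<in> verts G \<and> i < edge_ends G u v)},
     base = fst,
     mate = (\<lambda>(u, t, i). case t of None \<Rightarrow> (u, None, i)
        | Some v \<Rightarrow> (v, Some u, if u = v then flip i else i)),
     eff = eff_weight G,
     lab = (\<lambda>_. turn)\<rparr>"

lemma dg_of_simps [simp]:
  "nodes (dg_of G) = verts G" "base (dg_of G) = fst" "eff (dg_of G) = eff_weight G"
  "lab (dg_of G) d = turn" "mate (dg_of G) (u, None, i) = (u, None, i)"
  "mate (dg_of G) (u, Some v, i) = (v, Some u, if u = v then flip i else i)"
  "(u, None, i) \<in> darts (dg_of G) \<longleftrightarrow> u \<in> verts G \<and> i < 2 - total_ends G u"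
  "(u, Some v, i) \<in> darts (dg_of G) \<longleftrightarrow> u \<in> verts G \<and> v \<in> verts G \<and> i < edge_ends G u v"
  by (simp_all add: dg_of_def)

lemma dart_cases:
  obtains u i where "d = (u, None, i)" | u v i where "d = (u, Some v, i)"
  by (metis option.exhaust prod_cases3)

lemma edge_ends_sym: "edge_ends G u v = edge_ends G v u"
proof -
  have "count (edges G) (Upair u v) = count (edges G) (Upair v u)"
    by (rule arg_cong[where f = "count (edges G)"]) simp
  then show ?thesis by (auto simp: edge_ends_def)
qed

lemma flip_flip [simp]: "flip (flip i) = i" by (auto simp: flip_def)

lemma flip_less: "i < 2 * c \<Longrightarrow> flip i < 2 * c"
  unfolding flip_def by presburger

lemma flip_neq [simp]: "flip i \<noteq> i"
  unfolding flip_def by presburger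

lemma flip_edge_ends: "i < edge_ends G u u \<Longrightarrow> flip i < edge_ends G u u"
  using flip_less[of i "count (edges G) (Upair u u)"] by (simp add: edge_ends_def mult.commute)

lemma wgraph_finite: "wgraph G \<Longrightarrow> finite (verts G)" and wgraph_nonempty: "wgraph G \<Longrightarrow> verts G \<noteq> {}"
  by (simp_all add: wgraph_def)

lemma wgraph_edge: "wgraph G \<Longrightarrow> Upair u v \<in># edges G \<Longrightarrow> u \<in> verts G \<and> v \<in> verts G"
  unfolding wgraph_def by fastforce

lemma darts_at_dg_of:
  assumes "v \<in> verts G"
  shows "darts_at (dg_of G) v = (\<lambda>(u, i). (v, Some u, i)) ` (SIGMA u:verts G. {..<edge_ends G v u})
     \<union> (\<lambda>i. (v, None, i)) ` {..<2 - total_ends G v}"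
proof (rule set_eqI)
  fix d show "d \<in> darts_at (dg_of G) v \<longleftrightarrow> d \<in> (\<lambda>(u, i). (v, Some u, i)) ` (SIGMA u:verts G. {..<edge_ends G v u})
     \<union> (\<lambda>i. (v, None, i)) ` {..<2 - total_ends G v}"
    using assms by (cases d rule: dart_cases) (auto simp: darts_at_def)
qed

lemma card_darts_at_dg_of:
  assumes wf: "wgraph G" and v: "v \<in> verts G"
  shows "card (darts_at (dg_of G) v) = max 2 (total_ends G v)"
proof -
  let ?A = "(\<lambda>(u, i). (v, Some u, i)) ` (SIGMA u:verts G. {..<edge_ends G v u})"
  let ?B = "(\<lambda>i. (v, None :: 'a option, i)) ` {..<2 - total_ends G v}"
  have "card ?A = card (SIGMA u:verts G. {..<edge_ends G v u})"
    by (rule card_image) (auto simp: inj_on_def)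
  also have "\<dots> = total_ends G v"
    using wgraph_finite[OF wf] by (simp add: total_ends_def)
  finally have A: "card ?A = total_ends G v" .
  have B: "card ?B = 2 - total_ends G v"
    by (subst card_image) (auto simp: inj_on_def)
  have "finite ?A" "finite ?B" using wgraph_finite[OF wf] by auto
  moreover have "?A \<inter> ?B = {}" by auto
  ultimately have "card (?A \<union> ?B) = card ?A + card ?B" by (rule card_Un_disjoint)
  then show ?thesis unfolding darts_at_dg_of[OF v] A B by simp
qed

lemma finite_darts_dg_of:
  assumes "wgraph G" shows "finite (darts (dg_of G))"
proof -
  have "darts (dg_of G) = (\<Union>v\<in>verts G. darts_at (dg_of G) v)"
  proof (rule set_eqI)
    fix d show "d \<in> darts (dg_of G) \<longleftrightarrow> d \<in> (\<Union>v\<in>verts G. darts_at (dg_of G) v)"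
      by (cases d rule: dart_cases) (auto simp: darts_at_def)
  qed
  moreover have "finite (darts_at (dg_of G) v)" if "v \<in> verts G" for v
    unfolding darts_at_dg_of[OF that] using wgraph_finite[OF assms] by auto
  ultimately show ?thesis using wgraph_finite[OF assms] by simp
qed

lemma wf_dg_of:
  assumes "wgraph G" shows "wf_dart_graph (dg_of G)"
  unfolding wf_dart_graph_def
proof (intro conjI ballI)
  fix d assume d: "d \<in> darts (dg_of G)"
  show "base (dg_of G) d \<in> nodes (dg_of G)" using d by (cases d rule: dart_cases) auto
  show "mate (dg_of G) d \<in> darts (dg_of G)" using d
    by (cases d rule: dart_cases) (auto simp: flip_edge_ends edge_ends_sym)
  show "mate (dg_of G) (mate (dg_of G) d) = d" by (cases d rule: dart_cases) auto
next
  fix v assume "v \<in> nodes (dg_of G)"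
  then show "2 \<le> card (darts_at (dg_of G) v)" using card_darts_at_dg_of[OF assms, of v] by simp
qed (use assms wgraph_finite wgraph_nonempty finite_darts_dg_of in auto)

lemma vertex_degree_total_ends:
  assumes wf: "wgraph G"
  shows "vertex_degree G v = total_ends G v"
proof -
  have "size {#e \<in># E. v \<in> set_uprod e#} + count E (Upair v v) =
      (\<Sum>u\<in>V. count E (Upair v u) * (if v = u then 2 else 1))"
    if "finite V" "\<forall>e\<in>#E. set_uprod e \<subseteq> V" for E and V :: "'a set"
    using that(2)
  proof (induction E)
    case (add e E)
    obtain x y where e: "e = Upair x y" using uprod_exhaust by blast
    have xy: "x \<in> V" "y \<in> V" using add.prems e by auto
    let ?c = "\<lambda>u. if v = u then 2 else 1 :: nat"
    have "(\<Sum>u\<in>V. count (add_mset e E) (Upair v u) * ?c u) =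
       (\<Sum>u\<in>V. count E (Upair v u) * ?c u) + (\<Sum>u\<in>V. (if Upair v u = e then ?c u else 0))"
      unfolding sum.distrib[symmetric] by (rule sum.cong) auto
    moreover have "(\<Sum>u\<in>V. (if Upair v u = e then ?c u else 0)) =
       (if v = x \<and> v = y then 2 else if v = x \<or> v = y then 1 else 0)"
    proof (cases "v = x \<or> v = y")
      case True
      \<comment> \<open>The other end of the edge e; for a loop it is v itself.\<close>
      define w where "w = (if v = x then y else x)"
      have "(\<Sum>u\<in>V. (if Upair v u = e then ?c u else 0)) = (\<Sum>u\<in>V. if u = w then ?c w else 0)"
        using True by (intro sum.cong) (auto simp: e w_def)
      also have "\<dots> = ?c w" using that(1) xy by (simp add: w_def)
      finally show ?thesis using True by (auto simp: w_def)
    next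
      case False
      then show ?thesis by (simp add: e)
    qed
    ultimately show ?case using add by (auto simp: e)
  qed simp
  from this[of "verts G" "edges G"] show ?thesis
    using wf unfolding vertex_degree_def total_ends_def edge_ends_def wgraph_def by simp
qed

lemma connected_dg_of:
  assumes "connected_wgraph G" shows "connected_dart_graph (dg_of G)"
  unfolding connected_dart_graph_def
proof (intro allI impI, elim conjE)
  fix U assume U: "U \<subseteq> nodes (dg_of G)" "U \<noteq> {}"
    and cl: "\<forall>d\<in>darts (dg_of G). base (dg_of G) d \<in> U \<longrightarrow> base (dg_of G) (mate (dg_of G) d) \<in> U"
  have wf: "wgraph G" using assms by (simp add: connected_wgraph_def)
  obtain u where u: "u \<in> U" using U by blast
  have "v \<in> U" if "(u, v) \<in> (adjacency G)\<^sup>*" for v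
    using that
  proof (induction rule: rtrancl_induct)
    case (step p q)
    then have pq: "Upair p q \<in># edges G" by (simp add: adjacency_def)
    then have "(p, Some q, 0) \<in> darts (dg_of G)"
      using wgraph_edge[OF wf pq] by (auto simp: edge_ends_def)
    then show ?case using cl step(3) by fastforce
  qed (rule u)
  then show "U = nodes (dg_of G)" using assms U u unfolding connected_wgraph_def by auto
qed

lemma sim_connected:
  assumes wf: "wf_dart_graph X" and "sim X Y" "connected_dart_graph X"
  shows "connected_dart_graph Y"
  unfolding connected_dart_graph_def
proof (intro allI impI, elim conjE)
  fix U assume U: "U \<subseteq> nodes Y" "U \<noteq> {}" and cl: "\<forall>d\<in>darts Y. base Y d \<in> U \<longrightarrow> base Y (mate Y d) \<in> U"
  obtain \<phi> \<psi> k where s: "sim_via X Y \<phi> \<psi> k" using assms(2) unfolding sim_def by blast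
  have im: "nodes Y = \<phi> ` nodes X" using sim_viaD(1)[OF s] by (simp add: bij_betw_def)
  have "nodes X = {v \<in> nodes X. \<phi> v \<in> U}"
  proof (rule connected_closed[OF assms(3)])
    show "{v \<in> nodes X. \<phi> v \<in> U} \<noteq> {}" using U im by auto
  next
    fix d assume d: "d \<in> darts X" "base X d \<in> {v \<in> nodes X. \<phi> v \<in> U}"
    have "base Y (mate Y (\<psi> d)) \<in> U" using d cl sim_viaD(3)[OF s d(1)] sim_via_inj(3)[OF s d(1)] by auto
    then show "base X (mate X d) \<in> {v \<in> nodes X. \<phi> v \<in> U}"
      using sim_viaD(4)[OF s d(1)] sim_viaD(3)[OF s wfD(5)[OF wf d(1)]] wfD(4)[OF wf wfD(5)[OF wf d(1)]]
      by (simp del: mem_Collect_eq) (simp)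
  qed auto
  then show "U = nodes Y" using im U by auto
qed

lemma count_image_uprod:
  assumes f: "inj_on f V" and E: "\<forall>e\<in>#E. set_uprod e \<subseteq> V" and uv: "u \<in> V" "v \<in> V"
  shows "count (image_mset (map_uprod f) E) (Upair (f u) (f v)) = count E (Upair u v)"
proof -
  have "e = Upair u v" if "e \<in># E" "map_uprod f e = Upair (f u) (f v)" for e
  proof -
    obtain x y where e: "e = Upair x y" using uprod_exhaust by blast
    then have "x \<in> V" "y \<in> V" using E that(1) by fastforce+
    then show ?thesis using that(2) e f uv by (auto simp: inj_on_def)
  qed
  then have sub: "map_uprod f -` {Upair (f u) (f v)} \<inter> set_mset E \<subseteq> {Upair u v}" by blast
  show ?thesis
  proof (cases "Upair u v \<in># E")
    case True
    have "Upair u v \<in> map_uprod f -` {Upair (f u) (f v)} \<inter> set_mset E" using True by simp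
    then have eq: "map_uprod f -` {Upair (f u) (f v)} \<inter> set_mset E = {Upair u v}" using sub by blast
    show ?thesis unfolding count_image_mset eq by simp
  next
    case False
    then have eq: "map_uprod f -` {Upair (f u) (f v)} \<inter> set_mset E = {}" using sub by blast
    show ?thesis unfolding count_image_mset eq using False by (simp add: not_in_iff)
  qed
qed

lemma sim_dg_of_iso:
  assumes "G \<cong>\<^sub>w H" shows "sim (dg_of G) (dg_of H)"
proof -
  obtain f where wf: "wgraph G" "wgraph H" and f: "bij_betw f (verts G) (verts H)"
    and e: "image_mset (map_uprod f) (edges G) = edges H"
    and w: "\<forall>v\<in>verts G. weight H (f v) = weight G v"
    using assms unfolding wgraph_iso_def by blast
  have inj: "inj_on f (verts G)" and im: "f ` verts G = verts H" using f by (auto simp: bij_betw_def)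
  have cnt: "count (edges H) (Upair (f u) (f v)) = count (edges G) (Upair u v)"
    if "u \<in> verts G" "v \<in> verts G" for u v
    using count_image_uprod[OF inj _ that] wf(1) unfolding e[symmetric] wgraph_def by blast
  have ee: "edge_ends H (f u) (f v) = edge_ends G u v" if "u \<in> verts G" "v \<in> verts G" for u v
    using cnt[OF that] that inj unfolding edge_ends_def inj_on_def by auto
  have te: "total_ends H (f u) = total_ends G u" if "u \<in> verts G" for u
    unfolding total_ends_def im[symmetric] using ee[OF that] by (simp add: sum.reindex[OF inj])
  define \<psi> where "\<psi> = (\<lambda>(u, t, i :: nat). (f u, map_option f t, i))"
  have \<psi>: "\<psi> (u, None, i) = (f u, None, i)" "\<psi> (u, Some v, i) = (f u, Some (f v), i)" for u v i
    by (simp_all add: \<psi>_def)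
  have "inj_on \<psi> (darts (dg_of G))"
  proof (rule inj_onI)
    fix d d' assume "d \<in> darts (dg_of G)" "d' \<in> darts (dg_of G)" "\<psi> d = \<psi> d'"
    then show "d = d'" using inj
      by (cases d rule: dart_cases; cases d' rule: dart_cases) (auto simp: \<psi> inj_on_def)
  qed
  moreover have "\<psi> ` darts (dg_of G) = darts (dg_of H)"
  proof (intro equalityI subsetI)
    fix d assume "d \<in> \<psi> ` darts (dg_of G)"
    then obtain d0 where "d0 \<in> darts (dg_of G)" "d = \<psi> d0" by blast
    then show "d \<in> darts (dg_of H)"
      using im by (cases d0 rule: dart_cases) (auto simp: \<psi> te ee)
  next
    fix d assume d: "d \<in> darts (dg_of H)"
    show "d \<in> \<psi> ` darts (dg_of G)"
    proof (cases d rule: dart_cases)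
      case (1 u' i)
      then obtain u where "u \<in> verts G" "u' = f u" using d im by auto
      then have "(u, None, i) \<in> darts (dg_of G)" "d = \<psi> (u, None, i)" using 1 d te by (auto simp: \<psi>)
      then show ?thesis by blast
    next
      case (2 u' v' i)
      then have "u' \<in> f ` verts G" "v' \<in> f ` verts G" using d im by auto
      then obtain u v where "u \<in> verts G" "u' = f u" "v \<in> verts G" "v' = f v" by blast
      then have "(u, Some v, i) \<in> darts (dg_of G)" "d = \<psi> (u, Some v, i)" using 2 d ee by (auto simp: \<psi>)
      then show ?thesis by blast
    qed
  qed
  ultimately have bij: "bij_betw \<psi> (darts (dg_of G)) (darts (dg_of H))" by (simp add: bij_betw_def)
  have "sim_via (dg_of G) (dg_of H) f \<psi> (\<lambda>_. 0)"
    unfolding sim_via_def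
  proof (intro conjI ballI impI)
    fix d assume d: "d \<in> darts (dg_of G)"
    show "base (dg_of H) (\<psi> d) = f (base (dg_of G) d)" "mate (dg_of H) (\<psi> d) = \<psi> (mate (dg_of G) d)"
      using d inj by (cases d rule: dart_cases; auto simp: \<psi> inj_on_def)+
    show "\<exists>m. lab (dg_of H) (\<psi> d) = twist (- 0) * lab (dg_of G) d * twist m" by (rule exI[of _ 0]) simp
    show "lab (dg_of H) (\<psi> d) = twist (- 0) * lab (dg_of G) d * twist (- 0)" by simp
  qed (use f bij w cnt in \<open>auto simp: eff_weight_def\<close>)
  then show ?thesis unfolding sim_def by blast
qed


section \<open>Blowups\<close>

lemma sum_indicator_darts:
  assumes "finite (darts_at Y w)"
  shows "(\<Sum>d\<in>darts_at Y w. if d \<in> A then 1 else 0 :: int) = int (card (darts_at Y w \<inter> A))"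
  using assms by (simp add: sum.If_cases)

lemma wf_outer:
  assumes "wgraph H" "v \<in> verts H"
  shows "wgraph \<lparr>verts = insert x (verts H), edges = edges H + {#Upair v x#}, weight = w\<rparr>"
  using assms unfolding wgraph_def by auto

text \<open>The new vertex has its edge and one leg. Merging it produces a leg at v with label T S
  T. If v had degree at least 2, this leg is pruned and gives back the lost unit of weight.
  Otherwise v had legs before, one of which is missing after the blowup; the new leg replaces it, a
  gauge change restoring the weight and the free end absorbing the other twist.\<close>

lemma outer_blowup_reduces:
  assumes wfH: "wgraph H" and v: "v \<in> verts H" and x: "x \<notin> verts H"
    and G: "G = \<lparr>verts = insert x (verts H), edges = edges H + {#Upair v x#},
      weight = (weight H)(x := -1, v := weight H v - 1)\<rparr>"
  shows "\<exists>Y. step\<^sup>*\<^sup>* (dg_of G) Y \<and> sim Y (dg_of H)"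
proof -
  have wfG: "wgraph G" unfolding G by (rule wf_outer[OF wfH v])
  note fin = wgraph_finite[OF wfH]
  have xv: "x \<noteq> v" using x v by auto
  have cx: "count (edges H) (Upair x u) = 0" "count (edges H) (Upair u x) = 0" for u
    using wgraph_edge[OF wfH] x by (meson count_inI)+
  have vG: "verts G = insert x (verts H)" by (simp add: G)
  have e1: "edge_ends G p q = edge_ends H p q" if "p \<noteq> x" "q \<noteq> x" for p q
    using that by (simp add: edge_ends_def G)
  have e2: "edge_ends G x q = (if q = v then 1 else 0)" "edge_ends G q x = (if q = v then 1 else 0)" for q
    using xv cx by (auto simp: edge_ends_def G)
  have tx: "total_ends G x = 1"
    unfolding total_ends_def vG using fin x v xv by (simp add: e2)
  have tt: "total_ends G p = total_ends H p + (if p = v then 1 else 0)" if "p \<in> verts H" for p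
  proof -
    have "p \<noteq> x" using that x by auto
    have "(\<Sum>u\<in>verts H. edge_ends G p u) = (\<Sum>u\<in>verts H. edge_ends H p u)"
      using x \<open>p \<noteq> x\<close> by (intro sum.cong refl e1) auto
    then show ?thesis unfolding total_ends_def vG using fin x by (simp add: e2)
  qed
  have ew: "eff_weight G x = -1" "eff_weight G v = eff_weight H v - 1"
    "\<And>p. p \<noteq> x \<Longrightarrow> p \<noteq> v \<Longrightarrow> eff_weight G p = eff_weight H p"
    using xv cx by (auto simp: eff_weight_def G)
  define a where "a = (x, Some v, 0 :: nat)"
  define b where "b = (x, None :: 'a option, 0 :: nat)"
  define e where "e = (v, Some x, 0 :: nat)"
  let ?G = "dg_of G"
  have memG: "(p, None, i) \<in> darts ?G \<longleftrightarrow> (p = x \<and> i = 0) \<or> (p \<in> verts H \<and> i < 2 - total_ends G p)"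
    "(p, Some q, i) \<in> darts ?G \<longleftrightarrow> (p = x \<and> q = v \<and> i = 0) \<or> (p = v \<and> q = x \<and> i = 0) \<or>
       (p, Some q, i) \<in> darts (dg_of H)" for p q i
  proof -
    show "(p, None, i) \<in> darts ?G \<longleftrightarrow> (p = x \<and> i = 0) \<or> (p \<in> verts H \<and> i < 2 - total_ends G p)"
      using x tx by (auto simp: vG)
    show "(p, Some q, i) \<in> darts ?G \<longleftrightarrow> (p = x \<and> q = v \<and> i = 0) \<or> (p = v \<and> q = x \<and> i = 0) \<or>
       (p, Some q, i) \<in> darts (dg_of H)"
    proof (cases "p = x \<or> q = x")
      case True
      then show ?thesis using x v xv by (auto simp: vG e2 split: if_splits)
    next
      case False
      then show ?thesis by (simp add: vG e1)
    qed
  qed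
  have eH: "e \<notin> darts (dg_of H)" "a \<notin> darts (dg_of H)" "b \<notin> darts (dg_of H)"
    using x by (auto simp: e_def a_def b_def)
  have nx: "(x, t, i) \<notin> darts (dg_of H)" "(p, Some x, i) \<notin> darts (dg_of H)" for t i p
  proof -
    show "(x, t, i) \<notin> darts (dg_of H)" using x by (cases t) auto
    show "(p, Some x, i) \<notin> darts (dg_of H)" using x by simp
  qed
  have atx: "darts_at ?G x = {a, b}"
  proof (rule set_eqI)
    fix d show "d \<in> darts_at ?G x \<longleftrightarrow> d \<in> {a, b}"
      using x xv nx by (cases d rule: dart_cases) (auto simp: darts_at_def memG a_def b_def simp del: dg_of_simps(7,8))
  qed
  have cm: "can_merge ?G x a b"
    unfolding can_merge_def atx using xv by (simp add: a_def b_def vG)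
  let ?Y = "merge ?G x a b"
  have wfY: "wf_dart_graph ?Y" by (rule wf_merge[OF wf_dg_of[OF wfG] cm])
  have stY: "step ?G ?Y" by (rule step.merge[OF cm])
  have nY: "nodes ?Y = verts H" using x by (simp add: vG)
  have dY: "d \<in> darts ?Y \<longleftrightarrow> d = e \<or> (d \<in> darts ?G \<and> d \<noteq> a \<and> d \<noteq> b)" for d
    using xv by (auto simp: e_def a_def b_def memG simp del: dg_of_simps(7,8))
  have mate_a: "mate ?G d = a \<longleftrightarrow> d = e" "mate ?G d \<noteq> b" if "d \<in> darts ?Y" for d
    using that xv by (cases d rule: dart_cases; auto simp: a_def b_def e_def)+
  have mY: "mate ?Y d = (if d = e then e else mate ?G d)" if "d \<in> darts ?Y" for d
    using mate_a[OF that] by (auto simp: mate_merge a_def b_def e_def)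
  have lY: "lab ?Y d = (if d = e then twist 1 * turn * twist 1 else turn)" if "d \<in> darts ?Y" for d
    using mate_a[OF that] turn_blowup by (simp add: lab_merge ew)
  have eY: "e \<in> darts ?Y" using dY by blast
  show ?thesis
  proof (cases "2 \<le> total_ends H v")
    case True
    have "card (darts_at ?Y v) = card (darts_at ?G v)" using darts_at_merge[OF cm, of v] xv by simp
    then have "3 \<le> card (darts_at ?Y (base ?Y e))"
      using card_darts_at_dg_of[OF wfG, of v] tt[OF v] True v by (simp add: vG e_def)
    then have cp: "can_prune ?Y e 1"
      unfolding can_prune_def using eY mY[OF eY] lY[OF eY] by auto
    have "darts (prune ?Y e 1) = darts (dg_of H)"
    proof (rule set_eqI)
      fix d show "d \<in> darts (prune ?Y e 1) \<longleftrightarrow> d \<in> darts (dg_of H)"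
        using True tt x nx
        by (cases d rule: dart_cases) (auto simp: memG a_def b_def e_def simp del: dg_of_simps(7,8) simp: dg_of_simps(7)[of _ _ H] split: if_splits)
    qed
    then have "sim (prune ?Y e 1) (dg_of H)"
    proof (intro sim_agree)
      fix d assume "d \<in> darts (prune ?Y e 1)"
      then have d: "d \<in> darts ?Y" "d \<noteq> e" by auto
      show "base (prune ?Y e 1) d = base (dg_of H) d \<and> mate (prune ?Y e 1) d = mate (dg_of H) d"
        using mY[OF d(1)] d(2) by (cases d rule: dart_cases) auto
      show "lab (prune ?Y e 1) d = lab (dg_of H) d \<or>
         mate (prune ?Y e 1) d = d \<and> (\<exists>m. lab (dg_of H) d = lab (prune ?Y e 1) d * twist m)"
        using lY[OF d(1)] d(2) by simp
    next
      fix u assume "u \<in> nodes (prune ?Y e 1)"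
      then have "u \<noteq> x" using x by simp
      then show "eff (prune ?Y e 1) u = eff (dg_of H) u" using ew by (simp add: e_def)
    qed (use nY in auto)
    then show ?thesis using stY step.prune[OF cp] by (meson rtranclp.rtrancl_into_rtrancl rtranclp.rtrancl_refl)
  next
    case False
    \<comment> \<open>The last leg of H at v, which disappears when v gains an edge.\<close>
    define z where "z = (v, None :: 'a option, 1 - total_ends H v)"
    define \<psi> where "\<psi> d = (if d = e then z else d)" for d
    define k where "k d = (if d \<in> {e} then 1 else 0 :: int)" for d
    have zH: "z \<in> darts (dg_of H)" using False v by (simp add: z_def)
    have "darts ?Y - {e} = darts (dg_of H) - {z}"
    proof (rule set_eqI)
      fix d show "d \<in> darts ?Y - {e} \<longleftrightarrow> d \<in> darts (dg_of H) - {z}"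
        using False tt x nx v
        by (cases d rule: dart_cases) (auto simp: memG a_def b_def e_def z_def simp del: dg_of_simps(7,8) simp: dg_of_simps(7)[of _ _ H] split: if_splits)
    qed
    then have DY: "darts ?Y = insert e (darts (dg_of H) - {z})" using eY by blast
    have bij: "bij_betw \<psi> (darts ?Y) (darts (dg_of H))"
      unfolding bij_betw_def inj_on_def DY using eH zH by (auto simp: \<psi>_def)
    have "sim_via ?Y (dg_of H) id \<psi> k"
      unfolding sim_via_def
    proof (intro conjI ballI impI)
      show "bij_betw id (nodes ?Y) (nodes (dg_of H))" using nY by simp
      show "bij_betw \<psi> (darts ?Y) (darts (dg_of H))" by (rule bij)
    next
      fix d assume d: "d \<in> darts ?Y"
      have me: "mate ?G d \<noteq> e" if "d \<noteq> e"
        using that d xv by (cases d rule: dart_cases) (auto simp: e_def a_def)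
      show "base (dg_of H) (\<psi> d) = id (base ?Y d)" by (simp add: \<psi>_def z_def e_def)
      show "mate (dg_of H) (\<psi> d) = \<psi> (mate ?Y d)"
        using mY[OF d] me by (cases d rule: dart_cases) (auto simp: \<psi>_def z_def)
      show "\<exists>m. lab (dg_of H) (\<psi> d) = twist (- k d) * lab ?Y d * twist m"
        using lY[OF d] by (intro exI[of _ "if d = e then -1 else 0"])
          (simp add: k_def mult.assoc twist_twist twist_twist_left)
      show "lab (dg_of H) (\<psi> d) = twist (- k d) * lab ?Y d * twist (- k (mate ?Y d))" if "mate ?Y d \<noteq> d"
        using lY[OF d] mY[OF d] me that by (auto simp: k_def)
    next
      fix u assume u: "u \<in> nodes ?Y"
      then have "u \<noteq> x" using x by auto
      have "darts_at ?Y u \<inter> {e} = (if u = v then {e} else {})"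
        using eY by (auto simp: darts_at_def e_def)
      then have "(\<Sum>d\<in>darts_at ?Y u. k d) = (if u = v then 1 else 0)"
        unfolding k_def using sum_indicator_darts[of ?Y u "{e}", OF finite_darts_at[OF wfY]] by simp
      then show "eff (dg_of H) (id u) = eff ?Y u + (\<Sum>d\<in>darts_at ?Y u. k d)"
        using ew \<open>u \<noteq> x\<close> by auto
    qed
    then show ?thesis using stY unfolding sim_def by blast
  qed
qed

text \<open>Merging the new vertex restores the edge with label T S T in place of S. A gauge change
  by 1 at both ends moves the two twists back into the weights; for a loop both go to the same
  vertex.\<close>

lemma inner_blowup_reduces:
  assumes wfH: "wgraph H" and uv: "Upair u v \<in># edges H" and x: "x \<notin> verts H"
    and G: "G = \<lparr>verts = insert x (verts H), edges = edges H - {#Upair u v#} + {#Upair u x, Upair x v#},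
      weight = (if u = v then (weight H)(x := -1, u := weight H u - 4)
               else (weight H)(x := -1, u := weight H u - 1, v := weight H v - 1))\<rparr>"
  shows "wgraph G" "\<exists>Y. step\<^sup>*\<^sup>* (dg_of G) Y \<and> sim Y (dg_of H)"
proof -
  note fin = wgraph_finite[OF wfH]
  have uH: "u \<in> verts H" and vH: "v \<in> verts H" using wgraph_edge[OF wfH uv] by auto
  show wfG: "wgraph G"
    using wfH uH vH unfolding G wgraph_def by (auto dest: in_diffD)
  have xuv: "x \<noteq> u" "x \<noteq> v" using x uH vH by auto
  have cx: "count (edges H) (Upair x w) = 0" "count (edges H) (Upair w x) = 0" for w
    using wgraph_edge[OF wfH] x by (meson count_inI)+
  have vG: "verts G = insert x (verts H)" by (simp add: G)
  have c1: "1 \<le> count (edges H) (Upair u v)" using uv by simp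
  have e1: "edge_ends G p q = edge_ends H p q - (if {p, q} = {u, v} then (if u = v then 2 else 1) else 0)"
    if "p \<noteq> x" "q \<noteq> x" for p q
  proof -
    have cnt: "count (edges G) (Upair p q) = count (edges H) (Upair p q) - (if Upair p q = Upair u v then 1 else 0)"
      using that by (simp add: G)
    have iff: "{p, q} = {u, v} \<longleftrightarrow> Upair p q = Upair u v" by (auto simp: doubleton_eq_iff)
    show ?thesis
    proof (cases "Upair p q = Upair u v")
      case True
      then have "p = q \<longleftrightarrow> u = v" by auto
      then show ?thesis unfolding iff edge_ends_def cnt using True by (simp add: diff_mult_distrib)
    next
      case False
      then show ?thesis unfolding iff edge_ends_def cnt by (simp only: if_False diff_zero)
    qed
  qed
  have e2: "edge_ends G x q = (if q = u then 1 else 0) + (if q = v then 1 else 0)"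
    "edge_ends G q x = (if q = u then 1 else 0) + (if q = v then 1 else 0)" for q
    using xuv cx by (auto simp: edge_ends_def G)
  have tx: "total_ends G x = 2"
    unfolding total_ends_def vG using fin x uH vH xuv by (simp add: e2 sum.distrib)
  have tt: "total_ends G p = total_ends H p" if p: "p \<in> verts H" for p
  proof -
    have "p \<noteq> x" using that x by auto
    have "edge_ends H p q = edge_ends G p q + (if {p, q} = {u, v} then (if u = v then 2 else 1) else 0)"
      if "q \<in> verts H" for q
    proof -
      have "(if {p, q} = {u, v} then (if u = v then 2 else 1) else 0) \<le> edge_ends H p q"
      proof (cases "{p, q} = {u, v}")
        case True
        then have "Upair p q = Upair u v" "p = q \<longleftrightarrow> u = v" by (auto simp: doubleton_eq_iff)
        then show ?thesis unfolding edge_ends_def using c1 by (simp del: Upair_inject)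
      qed simp
      moreover have "q \<noteq> x" using that x by auto
      ultimately show ?thesis using e1[of p q] \<open>p \<noteq> x\<close> by simp
    qed
    then have "total_ends H p = (\<Sum>q\<in>verts H. edge_ends G p q) +
        (\<Sum>q\<in>verts H. if {p, q} = {u, v} then (if u = v then 2 else 1) else 0)"
      unfolding total_ends_def sum.distrib[symmetric] by (intro sum.cong) auto
    also have "(\<Sum>q\<in>verts H. if {p, q} = {u, v} then (if u = v then 2 else 1) else 0) =
       (if p = u then 1 else 0) + (if p = v then 1 else 0 :: nat)"
    proof (cases "p = u \<or> p = v")
      case True
      define w where "w = (if p = u then v else u)"
      have "(\<Sum>q\<in>verts H. if {p, q} = {u, v} then (if u = v then 2 else 1) else 0) =
          (\<Sum>q\<in>verts H. if q = w then (if u = v then 2 else 1) else 0 :: nat)"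
        using True by (intro sum.cong) (auto simp: w_def doubleton_eq_iff)
      also have "\<dots> = (if u = v then 2 else 1)" using fin uH vH by (simp add: w_def)
      finally show ?thesis using True by auto
    next
      case False
      then show ?thesis by (auto simp: doubleton_eq_iff)
    qed
    finally show ?thesis unfolding total_ends_def vG using fin x by (simp add: e2)
  qed
  \<comment> \<open>For a loop the weight drops by 4, but the loop itself disappears and stops
    counting 2, so the effective weight drops by 2.\<close>
  have ew: "eff_weight G x = -1"
    "\<And>p. p \<noteq> x \<Longrightarrow> eff_weight H p = eff_weight G p + (if p = u then 1 else 0) + (if p = v then 1 else 0)"
    using xuv cx c1 by (auto simp: eff_weight_def G)
  define c where "c = edge_ends G u v"
  \<comment> \<open>For a loop, the two new edges are parallel, so the second one gets index 1. The
    removed loop has indices c and c + 1, which \<open>flip\<close> exchanges because c is then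
    even.\<close>
  define \<delta> where "\<delta> = (if u = v then 1 else 0 :: nat)"
  define a where "a = (x, Some u, 0 :: nat)"
  define b where "b = (x, Some v, \<delta>)"
  define e where "e = (u, Some x, 0 :: nat)"
  define f where "f = (v, Some x, \<delta>)"
  define y where "y = (u, Some v, c)"
  define z where "z = (v, Some u, c + \<delta>)"
  have cH: "edge_ends H u v = c + \<delta> + 1" "edge_ends H v u = c + \<delta> + 1" "u = v \<Longrightarrow> even c"
  proof -
    obtain n where n: "count (edges H) (Upair u v) = Suc n" using c1 by (metis Suc_le_D One_nat_def)
    have "edge_ends H u v = Suc n * (if u = v then 2 else 1)" "c = n * (if u = v then 2 else 1)"
      using xuv n by (simp_all add: edge_ends_def c_def G)
    then show "edge_ends H u v = c + \<delta> + 1" "edge_ends H v u = c + \<delta> + 1" "u = v \<Longrightarrow> even c"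
      using edge_ends_sym[of H u v] by (simp_all add: \<delta>_def)
  qed
  have cG: "edge_ends G u v = c" "edge_ends G v u = c"
    unfolding c_def by (rule refl, rule edge_ends_sym)
  let ?G = "dg_of G"
  have memG: "(p, None, i) \<in> darts ?G \<longleftrightarrow> (p, None, i) \<in> darts (dg_of H)"
    "(p, Some q, i) \<in> darts ?G \<longleftrightarrow> (p, Some q, i) \<in> {a, b, e, f} \<or>
      ((p, Some q, i) \<in> darts (dg_of H) \<and> (p, Some q, i) \<notin> {y, z})" for p q i
  proof -
    show "(p, None, i) \<in> darts ?G \<longleftrightarrow> (p, None, i) \<in> darts (dg_of H)"
      using x tx tt by (auto simp: vG)
    show "(p, Some q, i) \<in> darts ?G \<longleftrightarrow> (p, Some q, i) \<in> {a, b, e, f} \<or>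
      ((p, Some q, i) \<in> darts (dg_of H) \<and> (p, Some q, i) \<notin> {y, z})"
    proof (cases "p = x \<or> q = x")
      case True
      then have nh: "(p, Some q, i) \<notin> darts (dg_of H)" using x by auto
 have "(p, Some q, i) \<in> darts ?G \<longleftrightarrow>
          (p = x \<or> p \<in> verts H) \<and> (q = x \<or> q \<in> verts H) \<and> i < edge_ends G p q"
        by (simp add: vG)
      also have "\<dots> \<longleftrightarrow> (p = x \<and> (q = u \<and> i = 0 \<or> q = v \<and> i = \<delta>)) \<or>
          (q = x \<and> (p = u \<and> i = 0 \<or> p = v \<and> i = \<delta>))"
      proof (cases "p = x")
        case True
        then show ?thesis using x xuv uH vH e2(1)[of q] by (auto simp: \<delta>_def split: if_splits)
      next
        case False
        then have "q = x" using \<open>p = x \<or> q = x\<close> by simp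
        then show ?thesis using False x xuv uH vH e2(2)[of p] by (auto simp: \<delta>_def split: if_splits)
      qed
      also have "\<dots> \<longleftrightarrow> (p, Some q, i) \<in> {a, b, e, f}"
        by (auto simp: a_def b_def e_def f_def)
      finally have "(p, Some q, i) \<in> darts ?G \<longleftrightarrow> (p, Some q, i) \<in> {a, b, e, f}" .
      then show ?thesis using nh by blast
    next
      case False
      have "i < edge_ends G p q \<longleftrightarrow> i < edge_ends H p q \<and> (p, Some q, i) \<notin> {y, z}"
      proof (cases "{p, q} = {u, v}")
        case True
        then have "edge_ends G p q = c" "edge_ends H p q = c + \<delta> + 1"
          using cH cG by (auto simp: doubleton_eq_iff)
        then show ?thesis using True by (auto simp: y_def z_def \<delta>_def doubleton_eq_iff)
      next
        case n: False
        then have "(p, Some q, i) \<notin> {y, z}" by (auto simp: y_def z_def)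
        then show ?thesis using n e1[of p q] False by simp
      qed
      then show ?thesis using False by (auto simp: vG a_def b_def e_def f_def)
    qed
  qed
  have memG': "d \<in> darts ?G \<longleftrightarrow> d \<in> {a, b, e, f} \<or> (d \<in> darts (dg_of H) \<and> d \<notin> {y, z})" for d
    using memG by (cases d rule: dart_cases) (auto simp: a_def b_def e_def f_def y_def z_def)
  have dist: "a \<noteq> b" "e \<noteq> f" "y \<noteq> z" "{a, b} \<inter> {e, f} = {}"
    using xuv by (auto simp: a_def b_def e_def f_def y_def z_def \<delta>_def)
  have yzH: "y \<in> darts (dg_of H)" "z \<in> darts (dg_of H)" using uH vH cH by (auto simp: y_def z_def)
  have nH: "a \<notin> darts (dg_of H)" "b \<notin> darts (dg_of H)" "e \<notin> darts (dg_of H)" "f \<notin> darts (dg_of H)"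
    using x by (auto simp: a_def b_def e_def f_def)
  have mates: "mate ?G a = e" "mate ?G b = f" "mate ?G e = a" "mate ?G f = b"
    using xuv by (auto simp: a_def b_def e_def f_def)
  have matesH: "mate (dg_of H) y = z" "mate (dg_of H) z = y"
    using cH(3) by (auto simp: y_def z_def \<delta>_def flip_def)
  have atx: "darts_at ?G x = {a, b}"
    unfolding darts_at_def memG' using x xuv
    by (auto simp: a_def b_def e_def f_def) (use dg_of_simps in \<open>auto simp: dg_of_def\<close>)
  have cm: "can_merge ?G x a b"
    unfolding can_merge_def atx using dist mates by (auto simp: vG)
  let ?Y = "merge ?G x a b"
  have wfY: "wf_dart_graph ?Y" by (rule wf_merge[OF wf_dg_of[OF wfG] cm])
  have stY: "step ?G ?Y" by (rule step.merge[OF cm])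
  have nY: "nodes ?Y = verts H" using x by (simp add: vG)
  have dY: "darts ?Y = (darts (dg_of H) - {y, z}) \<union> {e, f}"
    using memG' dist nH by auto
  have common: "mate ?G d = mate (dg_of H) d \<and> mate ?G d \<in> darts (dg_of H) - {y, z}"
    if "d \<in> darts (dg_of H) - {y, z}" for d
  proof -
    have "mate ?G d = mate (dg_of H) d" by (cases d rule: dart_cases) auto
    moreover have "mate (dg_of H) d \<in> darts (dg_of H)" "mate (dg_of H) (mate (dg_of H) d) = d"
      using wfD(5,6)[OF wf_dg_of[OF wfH]] that by auto
    ultimately show ?thesis using matesH that by auto
  qed
  have mY: "mate ?Y e = f" "mate ?Y f = e"
    "\<And>d. d \<in> darts (dg_of H) - {y, z} \<Longrightarrow> mate ?Y d = mate (dg_of H) d"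
    using mates dist common nH by (auto simp: mate_merge) fastforce+
  have lY: "lab ?Y e = twist 1 * turn * twist 1" "lab ?Y f = twist 1 * turn * twist 1"
    "\<And>d. d \<in> darts (dg_of H) - {y, z} \<Longrightarrow> lab ?Y d = turn"
    using mates dist common nH turn_blowup ew(1) by (auto simp: lab_merge) fastforce+
  define \<psi> where "\<psi> d = (if d = e then y else if d = f then z else d)" for d
  define k where "k d = (if d \<in> {e, f} then 1 else 0 :: int)" for d
  have bij: "bij_betw \<psi> (darts ?Y) (darts (dg_of H))"
    unfolding bij_betw_def inj_on_def dY using nH yzH dist by (auto simp: \<psi>_def)
  have "sim_via ?Y (dg_of H) id \<psi> k"
    unfolding sim_via_def
  proof (intro conjI)
    show "bij_betw id (nodes ?Y) (nodes (dg_of H))" using nY by simp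
    show "bij_betw \<psi> (darts ?Y) (darts (dg_of H))" by (rule bij)
    show "\<forall>d\<in>darts ?Y. base (dg_of H) (\<psi> d) = id (base ?Y d) \<and> mate (dg_of H) (\<psi> d) = \<psi> (mate ?Y d) \<and>
        (mate ?Y d = d \<longrightarrow> (\<exists>m. lab (dg_of H) (\<psi> d) = twist (- k d) * lab ?Y d * twist m)) \<and>
        (mate ?Y d \<noteq> d \<longrightarrow> lab (dg_of H) (\<psi> d) = twist (- k d) * lab ?Y d * twist (- k (mate ?Y d)))"
    proof
      fix d assume "d \<in> darts ?Y"
      then consider "d = e" | "d = f" | "d \<in> darts (dg_of H) - {y, z}" unfolding dY by blast
      then show "base (dg_of H) (\<psi> d) = id (base ?Y d) \<and> mate (dg_of H) (\<psi> d) = \<psi> (mate ?Y d) \<and>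
        (mate ?Y d = d \<longrightarrow> (\<exists>m. lab (dg_of H) (\<psi> d) = twist (- k d) * lab ?Y d * twist m)) \<and>
        (mate ?Y d \<noteq> d \<longrightarrow> lab (dg_of H) (\<psi> d) = twist (- k d) * lab ?Y d * twist (- k (mate ?Y d)))"
      proof cases
        case 1
        have "lab (dg_of H) (\<psi> d) = twist (- k d) * lab ?Y d * twist (- k (mate ?Y d))"
          using 1 mY lY by (simp add: k_def mult.assoc twist_twist twist_twist_left)
        then show ?thesis using 1 mY dist matesH
          by (simp add: \<psi>_def) (simp add: e_def y_def)
      next
        case 2
        have "lab (dg_of H) (\<psi> d) = twist (- k d) * lab ?Y d * twist (- k (mate ?Y d))"
          using 2 mY lY by (simp add: k_def mult.assoc twist_twist twist_twist_left)
        then show ?thesis using 2 mY dist matesH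
          by (simp add: \<psi>_def) (simp add: f_def z_def)
      next
        case 3
        then have "d \<noteq> e" "d \<noteq> f" "mate (dg_of H) d \<noteq> e" "mate (dg_of H) d \<noteq> f"
          using nH common[OF 3] by auto
        then show ?thesis using 3 mY(3)[OF 3] lY(3)[OF 3]
          by (simp add: \<psi>_def k_def) (metis twist_0 mult.right_neutral)
      qed
    qed
    show "\<forall>w\<in>nodes ?Y. eff (dg_of H) (id w) = eff ?Y w + (\<Sum>d\<in>darts_at ?Y w. k d)"
    proof
      fix w assume w: "w \<in> nodes ?Y"
      then have "w \<noteq> x" using x by auto
      have "darts_at ?Y w \<inter> {e, f} = (if w = u then {e} else {}) \<union> (if w = v then {f} else {})"
        using dY by (auto simp: darts_at_def e_def f_def)
      then have "(\<Sum>d\<in>darts_at ?Y w. k d) = (if w = u then 1 else 0) + (if w = v then 1 else 0)"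
        unfolding k_def using sum_indicator_darts[of ?Y w "{e, f}", OF finite_darts_at[OF wfY]] dist by simp
      then show "eff (dg_of H) (id w) = eff ?Y w + (\<Sum>d\<in>darts_at ?Y w. k d)"
        using ew(2)[OF \<open>w \<noteq> x\<close>] by simp
    qed
  qed
  then show "\<exists>Y. step\<^sup>*\<^sup>* ?G Y \<and> sim Y (dg_of H)" using stY unfolding sim_def by blast
qed

lemma blowup_reduces:
  assumes "blowup H G"
  shows "wgraph H \<and> wgraph G \<and> (\<exists>Y. step\<^sup>*\<^sup>* (dg_of G) Y \<and> sim Y (dg_of H))"
  using assms
proof cases
  case (outer v x)
  then show ?thesis using outer_blowup_reduces[OF outer(2-4,1)] wf_outer[OF outer(2,3)] by auto
next
  case (inner u v x)
  then show ?thesis using inner_blowup_reduces[OF inner(2-4,1)] by blast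
qed

text \<open>After a blowup the reduction to the old graph is put in front of the old path to a
  normal form. A blowdown goes the other way along a reduction, and this is where confluence is
  needed.\<close>

lemma birational_step_reaches:
  fixes G H :: "'v wgraph"
  assumes Q: "normal_form_property Q" and st: "birational_step G H"
    and wf: "wgraph G" and conn: "connected_dart_graph (dg_of G)"
    and r: "normal_form_property.reaches Q (dg_of G)"
  shows "wgraph H \<and> connected_dart_graph (dg_of H) \<and> normal_form_property.reaches Q (dg_of H)"
proof -
  interpret normal_form_property Q by (rule Q)
  consider "blowup G H" | "blowup H G" | "G \<cong>\<^sub>w H" using st unfolding birational_step_def by blast
  then show ?thesis
  proof cases
    case 1
    then obtain Y where Y: "wgraph H" "step\<^sup>*\<^sup>* (dg_of H) Y" "sim Y (dg_of G)"
      using blowup_reduces by blast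
    have wfY: "wf_dart_graph Y" using wf_steps Y wf_dg_of by blast
    have "sim (dg_of G) Y" using sim_sym[OF wfY Y(3)] .
    then have "connected_dart_graph Y" "reaches Y"
      using sim_connected reaches_sim wf_dg_of[OF wf] conn r by blast+
    then show ?thesis using Y connected_steps_iff wf_dg_of reaches_backward by blast
  next
    case 2
    then obtain Y where Y: "wgraph H" "step\<^sup>*\<^sup>* (dg_of G) Y" "sim Y (dg_of H)"
      using blowup_reduces by blast
    have wfY: "wf_dart_graph Y" using wf_steps Y wf_dg_of wf by blast
    have "connected_dart_graph Y" "reaches Y"
      using connected_steps_iff reaches_steps Y(2) wf_dg_of[OF wf] conn r by blast+
    then show ?thesis using Y sim_connected reaches_sim wfY by blast
  next
    case 3
    then have "wgraph H" by (simp add: wgraph_iso_def)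
    then show ?thesis using sim_dg_of_iso[OF 3] sim_connected reaches_sim wf_dg_of[OF wf] conn r by blast
  qed
qed

theorem birational_steps_reaches:
  fixes G H :: "'v wgraph"
  assumes "birational_step\<^sup>*\<^sup>* G H" "normal_form_property Q"
    "wgraph G" "connected_dart_graph (dg_of G)" "normal_form_property.reaches Q (dg_of G)"
  shows "wgraph H \<and> connected_dart_graph (dg_of H) \<and> normal_form_property.reaches Q (dg_of H)"
  using assms
  by (induction rule: rtranclp_induct) (use birational_step_reaches in blast)+

section \<open>Paths and cycles\<close>

lemma path_edges_simps [simp]:
  "path_edges [] = {#}" "path_edges [v] = {#}"
  "path_edges (u # v # vs) = add_mset (Upair u v) (path_edges (v # vs))"
  by (simp_all add: path_edges_def)

lemma path_edges_append: "path_edges (xs @ v # ys) = path_edges (xs @ [v]) + path_edges (v # ys)"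
proof (induction xs)
  case (Cons x xs)
  then show ?case by (cases xs) auto
qed simp

lemma path_edges_snoc: "xs \<noteq> [] \<Longrightarrow> path_edges (xs @ [v]) = add_mset (Upair (last xs) v) (path_edges xs)"
proof (induction xs)
  case (Cons x xs)
  then show ?case by (cases xs) auto
qed simp

lemma path_edges_rev [simp]: "path_edges (rev vs) = path_edges vs"
proof (induction vs)
  case (Cons v vs)
  show ?case
  proof (cases vs)
    case (Cons w ws)
    then have "path_edges (rev vs @ [v]) = add_mset (Upair w v) (path_edges (rev vs))"
      by (subst path_edges_snoc) (auto simp: last_rev)
    moreover have "Upair w v = Upair v w" by simp
    ultimately show ?thesis using Cons Cons.IH by simp
  qed simp
qed simp

lemma set_path_edges: "e \<in># path_edges vs \<Longrightarrow> set_uprod e \<subseteq> set vs"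
proof (induction vs rule: induct_list012)
  case (3 x y zs)
  then show ?case by auto
qed auto

lemma size_path_edges: "size (path_edges vs) = length vs - 1"
  by (induction vs rule: induct_list012) auto

lemma path_edges_map: "image_mset (map_uprod f) (path_edges vs) = path_edges (map f vs)"
  by (induction vs rule: induct_list012) auto

lemma path_filter_notin:
  assumes "v \<notin> set ys"
  shows "filter_mset (\<lambda>e. v \<notin> set_uprod e) (path_edges (v # ys)) = path_edges ys"
    "filter_mset (\<lambda>e. v \<in> set_uprod e) (path_edges (v # ys)) = (if ys = [] then {#} else {#Upair v (hd ys)#})"
proof -
  have 1: "\<forall>e\<in>#path_edges ys. v \<notin> set_uprod e" using set_path_edges assms by blast
  then have 2: "filter_mset (\<lambda>e. v \<notin> set_uprod e) (path_edges ys) = path_edges ys"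
    "filter_mset (\<lambda>e. v \<in> set_uprod e) (path_edges ys) = {#}"
    by (auto simp: filter_mset_eq_conv intro!: multiset_eqI simp flip: not_in_iff)
  show "filter_mset (\<lambda>e. v \<notin> set_uprod e) (path_edges (v # ys)) = path_edges ys"
    "filter_mset (\<lambda>e. v \<in> set_uprod e) (path_edges (v # ys)) = (if ys = [] then {#} else {#Upair v (hd ys)#})"
    using 2 by (cases ys; simp)+
qed

text \<open>The first vertex of one path is met by at most one edge, so it is an end of the other
  path as well. Deleting it reduces to shorter paths.\<close>

lemma path_edges_unique:
  assumes "distinct vs" "distinct us" "set us = set vs" "path_edges us = path_edges vs"
  shows "us = vs \<or> us = rev vs"
  using assms
proof (induction vs arbitrary: us)
  case (Cons v vs)
  have main: "v # ys = v # vs \<or> v # ys = rev (v # vs)"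
    if "distinct (v # ys)" "set (v # ys) = set (v # vs)" "path_edges (v # ys) = path_edges (v # vs)" for ys
  proof -
    have nv: "v \<notin> set ys" "v \<notin> set vs" using that Cons.prems by auto
    then have s: "set ys = set vs" using that(2) by auto
    have pe: "path_edges ys = path_edges vs"
      using path_filter_notin(1)[OF nv(1)] path_filter_notin(1)[OF nv(2)] that(3) by simp
    have "distinct vs" "distinct ys" using that(1) Cons.prems(1) by simp_all
    then consider "ys = vs" | "ys = rev vs"
      using Cons.IH[OF _ _ s pe] by blast
    then show ?thesis
    proof cases
      case 2
      show ?thesis
      proof (cases vs)
        case (Cons w ws)
        have "(if ys = [] then {#} else {#Upair v (hd ys)#}) = (if vs = [] then {#} else {#Upair v (hd vs)#})"
          using path_filter_notin(2)[OF nv(1)] path_filter_notin(2)[OF nv(2)] that(3) by metis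
        moreover have "ys \<noteq> []" "vs \<noteq> []" using 2 Cons by simp_all
        ultimately have "Upair v (hd ys) = Upair v (hd vs)" by simp
        \<comment> \<open>The tail may come out reversed; but the neighbour of v is the same in both
          paths, which makes first and last vertex of the tail equal, so that the tail has one
          vertex.\<close>
        then have "hd (rev vs) = hd vs" using 2 by auto
        then have "last vs = hd vs" by (simp only: hd_rev)
        then have "last vs = w" using Cons by simp
        moreover have "distinct (w # ws)" using Cons.prems(1) Cons by simp
        ultimately have "ws = []" using Cons by (metis distinct.simps(2) last.simps last_in_set)
        then show ?thesis using 2 Cons by simp
      qed (use 2 in simp)
    qed simp
  qed
  have "v \<in> set us" using Cons.prems by simp
  then obtain xs ys where us: "us = xs @ v # ys" by (meson split_list)
  have nv: "v \<notin> set ys" "v \<notin> set xs" "v \<notin> set vs" using Cons.prems us by auto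
  have "path_edges us = path_edges (v # rev xs) + path_edges (v # ys)"
    using path_edges_append[of xs v ys] us path_edges_rev[of "v # rev xs"] by simp
  then have "filter_mset (\<lambda>e. v \<in> set_uprod e) (path_edges (v # vs)) =
      filter_mset (\<lambda>e. v \<in> set_uprod e) (path_edges (v # rev xs)) +
      filter_mset (\<lambda>e. v \<in> set_uprod e) (path_edges (v # ys))"
    using Cons.prems(4) by simp
  moreover have nr: "v \<notin> set (rev xs)" using nv(2) by simp
  ultimately have "size (if vs = [] then {#} else {#Upair v (hd vs)#}) =
      size ((if rev xs = [] then {#} else {#Upair v (hd (rev xs))#}) + (if ys = [] then {#} else {#Upair v (hd ys)#}))"
    by (simp only: path_filter_notin(2)[OF nv(1)] path_filter_notin(2)[OF nv(3)] path_filter_notin(2)[OF nr])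
  then have "xs = [] \<or> ys = []" by (simp split: if_splits)
  then show ?case
  proof
    assume "xs = []"
    then show ?thesis using main[of ys] us Cons.prems by simp
  next
    assume "ys = []"
    then have "rev us = v # rev xs" using us by simp
    then have "rev us = v # vs \<or> rev us = rev (v # vs)"
      using main[of "rev xs"] Cons.prems by (metis distinct_rev path_edges_rev set_rev)
    then show ?thesis by (metis rev_rev_ident)
  qed
qed simp

lemma loop_path_edges: "Upair v v \<in># path_edges l \<Longrightarrow> 2 \<le> count_list l v"
proof (induction l rule: induct_list012)
  case (3 x y zs)
  then show ?case by (cases "Upair v v = Upair x y") auto
qed auto

lemma count_list_distinct: "distinct l \<Longrightarrow> count_list l v \<le> 1"
  by (induction l) (auto simp: count_list_0_iff)

lemma cycle_edges_Cons: "cycle_edges (v # p) = path_edges (v # p @ [v])"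
proof -
  have "map2 Upair xs zs = map2 Upair (xs @ [y]) zs" if "length xs = length zs" for xs zs and y :: 'a
    using that by (simp add: zip_append1)
  from this[of "v # p" "p @ [v]" v] show ?thesis
    unfolding cycle_edges_def path_edges_def by simp
qed

lemma cycle_edges_rotate1: "cycle_edges (rotate1 us) = cycle_edges us"
proof (cases us)
  case (Cons v p)
  show ?thesis
  proof (cases p)
    case (Cons w r)
    have "cycle_edges (rotate1 us) = path_edges ((w # r) @ v # [w])"
      using \<open>us = v # p\<close> Cons cycle_edges_Cons[of w "r @ [v]"] by simp
    also have "\<dots> = path_edges ((w # r) @ [v]) + path_edges [v, w]" by (rule path_edges_append)
    also have "\<dots> = cycle_edges us"
      using \<open>us = v # p\<close> Cons cycle_edges_Cons[of v p] by simp
    finally show ?thesis .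
  qed (use Cons in simp)
qed simp

lemma cycle_edges_rotate: "cycle_edges (rotate i us) = cycle_edges us"
  by (induction i) (simp_all add: cycle_edges_rotate1)

lemma size_cycle_edges: "size (cycle_edges us) = length us"
  by (simp add: cycle_edges_def)

lemma cycle_edges_map: "image_mset (map_uprod f) (cycle_edges us) = cycle_edges (map f us)"
proof (cases us)
  case (Cons v p)
  then show ?thesis using path_edges_map[of f "v # p @ [v]"] by (simp add: cycle_edges_Cons)
qed (simp add: cycle_edges_def)

text \<open>Deleting the common vertex v leaves two paths with the same edges.\<close>

lemma cycle_edges_unique:
  assumes "v \<notin> set p" "v \<notin> set q" "distinct p" "distinct q" "set p = set q"
    and "cycle_edges (v # p) = cycle_edges (v # q)"
  shows "q = p \<or> q = rev p"
proof -
  have *: "filter_mset (\<lambda>e. v \<notin> set_uprod e) (cycle_edges (v # r)) = path_edges r"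
    if "v \<notin> set r" for r
  proof (cases "r = []")
    case False
    have "path_edges (v # r @ [v]) = add_mset (Upair (last r) v) (path_edges (v # r))"
      using path_edges_snoc[of "v # r" v] False by simp
    then show ?thesis using path_filter_notin(1)[OF that] by (simp add: cycle_edges_Cons)
  qed (simp add: cycle_edges_Cons)
  have "path_edges q = path_edges p" using *[OF assms(1)] *[OF assms(2)] assms(6) by metis
  then show ?thesis using path_edges_unique assms by metis
qed

lemma cycle_degree:
  assumes "distinct us" "v \<in> set us"
  shows "size {#e \<in># cycle_edges us. v \<in> set_uprod e#} + count (cycle_edges us) (Upair v v) = 2"
proof -
  obtain xs ys where us: "us = xs @ v # ys" using assms(2) by (meson split_list)
  define q where "q = ys @ xs"
  have "rotate (length xs) us = v # q" unfolding us q_def by (simp add: rotate_append)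
  then have e: "cycle_edges us = cycle_edges (v # q)" using cycle_edges_rotate by metis
  have nv: "v \<notin> set q" using assms us by (auto simp: q_def)
  show ?thesis
  proof (cases "q = []")
    case True
    then show ?thesis unfolding e cycle_edges_Cons by simp
  next
    case False
    have "cycle_edges (v # q) = add_mset (Upair (last q) v) (path_edges (v # q))"
      using path_edges_snoc[of "v # q" v] False by (simp add: cycle_edges_Cons)
    moreover have "count (path_edges (v # q)) (Upair v v) = 0"
      using loop_path_edges[of v "v # q"] nv by (auto simp: count_eq_zero_iff count_list_0_iff)
    moreover have "last q \<noteq> v" using nv False by auto
    ultimately show ?thesis
      unfolding e using path_filter_notin(2)[OF nv] False by simp
  qed
qed

section \<open>Decomposition of a weighted graph along its segments\<close>

text \<open>A leg has a single dart, so its path is counted twice here to match an edge, which is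
  counted once from each of its two darts.\<close>

definition strand :: "('v, 'd) dart_graph \<Rightarrow> ('d \<Rightarrow> 'v list) \<Rightarrow> 'd \<Rightarrow> 'v uprod multiset" where
  "strand X p d = (if mate X d = d then path_edges (base X d # p d) + path_edges (base X d # p d)
     else path_edges (base X d # p d @ [base X (mate X d)]))"

text \<open>The list \<open>p d\<close> consists of the vertices of \<open>G\<close> passed when leaving along the dart \<open>d\<close>.
  As every edge is seen from both its darts, the strands cover the edges of \<open>G\<close> twice.\<close>

definition decomp :: "'v wgraph \<Rightarrow> ('v, 'd) dart_graph \<Rightarrow> ('d \<Rightarrow> 'v list) \<Rightarrow> bool" where
  "decomp G X p \<longleftrightarrow> wf_dart_graph X \<and>
     verts G = nodes X \<union> (\<Union>d\<in>darts X. set (p d)) \<and>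
     (\<forall>d\<in>darts X. distinct (p d) \<and> set (p d) \<inter> nodes X = {} \<and>
        lab X d = chain_value (map (eff_weight G) (p d)) \<and>
        (mate X d \<noteq> d \<longrightarrow> p (mate X d) = rev (p d)) \<and>
        (mate X d = d \<and> p d = [] \<longrightarrow> total_ends G (base X d) \<le> 1) \<and>
        (\<forall>v\<in>set (p d). total_ends G v \<le> 2)) \<and>
     (\<forall>d\<in>darts X. \<forall>d'\<in>darts X. d' \<noteq> d \<and> d' \<noteq> mate X d \<longrightarrow> set (p d) \<inter> set (p d') = {}) \<and>
     (\<forall>v\<in>nodes X. eff X v = eff_weight G v \<and> card (darts_at X v) = max 2 (total_ends G v)) \<and>
     (\<Sum>d\<in>darts X. strand X p d) = edges G + edges G"

lemma decompD:
  assumes "decomp G X p"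
  shows "wf_dart_graph X" "verts G = nodes X \<union> (\<Union>d\<in>darts X. set (p d))"
    "d \<in> darts X \<Longrightarrow> distinct (p d)" "d \<in> darts X \<Longrightarrow> set (p d) \<inter> nodes X = {}"
    "d \<in> darts X \<Longrightarrow> lab X d = chain_value (map (eff_weight G) (p d))"
    "d \<in> darts X \<Longrightarrow> mate X d \<noteq> d \<Longrightarrow> p (mate X d) = rev (p d)"
    "d \<in> darts X \<Longrightarrow> mate X d = d \<Longrightarrow> p d = [] \<Longrightarrow> total_ends G (base X d) \<le> 1"
    "d \<in> darts X \<Longrightarrow> v \<in> set (p d) \<Longrightarrow> total_ends G v \<le> 2"
    "d \<in> darts X \<Longrightarrow> d' \<in> darts X \<Longrightarrow> d' \<noteq> d \<Longrightarrow> d' \<noteq> mate X d \<Longrightarrow> set (p d) \<inter> set (p d') = {}"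
    "v \<in> nodes X \<Longrightarrow> eff X v = eff_weight G v"
    "v \<in> nodes X \<Longrightarrow> card (darts_at X v) = max 2 (total_ends G v)"
    "(\<Sum>d\<in>darts X. strand X p d) = edges G + edges G"
proof -
  show "wf_dart_graph X" "verts G = nodes X \<union> (\<Union>d\<in>darts X. set (p d))"
    "(\<Sum>d\<in>darts X. strand X p d) = edges G + edges G"
    using assms by (simp_all only: decomp_def)
  have 1: "\<forall>d\<in>darts X. distinct (p d) \<and> set (p d) \<inter> nodes X = {} \<and>
        lab X d = chain_value (map (eff_weight G) (p d)) \<and>
        (mate X d \<noteq> d \<longrightarrow> p (mate X d) = rev (p d)) \<and>
        (mate X d = d \<and> p d = [] \<longrightarrow> total_ends G (base X d) \<le> 1) \<and>
        (\<forall>v\<in>set (p d). total_ends G v \<le> 2)"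
    using assms unfolding decomp_def by (elim conjE)
  show "d \<in> darts X \<Longrightarrow> distinct (p d)" "d \<in> darts X \<Longrightarrow> set (p d) \<inter> nodes X = {}"
    "d \<in> darts X \<Longrightarrow> lab X d = chain_value (map (eff_weight G) (p d))"
    "d \<in> darts X \<Longrightarrow> mate X d \<noteq> d \<Longrightarrow> p (mate X d) = rev (p d)"
    "d \<in> darts X \<Longrightarrow> mate X d = d \<Longrightarrow> p d = [] \<Longrightarrow> total_ends G (base X d) \<le> 1"
    "d \<in> darts X \<Longrightarrow> v \<in> set (p d) \<Longrightarrow> total_ends G v \<le> 2"
    using 1 by blast+
  have 2: "\<forall>d\<in>darts X. \<forall>d'\<in>darts X. d' \<noteq> d \<and> d' \<noteq> mate X d \<longrightarrow> set (p d) \<inter> set (p d') = {}"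
    using assms unfolding decomp_def by (elim conjE)
  then show "d \<in> darts X \<Longrightarrow> d' \<in> darts X \<Longrightarrow> d' \<noteq> d \<Longrightarrow> d' \<noteq> mate X d \<Longrightarrow> set (p d) \<inter> set (p d') = {}"
    by blast
  have 3: "\<forall>v\<in>nodes X. eff X v = eff_weight G v \<and> card (darts_at X v) = max 2 (total_ends G v)"
    using assms unfolding decomp_def by (elim conjE)
  show "v \<in> nodes X \<Longrightarrow> eff X v = eff_weight G v"
    "v \<in> nodes X \<Longrightarrow> card (darts_at X v) = max 2 (total_ends G v)"
    using 3 by blast+
qed

lemma decomp_dg_of:
  assumes wf: "wgraph G" shows "decomp G (dg_of G) (\<lambda>_. [])"
proof -
  let ?X = "dg_of G"
  have fin: "finite (darts ?X)" by (rule finite_darts_dg_of[OF wf])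
  have "count (\<Sum>d\<in>darts ?X. strand ?X (\<lambda>_. []) d) e = count (edges G + edges G) e" for e
  proof -
    obtain a b where e: "e = Upair a b" using uprod_exhaust by blast
    let ?A = "(\<lambda>i. (a, Some b, i)) ` {..<edge_ends G a b} \<union> (\<lambda>i. (b, Some a, i)) ` {..<edge_ends G b a}"
    let ?P = "\<lambda>d. mate ?X d \<noteq> d \<and> Upair (base ?X d) (base ?X (mate ?X d)) = e"
    have "count (\<Sum>d\<in>darts ?X. strand ?X (\<lambda>_. []) d) e = (\<Sum>d\<in>darts ?X. count (strand ?X (\<lambda>_. []) d) e)"
      by (simp add: count_sum)
    also have "\<dots> = (\<Sum>d\<in>darts ?X. if ?P d then 1 else 0)"
      by (rule sum.cong) (auto simp: strand_def)
    also have "\<dots> = card {d \<in> darts ?X. ?P d}"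
      using fin by (simp add: sum.If_cases Int_def)
    also have "{d \<in> darts ?X. ?P d} = ?A"
    proof (rule set_eqI)
      fix d
      have *: "a \<in> verts G \<and> b \<in> verts G" if "0 < edge_ends G a b"
        using that wgraph_edge[OF wf, of a b] by (auto simp: edge_ends_def split: if_splits)
      have **: "edge_ends G b a = edge_ends G a b" by (rule edge_ends_sym)
      show "d \<in> {d \<in> darts ?X. ?P d} \<longleftrightarrow> d \<in> ?A"
      proof (cases d rule: dart_cases)
        case (2 u v i)
        then have "d \<in> {d \<in> darts ?X. ?P d} \<longleftrightarrow> d \<in> darts ?X \<and> (u = a \<and> v = b \<or> u = b \<and> v = a)"
          by (auto simp: e)
        also have "\<dots> \<longleftrightarrow> (u = a \<and> v = b \<or> u = b \<and> v = a) \<and> i < edge_ends G a b"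
          using 2 * ** by auto
        also have "\<dots> \<longleftrightarrow> d \<in> ?A" using 2 ** by auto
        finally show ?thesis .
      qed auto
    qed
    also have "card ?A = 2 * count (edges G) e"
    \<comment> \<open>For a loop the two images coincide, but \<open>edge_ends\<close> already
      counts both of its ends.\<close>
    proof (cases "a = b")
      case True
      then have "card ?A = card ((\<lambda>i. (a, Some a, i)) ` {..<edge_ends G a a})" by simp
      also have "\<dots> = edge_ends G a a" by (subst card_image) (auto simp: inj_on_def)
      finally show ?thesis using True by (simp add: e edge_ends_def)
    next
      case False
      have "card ?A = card ((\<lambda>i. (a, Some b, i)) ` {..<edge_ends G a b}) + card ((\<lambda>i. (b, Some a, i)) ` {..<edge_ends G b a})"
        using False by (intro card_Un_disjoint) auto
      also have "\<dots> = edge_ends G a b + edge_ends G b a"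
        by (subst (1 2) card_image) (auto simp: inj_on_def)
      finally show ?thesis using False edge_ends_sym[of G b a] by (simp add: e edge_ends_def)
    qed
    finally show ?thesis by simp
  qed
  then have "(\<Sum>d\<in>darts ?X. strand ?X (\<lambda>_. []) d) = edges G + edges G" by (rule multiset_eqI)
  moreover have "total_ends G (base ?X d) \<le> 1" if d: "d \<in> darts ?X" "mate ?X d = d" for d
  proof (cases d rule: dart_cases)
    case (1 u i)
    then have "i < 2 - total_ends G u" using d by simp
    then show ?thesis using 1 by simp
  next
    case (2 u v i)
    then show ?thesis using d by (cases "u = v") simp_all
  qed
  ultimately show ?thesis
    unfolding decomp_def using wf_dg_of[OF wf] card_darts_at_dg_of[OF wf] by auto
qed

text \<open>The path of a surviving dart is continued over v along the path on the other side. At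
  most one of the two darts at v is a leg, and by symmetry it may be taken to be a.\<close>

lemma decomp_merge:
  assumes dc: "decomp G X p" and cm: "can_merge X v a b" and bl: "mate X b \<noteq> b"
  shows "decomp G (merge X v a b)
    (\<lambda>d. if mate X d = a then p d @ [v] @ p b else if mate X d = b then p d @ [v] @ p a else p d)"
    (is "decomp G ?Y ?p")
proof -
  note m = can_mergeD[OF cm] and D = decompD[OF dc]
  note wf = D(1)
  have wfY: "wf_dart_graph ?Y" by (rule wf_merge[OF wf cm])
  have inv: "mate X d = e \<longleftrightarrow> d = mate X e" if "d \<in> darts X" "e \<in> darts X" for d e
    using wfD(6)[OF wf] that by metis
  define f where "f = mate X b"
  have fX: "f \<in> darts X" "mate X f = b" using wfD(5,6)[OF wf m(7)] by (auto simp: f_def)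
  have fab: "f \<noteq> a" "f \<noteq> b" using bl inv m by (auto simp: f_def)
  have pf: "p f = rev (p b)" using D(6)[OF m(7) bl] by (simp add: f_def)
  have fin: "finite (darts X)" using wfD(2)[OF wf] .
  have nv: "v \<notin> set (p d)" if "d \<in> darts X" for d using D(4)[OF that] m(1) by blast
  have tv: "total_ends G v \<le> 2" using D(11)[OF m(1)] m(2,3) by simp
  define e where "e = mate X a"
  show ?thesis
  proof (cases "e = a")
    case True
    then have la: "mate X a = a" by (simp add: e_def)
    have ch: "mate X d = a \<longleftrightarrow> False" "mate X d = b \<longleftrightarrow> d = f" if "d \<in> darts ?Y" for d
      using that inv[of d a] inv[of d b] m la by (auto simp: f_def)
    have p': "?p d = (if d = f then p f @ [v] @ p a else p d)" if "d \<in> darts ?Y" for d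
      using ch[OF that] by auto
    have m': "mate ?Y d = (if d = f then f else mate X d)" if "d \<in> darts ?Y" for d
      using ch[OF that] la by (auto simp: mate_merge)
    have l': "lab ?Y d = (if d = f then lab X f * twist (eff X v) * lab X a else lab X d)" if "d \<in> darts ?Y" for d
      using ch[OF that] by (auto simp: lab_merge)
    have fY: "f \<in> darts ?Y" using fX fab by simp
    have df: "set (p f) \<inter> set (p a) = {}"
      using D(9)[OF m(6) fX(1)] fab la by auto
    have dd: "set (p d) \<inter> set (p f) = {} \<and> set (p d) \<inter> set (p a) = {}" if "d \<in> darts ?Y" "d \<noteq> f" for d
      using D(9)[OF fX(1), of d] D(9)[OF m(6), of d] that fX(2) la by auto
    have strands: "(\<Sum>d\<in>darts ?Y. strand ?Y ?p d) = (\<Sum>d\<in>darts X. strand X p d)"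
    proof -
      have "(\<Sum>d\<in>darts ?Y. strand ?Y ?p d) = strand ?Y ?p f + (\<Sum>d\<in>darts ?Y - {f}. strand ?Y ?p d)"
        using fY fin by (simp add: sum.remove)
      also have "(\<Sum>d\<in>darts ?Y - {f}. strand ?Y ?p d) = (\<Sum>d\<in>darts ?Y - {f}. strand X p d)"
        by (rule sum.cong) (use p' m' in \<open>auto simp: strand_def\<close>)
      \<comment> \<open>The darts f and b traverse the same edges in opposite directions and the leg
        a counts twice; together this is the new leg counted twice.\<close>
      also have "strand ?Y ?p f = strand X p f + strand X p a + strand X p b"
      proof -
        have "strand X p b = path_edges (rev (base X f # p f @ [v]))"
          using bl pf m(9) by (simp add: strand_def f_def)
        then have "strand X p b = path_edges (base X f # p f @ [v])" by (simp only: path_edges_rev)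
        moreover have "strand X p f = path_edges (base X f # p f @ [v])"
          using fX fab m(9) by (simp add: strand_def)
        moreover have "strand X p a = path_edges (v # p a) + path_edges (v # p a)"
          using la m(8) by (simp add: strand_def)
        moreover have "strand ?Y ?p f = path_edges (base X f # p f @ v # p a) + path_edges (base X f # p f @ v # p a)"
          using p'[OF fY] m'[OF fY] by (simp add: strand_def)
        moreover have "path_edges ((base X f # p f) @ v # p a) = path_edges ((base X f # p f) @ [v]) + path_edges (v # p a)"
          by (rule path_edges_append)
        ultimately show ?thesis by simp
      qed
      also have "strand X p f + strand X p a + strand X p b + (\<Sum>d\<in>darts ?Y - {f}. strand X p d) =
         (\<Sum>d\<in>darts X. strand X p d)"
      proof -
        have "darts X = insert f (insert a (insert b (darts ?Y - {f})))" using fX m(6,7) by auto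
        moreover have "f \<notin> insert a (insert b (darts ?Y - {f}))" "a \<notin> insert b (darts ?Y - {f})"
            "b \<notin> darts ?Y - {f}" "finite (darts ?Y - {f})"
          using fab m(3) fin by auto
        ultimately show ?thesis by (simp add: add_ac del: merge_simps)
      qed
      finally show ?thesis .
    qed
    show ?thesis
      unfolding decomp_def
    proof (intro conjI ballI impI)
      show "wf_dart_graph ?Y" by (rule wfY)
      show "(\<Sum>d\<in>darts ?Y. strand ?Y ?p d) = edges G + edges G" using strands D(12) by simp
      have "(\<Union>d\<in>darts X. set (p d)) \<union> {v} = (\<Union>d\<in>darts ?Y. set (?p d)) \<union> {v}"
      proof (intro equalityI subsetI)
        fix u assume "u \<in> (\<Union>d\<in>darts X. set (p d)) \<union> {v}"
        then consider "u = v" | d where "d \<in> darts X" "u \<in> set (p d)" by blast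
        then show "u \<in> (\<Union>d\<in>darts ?Y. set (?p d)) \<union> {v}"
        proof cases
          case (2 d)
          then consider "d = a" | "d = b" | "d \<in> darts ?Y" by auto
          then have "u \<in> set (?p f) \<or> d \<in> darts ?Y \<and> u \<in> set (?p d)"
            using 2 p'[OF fY] p' pf by cases auto
          then show ?thesis using fY by blast
        qed simp
      next
        fix u assume "u \<in> (\<Union>d\<in>darts ?Y. set (?p d)) \<union> {v}"
        then consider "u = v" | d where "d \<in> darts ?Y" "u \<in> set (?p d)" by blast
        then show "u \<in> (\<Union>d\<in>darts X. set (p d)) \<union> {v}"
        proof cases
          case (2 d)
          then show ?thesis using p'[OF 2(1)] m(6) fX by (auto split: if_splits)
        qed simp
      qed
      moreover have "v \<in> set (?p f)" using p'[OF fY] by simp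
      ultimately show "verts G = nodes ?Y \<union> (\<Union>d\<in>darts ?Y. set (?p d))"
        using D(2) m(1) fY by (auto simp del: merge_simps(2))
    next
      fix d assume d: "d \<in> darts ?Y"
      then have dX: "d \<in> darts X" by simp
      show "distinct (?p d)"
        using p'[OF d] D(3)[OF dX] D(3)[OF fX(1)] D(3)[OF m(6)] nv[OF fX(1)] nv[OF m(6)] df by auto
      show "set (?p d) \<inter> nodes ?Y = {}"
        using p'[OF d] D(4)[OF dX] D(4)[OF fX(1)] D(4)[OF m(6)] by auto
      show "lab ?Y d = chain_value (map (eff_weight G) (?p d))"
        using p'[OF d] l'[OF d] D(5)[OF dX] D(5)[OF fX(1)] D(5)[OF m(6)] D(10)[OF m(1)]
        by (simp add: chain_value_append)
      show "?p (mate ?Y d) = rev (?p d)" if "mate ?Y d \<noteq> d"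
      proof -
        have "d \<noteq> f" "mate X d \<noteq> d" using that m'[OF d] by (auto split: if_splits)
        moreover have "mate ?Y d \<in> darts ?Y" using wfD(5)[OF wfY d] .
        moreover have "mate X d \<noteq> f" using inv[OF dX fX(1)] fX(2) d by auto
        ultimately show ?thesis using p'[OF d] p'[of "mate ?Y d"] m'[OF d] D(6)[OF dX] by auto
      qed
      show "total_ends G (base ?Y d) \<le> 1" if "mate ?Y d = d \<and> ?p d = []"
        using that p'[OF d] m'[OF d] D(7)[OF dX] by (auto split: if_splits)
      show "total_ends G u \<le> 2" if "u \<in> set (?p d)" for u
        using that p'[OF d] D(8)[OF dX] D(8)[OF fX(1)] D(8)[OF m(6)] tv by (auto split: if_splits)
    next
      fix d d' assume d: "d \<in> darts ?Y" "d' \<in> darts ?Y" "d' \<noteq> d \<and> d' \<noteq> mate ?Y d"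
      show "set (?p d) \<inter> set (?p d') = {}"
        using p'[OF d(1)] p'[OF d(2)] m'[OF d(1)] d dd[OF d(1)] dd[OF d(2)] nv[of d] nv[of d'] D(9)[of d d']
        by (auto split: if_splits)
    next
      fix u assume "u \<in> nodes ?Y"
      then show "eff ?Y u = eff_weight G u" "card (darts_at ?Y u) = max 2 (total_ends G u)"
        using D(10,11)[of u] darts_at_merge[OF cm, of u] by auto
    qed
  next
    case False
    then have la: "mate X a \<noteq> a" by (simp add: e_def)
    have eX: "e \<in> darts X" "mate X e = a" using wfD(5,6)[OF wf m(6)] by (auto simp: e_def)
    have eab: "e \<noteq> a" "e \<noteq> b" "e \<noteq> f" using la inv m eX fX by (auto simp: e_def)
    have pe: "p e = rev (p a)" using D(6)[OF m(6) la] by (simp add: e_def)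
    have ch: "mate X d = a \<longleftrightarrow> d = e" "mate X d = b \<longleftrightarrow> d = f" if "d \<in> darts ?Y" for d
      using that inv[of d a] inv[of d b] m by (auto simp: f_def e_def)
    have p': "?p d = (if d = e then p e @ [v] @ p b else if d = f then p f @ [v] @ p a else p d)"
      if "d \<in> darts ?Y" for d
      using ch[OF that] eab by auto
    have m': "mate ?Y d = (if d = e then f else if d = f then e else mate X d)" if "d \<in> darts ?Y" for d
      using ch[OF that] la bl eab by (auto simp: mate_merge f_def e_def)
    have l': "lab ?Y d = (if d = e then lab X e * twist (eff X v) * lab X b
        else if d = f then lab X f * twist (eff X v) * lab X a else lab X d)" if "d \<in> darts ?Y" for d
      using ch[OF that] eab by (auto simp: lab_merge)
    have fY: "f \<in> darts ?Y" and eY: "e \<in> darts ?Y" using fX fab eX eab by simp_all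
    have dab: "set (p a) \<inter> set (p b) = {}"
      using D(9)[OF m(6,7)] m(3,4) by auto
    have dd: "set (p d) \<inter> set (p b) = {} \<and> set (p d) \<inter> set (p a) = {}"
      if "d \<in> darts ?Y" "d \<noteq> f" "d \<noteq> e" for d
      using D(9)[OF m(7), of d] D(9)[OF m(6), of d] that by (auto simp: e_def f_def)
    have strands: "(\<Sum>d\<in>darts ?Y. strand ?Y ?p d) = (\<Sum>d\<in>darts X. strand X p d)"
    proof -
      have "darts ?Y = insert e (insert f (darts ?Y - {e, f}))" using eY fY by auto
      moreover have "e \<notin> insert f (darts ?Y - {e, f})" "f \<notin> darts ?Y - {e, f}" "finite (darts ?Y - {e, f})"
        using eab fin by auto
      ultimately have "(\<Sum>d\<in>darts ?Y. strand ?Y ?p d) =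
          strand ?Y ?p e + (strand ?Y ?p f + (\<Sum>d\<in>darts ?Y - {e, f}. strand ?Y ?p d))"
        by (metis (no_types, lifting) finite_insert sum.insert)
      also have "(\<Sum>d\<in>darts ?Y - {e, f}. strand ?Y ?p d) = (\<Sum>d\<in>darts ?Y - {e, f}. strand X p d)"
        by (rule sum.cong) (use p' m' in \<open>auto simp: strand_def\<close>)
      also have "strand ?Y ?p e = strand X p e + strand X p b"
      proof -
        have "strand ?Y ?p e = path_edges ((base X e # p e) @ v # (p b @ [base X f]))"
          using p'[OF eY] m'[OF eY] eab by (simp add: strand_def)
        also have "\<dots> = path_edges ((base X e # p e) @ [v]) + path_edges (v # (p b @ [base X f]))"
          by (rule path_edges_append)
        also have "\<dots> = strand X p e + strand X p b"
          using eX eab bl m(8,9) by (simp add: strand_def f_def)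
        finally show ?thesis .
      qed
      also have "strand ?Y ?p f = strand X p f + strand X p a"
      proof -
        have "strand ?Y ?p f = path_edges ((base X f # p f) @ v # (p a @ [base X e]))"
          using p'[OF fY] m'[OF fY] eab by (simp add: strand_def)
        also have "\<dots> = path_edges ((base X f # p f) @ [v]) + path_edges (v # (p a @ [base X e]))"
          by (rule path_edges_append)
        also have "\<dots> = strand X p f + strand X p a"
          using fX fab la m(8,9) by (simp add: strand_def e_def)
        finally show ?thesis .
      qed
      also have "strand X p e + strand X p b + (strand X p f + strand X p a + (\<Sum>d\<in>darts ?Y - {e, f}. strand X p d)) =
         (\<Sum>d\<in>darts X. strand X p d)"
      proof -
        have "darts X = insert e (insert f (insert a (insert b (darts ?Y - {e, f}))))" using fX eX m(6,7) by auto
        moreover have "e \<notin> insert f (insert a (insert b (darts ?Y - {e, f})))"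
            "f \<notin> insert a (insert b (darts ?Y - {e, f}))" "a \<notin> insert b (darts ?Y - {e, f})"
            "b \<notin> darts ?Y - {e, f}" "finite (darts ?Y - {e, f})"
          using fab eab m(3) fin by auto
        ultimately show ?thesis by (simp add: add_ac del: merge_simps)
      qed
      finally show ?thesis .
    qed
    show ?thesis
      unfolding decomp_def
    proof (intro conjI ballI impI)
      show "wf_dart_graph ?Y" by (rule wfY)
      show "(\<Sum>d\<in>darts ?Y. strand ?Y ?p d) = edges G + edges G" using strands D(12) by simp
      have "(\<Union>d\<in>darts X. set (p d)) \<union> {v} = (\<Union>d\<in>darts ?Y. set (?p d)) \<union> {v}"
      proof (intro equalityI subsetI)
        fix u assume "u \<in> (\<Union>d\<in>darts X. set (p d)) \<union> {v}"
        then consider "u = v" | d where "d \<in> darts X" "u \<in> set (p d)" by blast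
        then show "u \<in> (\<Union>d\<in>darts ?Y. set (?p d)) \<union> {v}"
        proof cases
          case (2 d)
          then consider "d = a" | "d = b" | "d = e" | "d = f" | "d \<in> darts ?Y" "d \<noteq> e" "d \<noteq> f" by auto
          then have "u \<in> set (?p f) \<or> d \<in> darts ?Y \<and> u \<in> set (?p d)"
            using 2 p'[OF fY] p' pf pe eY by cases auto
          then show ?thesis using fY by blast
        qed simp
      next
        fix u assume "u \<in> (\<Union>d\<in>darts ?Y. set (?p d)) \<union> {v}"
        then consider "u = v" | d where "d \<in> darts ?Y" "u \<in> set (?p d)" by blast
        then show "u \<in> (\<Union>d\<in>darts X. set (p d)) \<union> {v}"
        proof cases
          case (2 d)
          then show ?thesis using p'[OF 2(1)] m(6,7) fX eX by (auto split: if_splits)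
        qed simp
      qed
      moreover have "v \<in> set (?p f)" using p'[OF fY] eab by simp
      ultimately show "verts G = nodes ?Y \<union> (\<Union>d\<in>darts ?Y. set (?p d))"
        using D(2) m(1) fY by (auto simp del: merge_simps(2))
    next
      fix d assume d: "d \<in> darts ?Y"
      then have dX: "d \<in> darts X" by simp
      show "distinct (?p d)"
        using p'[OF d] D(3)[OF dX] D(3)[OF m(7)] D(3)[OF m(6)] nv[OF m(7)] nv[OF m(6)] dab pe pf by auto
      show "set (?p d) \<inter> nodes ?Y = {}"
        using p'[OF d] D(4)[OF dX] D(4)[OF m(7)] D(4)[OF m(6)] by auto
      show "lab ?Y d = chain_value (map (eff_weight G) (?p d))"
        using p'[OF d] l'[OF d] D(5)[OF dX] D(5)[OF fX(1)] D(5)[OF eX(1)] D(5)[OF m(6)] D(5)[OF m(7)] D(10)[OF m(1)]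
        by (simp add: chain_value_append)
      show "?p (mate ?Y d) = rev (?p d)" if "mate ?Y d \<noteq> d"
      proof (cases "d = e \<or> d = f")
        case True
        then show ?thesis using p'[OF eY] p'[OF fY] m'[OF eY] m'[OF fY] pe pf eab by auto
      next
        case False
        have "mate X d \<noteq> d" using that m'[OF d] False by (auto split: if_splits)
        moreover have "mate ?Y d \<in> darts ?Y" using wfD(5)[OF wfY d] .
        moreover have "mate X d \<noteq> f" "mate X d \<noteq> e"
          using inv[OF dX fX(1)] inv[OF dX eX(1)] fX(2) eX(2) d by auto
        ultimately show ?thesis using False p'[OF d] p'[of "mate ?Y d"] m'[OF d] D(6)[OF dX] by auto
      qed
      show "total_ends G (base ?Y d) \<le> 1" if "mate ?Y d = d \<and> ?p d = []"
        using that p'[OF d] m'[OF d] D(7)[OF dX] by (auto split: if_splits)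
      show "total_ends G u \<le> 2" if "u \<in> set (?p d)" for u
        using that p'[OF d] D(8)[OF dX] D(8)[OF m(7)] D(8)[OF m(6)] D(8)[OF eX(1)] D(8)[OF fX(1)] tv
        by (auto split: if_splits)
    next
      fix d d' assume d: "d \<in> darts ?Y" "d' \<in> darts ?Y" "d' \<noteq> d \<and> d' \<noteq> mate ?Y d"
      show "set (?p d) \<inter> set (?p d') = {}"
        using p'[OF d(1)] p'[OF d(2)] m'[OF d(1)] d dd[OF d(1)] dd[OF d(2)] nv[of d] nv[of d'] D(9)[of d d'] pe pf
        by (auto split: if_splits)
    next
      fix u assume "u \<in> nodes ?Y"
      then show "eff ?Y u = eff_weight G u" "card (darts_at ?Y u) = max 2 (total_ends G u)"
        using D(10,11)[of u] darts_at_merge[OF cm, of u] by auto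
    qed
  qed
qed

text \<open>Only merges are used, since a prune would forget vertices of G. For standard graphs with
  branching vertices, nothing is left to prune afterwards.\<close>

lemma decomp_exists_irreducible:
  assumes "decomp G X p"
  shows "\<exists>K p. step\<^sup>*\<^sup>* X K \<and> decomp G K p \<and> (\<forall>v a b. \<not> can_merge K v a b)"
  using assms
proof (induction "card (nodes X)" arbitrary: X p rule: less_induct)
  case less
  show ?case
  proof (cases "\<exists>v a b. can_merge X v a b")
    case True
    then obtain v a b where cm: "can_merge X v a b" by blast
    note wf = decompD(1)[OF less.prems]
    have "\<exists>a b p'. can_merge X v a b \<and> decomp G (merge X v a b) p'"
    proof (cases "mate X b = b")
      case True
      then have "mate X a \<noteq> a" using can_mergeD(5)[OF cm] by blast
      then show ?thesis using decomp_merge[OF less.prems can_merge_commute_ab[OF wf cm]]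
          can_merge_commute_ab[OF wf cm] by blast
    next
      case False
      then show ?thesis using decomp_merge[OF less.prems cm] cm by blast
    qed
    then obtain a b p' where Y: "can_merge X v a b" "decomp G (merge X v a b) p'" by blast
    have "card (nodes (merge X v a b)) < card (nodes X)"
      using can_mergeD(1)[OF Y(1)] wfD(1)[OF wf] by (simp only: merge_simps card_Diff1_less)
    then obtain K q where "step\<^sup>*\<^sup>* (merge X v a b) K" "decomp G K q" "\<forall>v a b. \<not> can_merge K v a b"
      using less.hyps Y(2) by blast
    then show ?thesis using step.merge[OF Y(1)] by (meson converse_rtranclp_into_rtranclp)
  next
    case False
    then show ?thesis using less.prems by blast
  qed
qed

text \<open>A node of valence 2 that cannot be merged carries a loop or two legs; no edge leads away
  from it, so by connectedness it is the whole graph.\<close>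

lemma irreducible_cases:
  assumes wf: "wf_dart_graph K" and conn: "connected_dart_graph K" and irr: "\<forall>v a b. \<not> can_merge K v a b"
  obtains (branched) "\<forall>v\<in>nodes K. 3 \<le> card (darts_at K v)"
  | (chain) v a b where "nodes K = {v}" "darts K = {a, b}" "a \<noteq> b" "base K a = v" "base K b = v"
      "mate K a = a" "mate K b = b"
  | (circle) v a b where "nodes K = {v}" "darts K = {a, b}" "a \<noteq> b" "base K a = v" "base K b = v"
      "mate K a = b" "mate K b = a"
proof (cases "\<forall>v\<in>nodes K. 3 \<le> card (darts_at K v)")
  case True
  then show ?thesis by (rule branched)
next
  case False
  then obtain v where v: "v \<in> nodes K" "card (darts_at K v) < 3" by auto
  then have "card (darts_at K v) = 2" using wfD(9)[OF wf v(1)] by simp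
  then obtain a b where at: "darts_at K v = {a, b}" "a \<noteq> b" by (auto simp: card_2_iff)
  then have ab: "a \<in> darts K" "b \<in> darts K" "base K a = v" "base K b = v"
    unfolding darts_at_def by auto
  have c: "mate K a = b \<and> mate K b = a \<or> mate K a = a \<and> mate K b = b"
    using irr at v(1) wfD(6)[OF wf ab(1)] unfolding can_merge_def by metis
  have "nodes K = {v}"
  proof (rule connected_closed[OF conn])
    fix d assume "d \<in> darts K" "base K d \<in> {v}"
    then have "d = a \<or> d = b" using at unfolding darts_at_def by auto
    then show "base K (mate K d) \<in> {v}" using c ab by auto
  qed (use v in auto)
  moreover have "darts K = {a, b}"
    using calculation at wfD(4)[OF wf] unfolding darts_at_def by auto
  ultimately show ?thesis using chain circle at(2) ab c by blast
qed

lemma wgraph_iso_sym: "G \<cong>\<^sub>w H \<Longrightarrow> H \<cong>\<^sub>w G"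
proof -
  assume "G \<cong>\<^sub>w H"
  then obtain f where wf: "wgraph G" "wgraph H" and f: "bij_betw f (verts G) (verts H)"
    and e: "image_mset (map_uprod f) (edges G) = edges H"
    and w: "\<forall>v\<in>verts G. weight H (f v) = weight G v"
    unfolding wgraph_iso_def by blast
  define g where "g = the_inv_into (verts G) f"
  have inj: "inj_on f (verts G)" and im: "f ` verts G = verts H" using f by (auto simp: bij_betw_def)
  have gf: "g (f v) = v" if "v \<in> verts G" for v
    using that inj by (simp add: g_def the_inv_into_f_f)
  have "bij_betw g (verts H) (verts G)" unfolding g_def by (rule bij_betw_the_inv_into[OF f])
  moreover have "image_mset (map_uprod g) (edges H) = edges G"
  proof -
    have "map_uprod g (map_uprod f x) = x" if "x \<in># edges G" for x
    proof -
      obtain u v where x: "x = Upair u v" using uprod_exhaust by blast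
      then show ?thesis using wgraph_edge[OF wf(1), of u v] that gf by auto
    qed
    then have "image_mset (\<lambda>x. map_uprod g (map_uprod f x)) (edges G) = image_mset (\<lambda>x. x) (edges G)"
      by (intro image_mset_cong) auto
    then show ?thesis unfolding e[symmetric] by (simp add: multiset.map_comp comp_def)
  qed
  moreover have "weight G (g v) = weight H v" if "v \<in> verts H" for v
  proof -
    obtain u where "u \<in> verts G" "v = f u" using \<open>v \<in> verts H\<close> im by blast
    then show ?thesis using w gf by simp
  qed
  ultimately show ?thesis unfolding wgraph_iso_def using wf by blast
qed

lemma wgraph_iso_refl: "wgraph G \<Longrightarrow> G \<cong>\<^sub>w G"
  unfolding wgraph_iso_def by (intro conjI exI[of _ id]) (auto simp: uprod.map_id0)

section \<open>Linear segments\<close>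

lemma std_list_rev:
  assumes "std_list ws" shows "std_list (rev ws)"
proof -
  consider k us where "\<forall>w\<in>set us. w \<le> -2" "ws = zeros (2 * k) @ us \<or> ws = us @ zeros (2 * k)"
    | k where "ws = zeros (2 * k + 1)"
    using assms unfolding std_list_def by blast
  then show ?thesis
  proof cases
    case 1
    then have "\<forall>w\<in>set (rev us). w \<le> -2" "rev ws = rev us @ zeros (2 * k) \<or> rev ws = zeros (2 * k) @ rev us"
      by auto
    then show ?thesis unfolding std_list_def by blast
  next
    case 2
    then have "rev ws = zeros (2 * k + 1)" by (metis rev_replicate)
    then show ?thesis unfolding std_list_def by blast
  qed
qed

lemma std_list_Nil: "std_list []"
  unfolding std_list_def by (intro disjI1 exI[of _ 0] exI[of _ "[]"]) simp

lemma shift_equiv_length: "shift_equiv A B \<Longrightarrow> length A = length B"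
  unfolding shift_equiv_def by auto

lemma std_list_of_chain:
  assumes "chain_order L vs" "standard_chain L"
  shows "std_list (map (weight L) vs)"
proof -
  obtain ws where ws: "std_list ws" "L \<cong>\<^sub>w linear_wgraph ws"
    using assms(2) unfolding standard_chain_def std_list_def by blast
  have c: "distinct vs" "set vs = verts L" "edges L = path_edges vs"
    using assms(1) unfolding chain_order_def by auto
  obtain g where g: "bij_betw g (verts L) {..<length ws}"
    and e: "image_mset (map_uprod g) (edges L) = path_edges [0..<length ws]"
    and w: "\<forall>v\<in>verts L. ws ! (g v) = weight L v"
    using ws(2) unfolding wgraph_iso_def linear_wgraph_def by auto
  have "distinct (map g vs)" "set (map g vs) = set [0..<length ws]"
    using g c by (auto simp: distinct_map bij_betw_def)
  then have "map g vs = [0..<length ws] \<or> map g vs = rev [0..<length ws]"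
    using path_edges_unique[of "[0..<length ws]" "map g vs"] e c(3) by (simp add: path_edges_map)
  moreover have "map (weight L) vs = map ((!) ws) (map g vs)" using w c(2) by simp
  ultimately have "map (weight L) vs = ws \<or> map (weight L) vs = rev ws"
    by (metis map_nth rev_map)
  then show ?thesis using ws(1) std_list_rev by metis
qed

text \<open>A segment presented as a list in path order. The filter takes every edge between
  non-branching vertices that touches the list, so no such edge leads out of it and the list fills a
  whole component.\<close>

definition seg_list :: "'v wgraph \<Rightarrow> 'v list \<Rightarrow> bool" where
  "seg_list G vs \<longleftrightarrow> vs \<noteq> [] \<and> distinct vs \<and> set vs \<subseteq> verts G - branching G \<and>
     {#e \<in># edges G. set_uprod e \<subseteq> verts G - branching G \<and> set_uprod e \<inter> set vs \<noteq> {}#} = path_edges vs"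

lemma path_reach:
  assumes "\<forall>e\<in>#path_edges vs. e \<in># E" "v \<in> set vs"
  shows "(hd vs, v) \<in> {(u, w). Upair u w \<in># E}\<^sup>*"
  using assms
proof (induction vs rule: induct_list012)
  case (3 x y zs)
  show ?case
  proof (cases "v = x")
    case False
    then have "(y, v) \<in> {(u, w). Upair u w \<in># E}\<^sup>*" using 3 by auto
    moreover have "(x, y) \<in> {(u, w). Upair u w \<in># E}" using 3 by simp
    ultimately show ?thesis by (simp add: converse_rtrancl_into_rtrancl)
  qed simp
qed auto

lemma seg_list_segment:
  assumes wf: "wgraph G" and s: "seg_list G vs"
  shows "\<exists>L\<in>segments G. chain_order L vs \<and> verts L = set vs \<and> weight L = weight G"
proof -
  define N where "N = verts G - branching G"
  define G0 where "G0 = induced_wgraph G N"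
  define R where "R = (adjacency G0)\<^sup>* `` {hd vs}"
  define L where "L = induced_wgraph G0 R"
  have s': "vs \<noteq> []" "distinct vs" "set vs \<subseteq> N"
    "{#e \<in># edges G. set_uprod e \<subseteq> N \<and> set_uprod e \<inter> set vs \<noteq> {}#} = path_edges vs"
    using s unfolding seg_list_def N_def by auto
  have v0: "verts G0 = N" by (auto simp: G0_def induced_wgraph_def N_def)
  have e0: "edges G0 = {#e \<in># edges G. set_uprod e \<subseteq> N#}" by (simp add: G0_def induced_wgraph_def)
  have mem: "e \<in># path_edges vs \<longleftrightarrow> e \<in># edges G0 \<and> set_uprod e \<inter> set vs \<noteq> {}" for e
    unfolding s'(4)[symmetric] e0 by auto
  have R: "R = set vs"
  proof (intro equalityI subsetI)
    fix v assume "v \<in> R"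
    then have "(hd vs, v) \<in> (adjacency G0)\<^sup>*" by (simp add: R_def)
    then show "v \<in> set vs"
    proof (induction rule: rtrancl_induct)
      case (step u w)
      then have "Upair u w \<in># path_edges vs" unfolding mem adjacency_def by auto
      then show ?case using set_path_edges by fastforce
    qed (use s'(1) in simp)
  next
    fix v assume "v \<in> set vs"
    then have "(hd vs, v) \<in> {(u, w). Upair u w \<in># edges G0}\<^sup>*"
      using mem by (intro path_reach) auto
    then show "v \<in> R" by (simp add: R_def adjacency_def)
  qed
  have vL: "verts L = set vs" using R s'(3) v0 by (auto simp: L_def induced_wgraph_def)
  have "edges L = {#e \<in># edges G0. set_uprod e \<subseteq> set vs#}" by (simp add: L_def induced_wgraph_def R)
  also have "\<dots> = {#e \<in># edges G0. set_uprod e \<inter> set vs \<noteq> {}#}"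
  proof (rule filter_mset_cong)
    fix e assume e: "e \<in># edges G0"
    obtain x y where xy: "e = Upair x y" using uprod_exhaust by blast
    show "set_uprod e \<subseteq> set vs \<longleftrightarrow> set_uprod e \<inter> set vs \<noteq> {}"
    proof
      assume "set_uprod e \<inter> set vs \<noteq> {}"
      then show "set_uprod e \<subseteq> set vs" using mem e set_path_edges by blast
    qed (simp add: xy)
  qed simp
  also have "\<dots> = path_edges vs" unfolding e0 s'(4)[symmetric]
    by (simp add: filter_filter_mset conj_commute)
  finally have "chain_order L vs" unfolding chain_order_def using s'(2) vL by simp
  moreover have "hd vs \<in> verts G0" using s'(1,3) v0 by auto
  then have "L \<in> segments G"
    unfolding segments_def wgraph_components_def L_def R_def G0_def N_def by blast
  moreover have "weight L = weight G" by (simp add: L_def G0_def induced_wgraph_def)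
  ultimately show ?thesis using vL by blast
qed

lemma vertex_degree_weight_update [simp]: "vertex_degree (G\<lparr>weight := w\<rparr>) v = vertex_degree G v"
  by (simp add: vertex_degree_def)

lemma branching_weight_update [simp]: "branching (G\<lparr>weight := w\<rparr>) = branching G"
  by (simp add: branching_def)

lemma wgraph_weight_update [simp]: "wgraph (G\<lparr>weight := w\<rparr>) = wgraph G"
  by (simp add: wgraph_def)

lemma seg_list_weight_update [simp]: "seg_list (G\<lparr>weight := w\<rparr>) vs = seg_list G vs"
  by (simp add: seg_list_def)

lemma shift_zerosI:
  assumes wf: "wgraph G" and s: "seg_list G vs" and us: "\<forall>w\<in>set us. w \<le> -2"
    and A: "map wA vs = zeros (2 * k) @ us" and B: "map wB vs = us @ zeros (2 * k)"
    and o: "\<And>v. v \<notin> set vs \<Longrightarrow> wA v = wB v"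
  shows "shift_zeros (G\<lparr>weight := wA\<rparr>) (G\<lparr>weight := wB\<rparr>)"
proof -
  have "wgraph (G\<lparr>weight := wA\<rparr>)" "seg_list (G\<lparr>weight := wA\<rparr>) vs" using wf s by simp_all
  then obtain L where "L \<in> segments (G\<lparr>weight := wA\<rparr>)" "chain_order L vs" "verts L = set vs"
    using seg_list_segment by blast
  then show ?thesis
    unfolding shift_zeros_def using us A B o
    by (intro conjI bexI[of _ L] exI[of _ vs] exI[of _ k] exI[of _ us]) auto
qed

lemma segment_reversion_shift_equiv:
  assumes wf: "wgraph G" and s: "seg_list G vs" and eq: "shift_equiv (map wA vs) (map wB vs)"
    and o: "\<And>v. v \<notin> set vs \<Longrightarrow> wA v = wB v"
  shows "segment_reversion\<^sup>*\<^sup>* (G\<lparr>weight := wA\<rparr>) (G\<lparr>weight := wB\<rparr>)"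
proof (cases "map wA vs = map wB vs")
  case True
  then have "wA = wB" using o by (metis ext map_eq_conv)
  then show ?thesis by simp
next
  case False
  then obtain k us where "\<forall>w\<in>set us. w \<le> -2"
    "map wA vs = zeros (2 * k) @ us \<and> map wB vs = us @ zeros (2 * k) \<or>
     map wB vs = zeros (2 * k) @ us \<and> map wA vs = us @ zeros (2 * k)"
    using eq unfolding shift_equiv_def by metis
  then have "segment_reversion (G\<lparr>weight := wA\<rparr>) (G\<lparr>weight := wB\<rparr>)"
    unfolding segment_reversion_def using shift_zerosI[OF wf s] o by metis
  then show ?thesis by blast
qed

lemma segment_reversions:
  assumes wf: "wgraph G" and fin: "finite \<P>"
    and seg: "\<And>vs. vs \<in> \<P> \<Longrightarrow> seg_list G vs"
    and eq: "\<And>vs. vs \<in> \<P> \<Longrightarrow> shift_equiv (map (weight G) vs) (map W vs)"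
    and disj: "\<And>us vs. us \<in> \<P> \<Longrightarrow> vs \<in> \<P> \<Longrightarrow> set us = set vs \<or> set us \<inter> set vs = {}"
  shows "segment_reversion\<^sup>*\<^sup>* G (G\<lparr>weight := \<lambda>v. if v \<in> (\<Union>vs\<in>\<P>. set vs) then W v else weight G v\<rparr>)"
  using fin seg eq disj
proof (induction \<P>)
  case (insert vs F)
  define wF where "wF = (\<lambda>v. if v \<in> (\<Union>vs\<in>F. set vs) then W v else weight G v)"
  define wI where "wI = (\<lambda>v. if v \<in> (\<Union>vs\<in>insert vs F. set vs) then W v else weight G v)"
  have IH: "segment_reversion\<^sup>*\<^sup>* G (G\<lparr>weight := wF\<rparr>)"
    unfolding wF_def using insert by (intro insert.IH) auto
  have "segment_reversion\<^sup>*\<^sup>* (G\<lparr>weight := wF\<rparr>) (G\<lparr>weight := wI\<rparr>)"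
  proof (cases "\<exists>us\<in>F. set us = set vs")
    \<comment> \<open>The two darts of an edge contribute the same segment in opposite directions;
      its weights have already been changed once.\<close>
    case True
    then have "(\<Union>vs\<in>insert vs F. set vs) = (\<Union>vs\<in>F. set vs)" by auto
    then have "wF = wI" unfolding wF_def wI_def by simp
    then show ?thesis by simp
  next
    case False
    then have "set us \<inter> set vs = {}" if "us \<in> F" for us using insert.prems(3)[of us vs] that by blast
    then have d: "set vs \<inter> (\<Union>vs\<in>F. set vs) = {}" by blast
    then have F: "map wF vs = map (weight G) vs" by (auto simp: wF_def)
    have I: "map wI vs = map W vs" by (auto simp: wI_def)
    have "shift_equiv (map wF vs) (map wI vs)" using insert.prems(2)[of vs] unfolding F I by simp
    moreover have "seg_list G vs" using insert.prems(1) by simp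
    moreover have "wF v = wI v" if "v \<notin> set vs" for v using that by (simp add: wF_def wI_def)
    ultimately show ?thesis using segment_reversion_shift_equiv[OF wf] by blast
  qed
  then show ?case using IH unfolding wI_def by simp
qed simp

section \<open>Reconstruction of branched graphs\<close>

lemma branching_total_ends:
  "wgraph G \<Longrightarrow> branching G = {v \<in> verts G. 3 \<le> total_ends G v}"
  by (simp add: branching_def vertex_degree_total_ends)

lemma filter_mset_sum: "finite A \<Longrightarrow> filter_mset P (\<Sum>x\<in>A. f x) = (\<Sum>x\<in>A. filter_mset P (f x))"
  by (induction A rule: finite_induct) auto

lemma image_mset_sum_finite: "finite A \<Longrightarrow> image_mset g (\<Sum>x\<in>A. f x) = (\<Sum>x\<in>A. image_mset g (f x))"
  by (induction A rule: finite_induct) auto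

lemma double_mset_cancel: "M + M = N + N \<Longrightarrow> M = (N :: 'c multiset)"
proof (rule multiset_eqI)
  fix x assume "M + M = N + N"
  then have "count (M + M) x = count (N + N) x" by simp
  then show "count M x = count N x" by simp
qed

text \<open>A loop at an interior vertex of a path would occur on some strand and make that strand
  visit the vertex twice, while paths are distinct and their bases are nodes.\<close>

lemma decomp_no_loop:
  assumes dc: "decomp G K p" and d: "d \<in> darts K" "v \<in> set (p d)"
  shows "count (edges G) (Upair v v) = 0"
proof (rule ccontr)
  note D = decompD[OF dc]
  have fin: "finite (darts K)" using wfD(2)[OF D(1)] .
  assume "count (edges G) (Upair v v) \<noteq> 0"
  then have "count (\<Sum>d\<in>darts K. strand K p d) (Upair v v) \<noteq> 0" unfolding D(12) by simp
  then obtain d' where d': "d' \<in> darts K" "count (strand K p d') (Upair v v) \<noteq> 0"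
    unfolding count_sum using fin by (auto simp: sum_eq_0_iff)
  have vn: "v \<notin> nodes K" using D(4)[OF d(1)] d(2) by blast
  have b: "base K d' \<noteq> v" "base K (mate K d') \<noteq> v"
    using wfD(4)[OF D(1) d'(1)] wfD(4)[OF D(1) wfD(5)[OF D(1) d'(1)]] vn by auto
  have "2 \<le> count_list (base K d' # p d' @ [base K (mate K d')]) v \<or> 2 \<le> count_list (base K d' # p d') v"
  proof (cases "mate K d' = d'")
    case True
    then have "Upair v v \<in># path_edges (base K d' # p d')"
      using d'(2) unfolding strand_def by (simp add: not_in_iff)
    from loop_path_edges[OF this] show ?thesis by (rule disjI2)
  next
    case False
    then have "Upair v v \<in># path_edges (base K d' # p d' @ [base K (mate K d')])"
      using d'(2) unfolding strand_def by (simp add: not_in_iff)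
    from loop_path_edges[OF this] show ?thesis by (rule disjI1)
  qed
  then have "2 \<le> count_list (p d') v" using b by (auto simp: count_list_append)
  then show False using count_list_distinct[OF D(3)[OF d'(1)], of v] by simp
qed

lemma decomp_eff_weight:
  assumes "decomp G K p" "d \<in> darts K"
  shows "map (eff_weight G) (p d) = map (weight G) (p d)"
  using decomp_no_loop[OF assms] by (simp add: eff_weight_def)

lemma decomp_branched_nodes:
  assumes wf: "wgraph G" and dc: "decomp G K p" and br: "\<forall>v\<in>nodes K. 3 \<le> card (darts_at K v)"
  shows "nodes K = branching G"
proof -
  note D = decompD[OF dc]
  have "3 \<le> total_ends G v" if "v \<in> nodes K" for v using D(11)[OF that] br that by auto
  moreover have "\<not> 3 \<le> total_ends G v" if "d \<in> darts K" "v \<in> set (p d)" for d v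
    using D(8)[OF that] by simp
  ultimately show ?thesis using D(2) unfolding branching_total_ends[OF wf] by auto
qed

lemma path_edges_interior:
  assumes "l \<noteq> []"
  shows "path_edges (b # l) = add_mset (Upair b (hd l)) (path_edges l)"
    "path_edges (b # l @ [b']) = add_mset (Upair (last l) b') (add_mset (Upair b (hd l)) (path_edges l))"
proof -
  show 1: "path_edges (b # l) = add_mset (Upair b (hd l)) (path_edges l)"
    using assms by (cases l) auto
  show "path_edges (b # l @ [b']) = add_mset (Upair (last l) b') (add_mset (Upair b (hd l)) (path_edges l))"
    using path_edges_snoc[of "b # l" b'] assms 1 by simp
qed

text \<open>Filtering the double cover of the edges by the defining condition of a segment leaves
  only the interior edges of the strands of d and its mate, which is the path counted twice.\<close>

lemma decomp_seg_list:
  assumes wf: "wgraph G" and dc: "decomp G K p" and br: "\<forall>v\<in>nodes K. 3 \<le> card (darts_at K v)"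
    and d: "d \<in> darts K" and ne: "p d \<noteq> []"
  shows "seg_list G (p d)"
proof -
  note D = decompD[OF dc]
  note nb = decomp_branched_nodes[OF wf dc br]
  have fin: "finite (darts K)" using wfD(2)[OF D(1)] .
  define N where "N = verts G - branching G"
  define P where "P e \<longleftrightarrow> set_uprod e \<subseteq> N \<and> set_uprod e \<inter> set (p d) \<noteq> {}" for e
  have baseN: "base K e \<notin> N" "base K (mate K e) \<notin> N" if "e \<in> darts K" for e
    using wfD(4)[OF D(1) that] wfD(4)[OF D(1) wfD(5)[OF D(1) that]] nb by (auto simp: N_def)
  have setN: "set (p d) \<subseteq> N" using D(2) D(4)[OF d] d nb by (auto simp: N_def)
  have zero: "filter_mset P (strand K p e) = {#}" if e: "e \<in> darts K" "e \<noteq> d" "e \<noteq> mate K d" for e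
  proof -
    have dj: "set (p d) \<inter> set (p e) = {}" using D(9)[OF d e(1)] e by blast
    have "\<not> P x" if x: "x \<in># strand K p e" for x
    proof
      assume "P x"
      have "set_uprod x \<subseteq> set (p e) \<union> {base K e, base K (mate K e)}"
        using x set_path_edges unfolding strand_def by (fastforce split: if_splits)
      then have "set_uprod x \<subseteq> set (p e)" using \<open>P x\<close> baseN[OF e(1)] unfolding P_def by blast
      then show False using \<open>P x\<close> dj unfolding P_def by blast
    qed
    then show ?thesis by simp
  qed
  have pathP: "filter_mset P (path_edges (p d)) = path_edges (p d)"
  proof -
    have "P x" if "x \<in># path_edges (p d)" for x
    proof -
      obtain u w where "x = Upair u w" using uprod_exhaust by blast
      then show ?thesis using set_path_edges[OF that] setN unfolding P_def by auto
    qed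
    then show ?thesis by (simp add: filter_mset_eq_conv)
  qed
  have nP: "\<not> P (Upair (base K e) x)" "\<not> P (Upair x (base K (mate K e)))" if "e \<in> darts K" for e x
    using baseN[OF that] unfolding P_def by auto
  have "filter_mset P (edges G + edges G) = (\<Sum>e\<in>darts K. filter_mset P (strand K p e))"
    unfolding D(12)[symmetric] by (rule filter_mset_sum[OF fin])
  also have "\<dots> = (\<Sum>e\<in>{d, mate K d}. filter_mset P (strand K p e))"
    by (rule sum.mono_neutral_right) (use fin d wfD(5)[OF D(1) d] zero in auto)
  also have "\<dots> = path_edges (p d) + path_edges (p d)"
  proof (cases "mate K d = d")
    case True
    then show ?thesis using nP[OF d] pathP path_edges_interior[OF ne] by (simp add: strand_def)
  next
    case False
    have m: "mate K d \<in> darts K" "mate K (mate K d) = d" using wfD(5,6)[OF D(1) d] by auto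
    have s1: "filter_mset P (strand K p d) = path_edges (p d)"
      using False nP[OF d] pathP path_edges_interior[OF ne] by (simp add: strand_def)
    have "strand K p (mate K d) = path_edges (rev (base K d # p d @ [base K (mate K d)]))"
      using False m D(6)[OF d False] by (simp add: strand_def)
    then have "strand K p (mate K d) = strand K p d" using False by (simp only: path_edges_rev strand_def if_False)
    then show ?thesis using False s1 by simp
  qed
  finally have "filter_mset P (edges G) + filter_mset P (edges G) = path_edges (p d) + path_edges (p d)"
    by simp
  then have "filter_mset P (edges G) = path_edges (p d)" by (rule double_mset_cancel)
  then show ?thesis
    unfolding seg_list_def using ne D(3)[OF d] setN unfolding P_def[abs_def] N_def by blast
qed

lemma standard_strands:
  assumes wf: "wgraph G" and std: "\<forall>L\<in>segments G. standard_chain L"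
    and dc: "decomp G K p" and br: "\<forall>v\<in>nodes K. 3 \<le> card (darts_at K v)" and d: "d \<in> darts K"
  shows "std_list (map (weight G) (p d))"
proof (cases "p d = []")
  case False
  obtain L where "L \<in> segments G" "chain_order L (p d)" "weight L = weight G"
    using seg_list_segment[OF wf decomp_seg_list[OF wf dc br d False]] by blast
  then show ?thesis using std_list_of_chain std by metis
qed (simp add: std_list_Nil)

text \<open>Valence at least 3 rules out merging. A leg with an empty path sits at a vertex of
  degree at most 1, hence not at these nodes, and a nonempty standard chain is too far from
  \<open>turn\<close> to be pruned.\<close>

lemma branched_irreducible:
  assumes dc: "decomp G K p" and br: "\<forall>v\<in>nodes K. 3 \<le> card (darts_at K v)"
    and std: "\<forall>d\<in>darts K. std_list (map (weight G) (p d))"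
  shows "\<not> step K Y"
proof
  note D = decompD[OF dc]
  assume "step K Y"
  then show False
  proof cases
    case (merge v a b)
    note m = can_mergeD[OF merge(2)]
    have "card {a, b} \<le> 2" by (simp add: card_insert_if)
    then show False using br m(1,2) by fastforce
  next
    case (prune d j)
    note c = can_pruneD[OF prune(2)]
    obtain m where m: "lab K d = twist j * turn * twist m" using c(4) by blast
    have "p d \<noteq> []"
    proof
      assume "p d = []"
      then have "total_ends G (base K d) \<le> 1" using D(7) c(1,2) by blast
      then show False using c(3) D(11)[OF wfD(4)[OF D(1) c(1)]] by simp
    qed
    then show False
      using std_list_nontrivial[of "map (weight G) (p d)" j m] std c(1) m D(5)[OF c(1)] decomp_eff_weight[OF dc c(1)]
      by auto
  qed
qed

text \<open>The edges are covered by the strands, so a bijection matching the strands is an isomorphism.\<close>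

lemma branched_reconstruction:
  fixes G :: "'a wgraph" and G' :: "'b wgraph"
  assumes wf: "wgraph G" and wf': "wgraph G'"
    and dc: "decomp G K p" and br: "\<forall>v\<in>nodes K. 3 \<le> card (darts_at K v)"
    and std: "\<forall>d\<in>darts K. std_list (map (weight G) (p d))"
    and dc': "decomp G' K' p'" and std': "\<forall>d\<in>darts K'. std_list (map (weight G') (p' d))"
    and "sim K K'"
  shows "\<exists>\<Delta> \<Delta>'. segment_reversion\<^sup>*\<^sup>* G \<Delta> \<and> change_branching_weights \<Delta> \<Delta>' \<and> \<Delta>' \<cong>\<^sub>w G'"
proof -
  obtain \<phi> \<psi> k where s: "sim_via K K' \<phi> \<psi> k" using assms(8) unfolding sim_def by blast
  note D = decompD[OF dc] and D' = decompD[OF dc']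
  note nb = decomp_branched_nodes[OF wf dc br]
  have fin: "finite (darts K)" using wfD(2)[OF D(1)] .
  have \<psi>: "\<psi> d \<in> darts K'" if "d \<in> darts K" for d using sim_via_inj(3)[OF s that] .
  have leg: "mate K' (\<psi> d) = \<psi> d \<longleftrightarrow> mate K d = d" if "d \<in> darts K" for d
    using sim_viaD(4)[OF s that] sim_via_inj(1)[OF s wfD(5)[OF D(1) that] that] by simp
  have se: "shift_equiv (map (weight G) (p d)) (map (weight G') (p' (\<psi> d)))" if d: "d \<in> darts K" for d
  proof -
    obtain i j where "lab K' (\<psi> d) = twist i * lab K d * twist j"
      using sim_viaD(5,6)[OF s d] by blast
    then have "chain_value (map (weight G') (p' (\<psi> d))) = twist i * chain_value (map (weight G) (p d)) * twist j"
      unfolding D(5)[OF d] D'(5)[OF \<psi>[OF d]] decomp_eff_weight[OF dc d] decomp_eff_weight[OF dc' \<psi>[OF d]] .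
    then show ?thesis using chain_value_determines std std' d \<psi>[OF d] by blast
  qed
  have len: "length (p' (\<psi> d)) = length (p d)" if "d \<in> darts K" for d
    using shift_equiv_length[OF se[OF that]] by simp
  have mp: "p' (\<psi> (mate K d)) = rev (p' (\<psi> d))" if d: "d \<in> darts K" "mate K d \<noteq> d" for d
    using D'(6)[OF \<psi>[OF d(1)]] leg[OF d(1)] d(2) sim_viaD(4)[OF s d(1)] by simp
  \<comment> \<open>A vertex on a path goes to the vertex at the same position of the corresponding
    path. The choice is harmless: only d and its mate see the vertex, at mirrored positions on both
    sides.\<close>
  define f where "f v = (if v \<in> nodes K then \<phi> v
    else (SOME w. \<exists>d\<in>darts K. \<exists>i<length (p d). p d ! i = v \<and> w = p' (\<psi> d) ! i))" for v
  have uniq: "p' (\<psi> e) ! j = p' (\<psi> d) ! i"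
    if d: "d \<in> darts K" "i < length (p d)" and e: "e \<in> darts K" "j < length (p e)" and eq: "p e ! j = p d ! i"
    for d e i j
  proof -
    have "p d ! i \<in> set (p d) \<inter> set (p e)" using that by (metis IntI nth_mem)
    then have "e = d \<or> e = mate K d" using D(9)[OF d(1) e(1)] by blast
    then consider "e = d" | "e = mate K d" "mate K d \<noteq> d" by blast
    then show ?thesis
    proof cases
      case 1
      then show ?thesis using D(3)[OF d(1)] d e eq by (simp add: nth_eq_iff_index_eq)
    next
      case 2
      then have r: "p e = rev (p d)" using D(6)[OF d(1)] by simp
      then have "p d ! (length (p d) - Suc j) = p d ! i" using eq e(2) by (simp add: rev_nth)
      then have "length (p d) - Suc j = i" using D(3)[OF d(1)] d(2) e(2) r by (simp add: nth_eq_iff_index_eq)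
      moreover have "p' (\<psi> e) ! j = p' (\<psi> d) ! (length (p' (\<psi> d)) - Suc j)"
        using mp[OF d(1) 2(2)] 2(1) e(2) r len[OF d(1)] by (simp add: rev_nth)
      ultimately show ?thesis using len[OF d(1)] by simp
    qed
  qed
  have fB: "f v = \<phi> v" if "v \<in> nodes K" for v using that by (simp add: f_def)
  have mapf: "map f (p d) = p' (\<psi> d)" if d: "d \<in> darts K" for d
  proof (rule nth_equalityI)
    show "length (map f (p d)) = length (p' (\<psi> d))" using len[OF d] by simp
  next
    fix i assume "i < length (map f (p d))"
    then have i: "i < length (p d)" by simp
    then have "p d ! i \<notin> nodes K" using D(4)[OF d] nth_mem by blast
    moreover have "(SOME w. \<exists>e\<in>darts K. \<exists>j<length (p e). p e ! j = p d ! i \<and> w = p' (\<psi> e) ! j) = p' (\<psi> d) ! i"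
    proof (rule some_equality)
      show "\<exists>e\<in>darts K. \<exists>j<length (p e). p e ! j = p d ! i \<and> p' (\<psi> d) ! i = p' (\<psi> e) ! j" using d i by blast
    next
      fix w assume "\<exists>e\<in>darts K. \<exists>j<length (p e). p e ! j = p d ! i \<and> w = p' (\<psi> e) ! j"
      then show "w = p' (\<psi> d) ! i" using uniq[OF d i] by blast
    qed
    ultimately show "map f (p d) ! i = p' (\<psi> d) ! i" using i by (simp add: f_def)
  qed
  have imB: "f ` nodes K = nodes K'"
    using fB sim_viaD(1)[OF s] by (auto simp: bij_betw_def)
  have imD: "\<psi> ` darts K = darts K'" using sim_viaD(2)[OF s] by (simp add: bij_betw_def)
  have imp: "f ` set (p d) = set (p' (\<psi> d))" if "d \<in> darts K" for d
    using mapf[OF that] by (metis list.set_map)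
  have im: "f ` verts G = verts G'"
  proof -
    have "f ` verts G = f ` nodes K \<union> (\<Union>d\<in>darts K. f ` set (p d))" unfolding D(2) by (simp add: image_Un image_UN)
    also have "(\<Union>d\<in>darts K. f ` set (p d)) = (\<Union>d\<in>darts K'. set (p' d))"
      unfolding imD[symmetric] using imp by simp
    finally show ?thesis using imB D'(2) by simp
  qed
  have inj: "inj_on f (verts G)"
  proof (rule inj_onI)
    fix u v assume uv: "u \<in> verts G" "v \<in> verts G" "f u = f v"
    have mix: False if "x \<in> nodes K" "d \<in> darts K" "y \<in> set (p d)" "f x = f y" for x y d
    proof -
      have "f y \<in> set (p' (\<psi> d))" using imp that by blast
      moreover have "f x \<in> nodes K'" using imB that by blast
      ultimately show False using D'(4)[OF \<psi>[OF that(2)]] that(4) by auto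
    qed
    consider "u \<in> nodes K" "v \<in> nodes K" | d where "u \<in> nodes K" "d \<in> darts K" "v \<in> set (p d)"
      | d where "v \<in> nodes K" "d \<in> darts K" "u \<in> set (p d)"
      | d e where "d \<in> darts K" "u \<in> set (p d)" "e \<in> darts K" "v \<in> set (p e)"
      using uv D(2) by blast
    then show "u = v"
    proof cases
      case 1
      then show ?thesis using uv(3) fB sim_via_inj(2)[OF s] by simp
    next
      case (2 d)
      then show ?thesis using mix uv(3) by blast
    next
      case (3 d)
      then show ?thesis using mix[of v d u] uv(3) by simp
    next
      case (4 d e)
      have "f u \<in> set (p' (\<psi> d)) \<inter> set (p' (\<psi> e))" using imp 4 uv(3) by (metis IntI image_eqI)
      then have "\<psi> e = \<psi> d \<or> \<psi> e = mate K' (\<psi> d)" using D'(9)[OF \<psi>[OF 4(1)] \<psi>[OF 4(3)]] by blast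
      then have "e = d \<or> e = mate K d"
        using sim_via_inj(1)[OF s 4(3)] 4(1) sim_viaD(4)[OF s 4(1)] wfD(5)[OF D(1) 4(1)] by auto
      then have "set (p e) = set (p d)" using D(6)[OF 4(1)] by (metis set_rev)
      then have "v \<in> set (p d)" using 4 by simp
      moreover have "inj_on f (set (p d))"
        using D'(3)[OF \<psi>[OF 4(1)]] unfolding mapf[OF 4(1), symmetric] by (simp add: distinct_map)
      ultimately show ?thesis using 4(2) uv(3) by (simp add: inj_on_def)
    qed
  qed
  have edges: "image_mset (map_uprod f) (edges G) = edges G'"
  proof (rule double_mset_cancel)
    have strand: "image_mset (map_uprod f) (strand K p d) = strand K' p' (\<psi> d)" if d: "d \<in> darts K" for d
    proof -
      have b: "f (base K d) = base K' (\<psi> d)" "f (base K (mate K d)) = base K' (mate K' (\<psi> d))"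
        using fB wfD(4,5)[OF D(1)] d sim_viaD(3,4)[OF s] by simp_all
      show ?thesis
        using leg[OF d] b mapf[OF d] by (simp add: strand_def path_edges_map)
    qed
    have "image_mset (map_uprod f) (edges G) + image_mset (map_uprod f) (edges G) =
        image_mset (map_uprod f) (edges G + edges G)" by simp
    also have "\<dots> = (\<Sum>d\<in>darts K. strand K' p' (\<psi> d))"
      unfolding D(12)[symmetric] image_mset_sum_finite[OF fin] using strand by (rule sum.cong[OF refl])
    also have "\<dots> = (\<Sum>d\<in>darts K'. strand K' p' d)"
      unfolding imD[symmetric] using sim_viaD(2)[OF s] by (subst sum.reindex) (auto simp: bij_betw_def)
    finally show "image_mset (map_uprod f) (edges G) + image_mset (map_uprod f) (edges G) = edges G' + edges G'"
      using D'(12) by simp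
  qed
  define W where "W v = weight G' (f v)" for v
  define \<P> where "\<P> = p ` {d \<in> darts K. p d \<noteq> []}"
  \<comment> \<open>\<Delta> takes the weights of G' on the segments only, \<Delta>' everywhere; the
    difference sits on the branching vertices.\<close>
  define \<Delta> where "\<Delta> = G\<lparr>weight := \<lambda>v. if v \<in> (\<Union>vs\<in>\<P>. set vs) then W v else weight G v\<rparr>"
  define \<Delta>' where "\<Delta>' = G\<lparr>weight := W\<rparr>"
  have "segment_reversion\<^sup>*\<^sup>* G \<Delta>"
    unfolding \<Delta>_def
  proof (rule segment_reversions[OF wf])
    show "finite \<P>" using fin by (simp add: \<P>_def)
  next
    fix vs assume "vs \<in> \<P>"
    then obtain d where d: "d \<in> darts K" "p d \<noteq> []" "vs = p d" by (auto simp: \<P>_def)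
    show "seg_list G vs" using decomp_seg_list[OF wf dc br d(1,2)] d(3) by simp
    have "map W vs = map (weight G') (p' (\<psi> d))"
      unfolding mapf[OF d(1), symmetric] d(3) by (simp add: W_def)
    then show "shift_equiv (map (weight G) vs) (map W vs)" using se[OF d(1)] d(3) by simp
  next
    fix us vs assume "us \<in> \<P>" "vs \<in> \<P>"
    then obtain d e where "d \<in> darts K" "us = p d" "e \<in> darts K" "vs = p e" by (auto simp: \<P>_def)
    then show "set us = set vs \<or> set us \<inter> set vs = {}" using D(6)[of d] D(9)[of d e] by (metis set_rev)
  qed
  moreover have "change_branching_weights \<Delta> \<Delta>'"
    unfolding change_branching_weights_def
  proof (intro conjI ballI)
    fix v assume "v \<in> verts \<Delta> - branching \<Delta>"
    then have "v \<in> verts G" "v \<notin> nodes K" by (simp_all add: \<Delta>_def nb)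
    then obtain d where "d \<in> darts K" "v \<in> set (p d)" using D(2) by auto
    then have "v \<in> (\<Union>vs\<in>\<P>. set vs)" by (force simp: \<P>_def)
    then show "weight \<Delta>' v = weight \<Delta> v" by (simp add: \<Delta>_def \<Delta>'_def)
  qed (simp_all add: \<Delta>_def \<Delta>'_def)
  moreover have "\<Delta>' \<cong>\<^sub>w G'"
    unfolding wgraph_iso_def
    using wf wf' inj im edges by (intro conjI exI[of _ f]) (auto simp: \<Delta>'_def bij_betw_def W_def)
  ultimately show ?thesis by blast
qed

section \<open>Chains\<close>

lemma distinct_no_loop:
  assumes "distinct vs" shows "count (path_edges vs) (Upair v v) = 0"
proof (rule ccontr)
  assume "count (path_edges vs) (Upair v v) \<noteq> 0"
  then have "Upair v v \<in># path_edges vs" by (simp add: not_in_iff)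
  from loop_path_edges[OF this] show False using count_list_distinct[OF assms, of v] by simp
qed

lemma path_edges_split: "path_edges (rev xs @ v # ys) = path_edges (v # xs) + path_edges (v # ys)"
  using path_edges_append[of "rev xs" v ys] path_edges_rev[of "v # xs"] by simp

lemma decomp_chain:
  assumes wf: "wgraph G" and dc: "decomp G K p"
    and K: "nodes K = {v}" "darts K = {a, b}" "a \<noteq> b" "base K a = v" "base K b = v" "mate K a = a" "mate K b = b"
  shows "\<exists>vs. seg_list G vs \<and> set vs = verts G \<and> edges G = path_edges vs \<and>
     chain_type K (chain_value (map (weight G) vs))"
proof -
  note D = decompD[OF dc]
  \<comment> \<open>The whole chain, read from the free end of the leg a to that of the leg
    b.\<close>
  define vs where "vs = rev (p a) @ v # p b"
  have aK: "a \<in> darts K" and bK: "b \<in> darts K" and vK: "v \<in> nodes K" using K by auto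
  have verts: "set vs = verts G" using D(2) K by (auto simp: vs_def)
  have dj: "set (p a) \<inter> set (p b) = {}" using D(9)[OF aK bK] K by simp
  have dist: "distinct vs"
    unfolding vs_def using D(3)[OF aK] D(3)[OF bK] D(4)[OF aK] D(4)[OF bK] vK dj by auto
  have "edges G + edges G = path_edges vs + path_edges vs"
    unfolding D(12)[symmetric] using K by (simp add: strand_def vs_def path_edges_split)
  then have edges: "edges G = path_edges vs" by (rule double_mset_cancel)
  have at: "darts_at K v = {a, b}" using K unfolding darts_at_def by auto
  have "total_ends G v \<le> 2" using D(11)[OF vK] at K(3) by simp
  then have "total_ends G u \<le> 2" if "u \<in> verts G" for u
    using that D(8)[OF aK, of u] D(8)[OF bK, of u] unfolding verts[symmetric] vs_def by auto
  then have B: "branching G = {}" unfolding branching_total_ends[OF wf] by fastforce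
  have "{#e \<in># edges G. set_uprod e \<subseteq> verts G - branching G \<and> set_uprod e \<inter> set vs \<noteq> {}#} = edges G"
  proof -
    have "set_uprod e \<subseteq> verts G - branching G \<and> set_uprod e \<inter> set vs \<noteq> {}" if "e \<in># edges G" for e
    proof -
      obtain x y where "e = Upair x y" using uprod_exhaust by blast
      then show ?thesis using wgraph_edge[OF wf, of x y] that B verts by auto
    qed
    then show ?thesis by (simp add: filter_mset_eq_conv)
  qed
  moreover have "vs \<noteq> []" by (simp add: vs_def)
  ultimately have "seg_list G vs" unfolding seg_list_def using dist verts B edges by simp
  moreover have "chain_type K (chain_value (map (weight G) vs))"
  proof (rule chain_typeI[OF K])
    have w: "eff_weight G = weight G"
      using distinct_no_loop[OF dist] by (simp add: fun_eq_iff eff_weight_def edges)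
    show "reversal (lab K a) * twist (eff K v) * lab K b = chain_value (map (weight G) vs)"
      using D(5)[OF aK] D(5)[OF bK] D(10)[OF vK] w
      by (simp add: vs_def reversal_chain_value chain_value_append rev_map)
  qed
  ultimately show ?thesis using verts edges by blast
qed

lemma seg_list_rev: "seg_list G vs \<Longrightarrow> seg_list G (rev vs)"
  by (simp add: seg_list_def)

lemma chain_reconstruction:
  fixes G :: "'a wgraph" and G' :: "'b wgraph"
  assumes wf: "wgraph G" "wgraph G'"
    and vs: "seg_list G vs" "set vs = verts G" "edges G = path_edges vs" "std_list (map (weight G) vs)"
    and vs': "seg_list G' vs'" "set vs' = verts G'" "edges G' = path_edges vs'" "std_list (map (weight G') vs')"
    and eq: "chain_equiv (chain_value (map (weight G) vs)) (chain_value (map (weight G') vs'))"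
  shows "\<exists>\<Delta> \<Delta>'. segment_reversion\<^sup>*\<^sup>* G \<Delta> \<and> change_branching_weights \<Delta> \<Delta>' \<and> \<Delta>' \<cong>\<^sub>w G'"
proof -
  obtain i j where ij: "chain_value (map (weight G') vs') = twist i * chain_value (map (weight G) vs) * twist j \<or>
      chain_value (map (weight G') vs') = twist i * chain_value (map (weight G) (rev vs)) * twist j"
    using eq unfolding chain_equiv_def by (auto simp: reversal_chain_value rev_map)
  \<comment> \<open>The values agree possibly only after reversal, so G is read in whichever
    direction matches G'.\<close>
  obtain us where us: "us = vs \<or> us = rev vs" "shift_equiv (map (weight G) us) (map (weight G') vs')"
  proof (rule disjE[OF ij])
    assume "chain_value (map (weight G') vs') = twist i * chain_value (map (weight G) vs) * twist j"
    then show thesis using that[of vs] chain_value_determines[OF vs(4) vs'(4)] by blast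
  next
    assume h: "chain_value (map (weight G') vs') = twist i * chain_value (map (weight G) (rev vs)) * twist j"
    have "std_list (map (weight G) (rev vs))" using std_list_rev[OF vs(4)] by (simp add: rev_map)
    then show thesis using that[of "rev vs"] chain_value_determines[OF _ vs'(4) h] by blast
  qed
  have u: "seg_list G us" "set us = verts G" "edges G = path_edges us"
    using us(1) vs(1-3) seg_list_rev by auto
  have len: "length us = length vs'" using shift_equiv_length[OF us(2)] by simp
  have dist: "distinct us" "distinct vs'" using u(1) vs'(1) unfolding seg_list_def by auto
  define f where "f v = the (map_of (zip us vs') v)" for v
  have mf: "map f us = vs'"
    by (rule nth_equalityI) (use len dist in \<open>simp_all add: f_def map_of_zip_nth\<close>)
  have bij: "bij_betw f (verts G) (verts G')"
    unfolding u(2)[symmetric] vs'(2)[symmetric] bij_betw_def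
    using dist(2) unfolding mf[symmetric] by (simp add: distinct_map)
  define W where "W v = (if v \<in> set us then weight G' (f v) else weight G v)" for v
  define \<Delta> where "\<Delta> = G\<lparr>weight := W\<rparr>"
  have mw: "map W us = map (weight G') vs'"
    unfolding mf[symmetric] by (simp add: W_def)
  have "segment_reversion\<^sup>*\<^sup>* (G\<lparr>weight := weight G\<rparr>) \<Delta>"
    unfolding \<Delta>_def by (rule segment_reversion_shift_equiv[OF wf(1) u(1)]) (use us(2) mw in \<open>simp_all add: W_def\<close>)
  moreover have "change_branching_weights \<Delta> \<Delta>" by (simp add: change_branching_weights_def)
  moreover have "\<Delta> \<cong>\<^sub>w G'"
    unfolding wgraph_iso_def
  proof (intro conjI exI[of _ f])
    show "image_mset (map_uprod f) (edges \<Delta>) = edges G'"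
      using u(3) vs'(3) mf by (simp add: \<Delta>_def path_edges_map)
  qed (use wf bij u(2) in \<open>auto simp: \<Delta>_def W_def\<close>)
  ultimately show ?thesis by auto
qed

section \<open>Circular graphs\<close>

lemma set_cycle_edges: "e \<in># cycle_edges us \<Longrightarrow> set_uprod e \<subseteq> set us"
proof (cases us)
  case (Cons v p)
  assume "e \<in># cycle_edges us"
  then show ?thesis using set_path_edges[of e "v # p @ [v]"] Cons by (auto simp: cycle_edges_Cons)
qed (simp add: cycle_edges_def)

lemma wgraph_circular: "ws \<noteq> [] \<Longrightarrow> wgraph (circular_wgraph ws)"
  unfolding wgraph_def circular_wgraph_def using set_cycle_edges by fastforce

lemma circular_wgraph_list:
  assumes "G \<cong>\<^sub>w circular_wgraph ws"
  obtains us where "distinct us" "set us = verts G" "edges G = cycle_edges us" "map (weight G) us = ws"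
proof -
  obtain f where f: "bij_betw f {..<length ws} (verts G)"
    and e: "image_mset (map_uprod f) (cycle_edges [0..<length ws]) = edges G"
    and w: "\<forall>i<length ws. weight G (f i) = ws ! i"
    using wgraph_iso_sym[OF assms] unfolding wgraph_iso_def circular_wgraph_def by auto
  have "distinct (map f [0..<length ws])" "set (map f [0..<length ws]) = verts G"
    using f by (auto simp: distinct_map bij_betw_def atLeast0LessThan)
  moreover have "edges G = cycle_edges (map f [0..<length ws])" using e by (simp add: cycle_edges_map)
  moreover have "map (weight G) (map f [0..<length ws]) = ws"
    by (rule nth_equalityI) (use w in auto)
  ultimately show ?thesis using that by blast
qed

lemma circular_wgraph_iso:
  assumes wf: "wgraph G" and us: "distinct us" "set us = verts G" "edges G = cycle_edges us"
  shows "G \<cong>\<^sub>w circular_wgraph (map (weight G) us)"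
proof (rule wgraph_iso_sym)
  have "us \<noteq> []" using wgraph_nonempty[OF wf] us by auto
  then have "wgraph (circular_wgraph (map (weight G) us))" using wgraph_circular by simp
  moreover have "bij_betw ((!) us) {..<length us} (verts G)"
    using bij_betw_nth[OF us(1) refl us(2)[symmetric]] .
  moreover have "image_mset (map_uprod ((!) us)) (cycle_edges [0..<length us]) = edges G"
    by (simp add: cycle_edges_map map_nth us(3))
  ultimately show "circular_wgraph (map (weight G) us) \<cong>\<^sub>w G"
    unfolding wgraph_iso_def using wf
    by (intro conjI exI[of _ "(!) us"]) (auto simp: circular_wgraph_def)
qed

lemma rotate_to_head:
  assumes "v \<in> set us" obtains i q where "rotate i us = v # q"
proof -
  obtain xs ys where "us = xs @ v # ys" using assms by (meson split_list)
  then have "rotate (length xs) us = v # (ys @ xs)" by (simp add: rotate_append)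
  then show ?thesis using that by blast
qed

lemma connected_cycle:
  assumes wf: "wgraph G" and us: "set us = verts G" "edges G = cycle_edges us"
  shows "connected_wgraph G"
  unfolding connected_wgraph_def
proof (intro conjI ballI wf)
  fix u v assume uv: "u \<in> verts G" "v \<in> verts G"
  obtain i q where r: "rotate i us = u # q" using rotate_to_head uv(1) us(1) by metis
  then have e: "edges G = path_edges (u # q @ [u])"
    using us(2) cycle_edges_rotate cycle_edges_Cons by metis
  have "\<forall>x\<in>#path_edges (u # q). x \<in># edges G"
    unfolding e using path_edges_snoc[of "u # q" u] by simp
  moreover have "v \<in> set (u # q)" using uv(2) us(1) r by (metis set_rotate)
  ultimately show "(u, v) \<in> (adjacency G)\<^sup>*"
    using path_reach[of "u # q" "edges G" v] unfolding adjacency_def by simp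
qed

lemma decomp_circle:
  assumes dc: "decomp G K p"
    and K: "nodes K = {v}" "darts K = {a, b}" "a \<noteq> b" "base K a = v" "base K b = v" "mate K a = b" "mate K b = a"
  shows "distinct (v # p a) \<and> set (v # p a) = verts G \<and> edges G = cycle_edges (v # p a)"
proof -
  note D = decompD[OF dc]
  have aK: "a \<in> darts K" and bK: "b \<in> darts K" and vK: "v \<in> nodes K" using K by auto
  have pb: "p b = rev (p a)" using D(6)[OF aK] K by simp
  have "strand K p b = path_edges (rev (v # p a @ [v]))" using K pb by (simp add: strand_def)
  then have "strand K p b = path_edges (v # p a @ [v])" by (simp only: path_edges_rev)
  moreover have "strand K p a = path_edges (v # p a @ [v])" using K by (simp add: strand_def)
  ultimately have "edges G + edges G = path_edges (v # p a @ [v]) + path_edges (v # p a @ [v])"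
    unfolding D(12)[symmetric] using K by simp
  then have "edges G = cycle_edges (v # p a)" unfolding cycle_edges_Cons by (rule double_mset_cancel)
  moreover have "set (v # p a) = verts G" using D(2) K pb by auto
  moreover have "distinct (v # p a)" using D(3)[OF aK] D(4)[OF aK] vK by auto
  ultimately show ?thesis by blast
qed

lemma eff_cycle_map:
  assumes "distinct us" "edges G = cycle_edges us" "us \<noteq> []"
  shows "map (eff_weight G) us = eff_cycle (map (weight G) us)"
proof (cases "length us = 1")
  case True
  then obtain u where "us = [u]" by (auto simp: length_Suc_conv)
  then show ?thesis using assms(2) by (simp add: eff_cycle_def eff_weight_def cycle_edges_Cons)
next
  case False
  have "eff_weight G u = weight G u" if u: "u \<in> set us" for u
  proof -
    obtain i q where r: "rotate i us = u # q" using rotate_to_head[OF u] .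
    have d: "distinct (u # q)" using assms(1) r by (metis distinct_rotate)
    have ne: "q \<noteq> []" using False r by (metis length_rotate length_Cons list.size(3) One_nat_def)
    have "edges G = path_edges (u # q @ [u])"
      using assms(2) r cycle_edges_rotate cycle_edges_Cons by metis
    also have "\<dots> = add_mset (Upair (last q) u) (path_edges (u # q))"
      using path_edges_snoc[of "u # q" u] ne by simp
    finally have "count (edges G) (Upair u u) = 0"
      using distinct_no_loop[OF d, of u] d ne by auto
    then show ?thesis by (simp add: eff_weight_def)
  qed
  then show ?thesis using False by (simp add: eff_cycle_def)
qed

text \<open>All degrees are 2 and there are as many edges as vertices, which excludes branching
  nodes and chains. The remaining single loop may start at another vertex and run in the opposite
  direction, hence only equivalence of values.\<close>

lemma circular_normal_form:
  assumes G: "G \<cong>\<^sub>w circular_wgraph ws" and ws: "ws \<noteq> []"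
  shows "connected_wgraph G \<and> (\<exists>K. step\<^sup>*\<^sup>* (dg_of G) K \<and> wf_dart_graph K \<and>
     circle_type K (cycle_value (eff_cycle ws)))"
proof -
  have wf: "wgraph G" using G by (simp add: wgraph_iso_def)
  obtain us where us: "distinct us" "set us = verts G" "edges G = cycle_edges us" "map (weight G) us = ws"
    using circular_wgraph_list[OF G] by blast
  have conn: "connected_wgraph G" by (rule connected_cycle[OF wf us(2,3)])
  have usne: "us \<noteq> []" using ws us(4) by auto
  have eff_us: "map (eff_weight G) us = eff_cycle ws" using eff_cycle_map[OF us(1,3) usne] us(4) by simp
  obtain K p where K: "step\<^sup>*\<^sup>* (dg_of G) K" "decomp G K p" "\<forall>v a b. \<not> can_merge K v a b"
    using decomp_exists_irreducible[OF decomp_dg_of[OF wf]] by blast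
  note D = decompD[OF K(2)]
  have "connected_dart_graph K"
    using connected_steps_iff[OF K(1) wf_dg_of[OF wf]] connected_dg_of[OF conn] by blast
  from D(1) this K(3) show ?thesis
  proof (cases rule: irreducible_cases)
    case branched
    obtain v where v: "v \<in> nodes K" using wfD(3)[OF D(1)] by blast
    then have "v \<in> set us" using D(2) us(2) by auto
    then have "vertex_degree G v = 2"
      using cycle_degree[OF us(1)] unfolding vertex_degree_def us(3) by simp
    then show ?thesis using D(11)[OF v] branched v vertex_degree_total_ends[OF wf, of v] by auto
  next
    case (chain v a b)
    obtain vs where vs: "seg_list G vs" "set vs = verts G" "edges G = path_edges vs"
      using decomp_chain[OF wf K(2) chain] by blast
    have "distinct vs" "vs \<noteq> []" using vs(1) by (simp_all add: seg_list_def)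
    then have "length vs = length us" using us(1,2) vs(2) distinct_card by metis
    \<comment> \<open>A path has one edge fewer than vertices, a cycle equally many.\<close>
    moreover have "length vs - 1 = length us"
      using vs(3) us(3) size_path_edges[of vs] size_cycle_edges[of us] by simp
    ultimately show ?thesis using usne by (cases us) auto
  next
    case (circle v a b)
    have c: "distinct (v # p a)" "set (v # p a) = verts G" "edges G = cycle_edges (v # p a)"
      using decomp_circle[OF K(2) circle] by auto
    have aK: "a \<in> darts K" and vK: "v \<in> nodes K" using circle by auto
    have "v \<in> set us" using us(2) c(2) by auto
    then obtain i q where r: "rotate i us = v # q" using rotate_to_head by metis
    have q: "distinct (v # q)" "set (v # q) = verts G" "cycle_edges (v # q) = edges G"
      using us r by (metis distinct_rotate, metis set_rotate, metis cycle_edges_rotate)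
    have "set (p a) = set q" using c(1,2) q(1,2) by (metis distinct.simps(2) insert_ident list.simps(15))
    then have "q = p a \<or> q = rev (p a)"
      using cycle_edges_unique[of v "p a" q] c q by simp
    then have pa: "p a = q \<or> p a = rev q" by auto
    have ct: "circle_type K (cycle_value (map (eff_weight G) (v # p a)))"
    proof (rule circle_typeI[OF circle])
      show "twist (eff K v) * lab K a = cycle_value (map (eff_weight G) (v # p a))"
        using D(5)[OF aK] D(10)[OF vK] by (simp add: cycle_value_Cons_chain del: cycle_value.simps)
    qed
    have c1: "conjugate (cycle_value (map (eff_weight G) (v # q))) (cycle_value (eff_cycle ws))"
      using conjugate_sym[OF conjugate_cycle_value_rotate[of "eff_cycle ws" i]] r
      unfolding eff_us[symmetric] by (metis rotate_map)
    have "circle_equiv (cycle_value (map (eff_weight G) (v # p a))) (cycle_value (eff_cycle ws))"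
    proof (rule disjE[OF pa])
      assume "p a = q"
      then show ?thesis using c1 unfolding circle_equiv_def by simp
    next
      assume pr: "p a = rev q"
      have "rev (map (eff_weight G) (v # p a)) = map (eff_weight G) (q @ [v])"
        unfolding pr by (simp add: rev_map)
      also have "\<dots> = rotate 1 (map (eff_weight G) (v # q))" by simp
      finally have e: "rev (map (eff_weight G) (v # p a)) = rotate 1 (map (eff_weight G) (v # q))" .
      have "conjugate (reversal (cycle_value (map (eff_weight G) (v # p a)))) (cycle_value (rotate 1 (map (eff_weight G) (v # q))))"
        unfolding e[symmetric] by (rule conjugate_reversal_cycle_value)
      then have "conjugate (reversal (cycle_value (map (eff_weight G) (v # p a)))) (cycle_value (eff_cycle ws))"
        using conjugate_sym[OF conjugate_cycle_value_rotate] c1 conjugate_trans by metis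
      then show ?thesis unfolding circle_equiv_def by blast
    qed
    then have "circle_type K (cycle_value (eff_cycle ws))" using ct circle_type_equiv by blast
    then show ?thesis using K(1) D(1) conn by blast
  qed
qed

section \<open>The main theorem\<close>

text \<open>The clauses on chains and cycles hold vacuously: such graphs have two darts, while
  anything equivalent to \<open>K0\<close> has at least three.\<close>

lemma normal_form_property_sim:
  fixes K0 :: "('a, 'c) dart_graph"
  assumes wf: "wf_dart_graph K0" and br: "\<forall>v\<in>nodes K0. 3 \<le> card (darts_at K0 v)"
    and irr: "\<And>Y. \<not> step K0 Y"
  shows "normal_form_property (\<lambda>K :: ('b, 'd) dart_graph. sim K0 K)"
proof -
  have br': "3 \<le> card (darts K)" if sm: "sim K0 K" for K :: "('b, 'd) dart_graph"
  proof -
    obtain \<phi> \<psi> k where s: "sim_via K0 K \<phi> \<psi> k" using sm unfolding sim_def by blast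
    obtain v where v: "v \<in> nodes K0" using wfD(3)[OF wf] by blast
    have "3 \<le> card (darts_at K0 v)" using br v by blast
    also have "\<dots> \<le> card (darts K0)"
      unfolding darts_at_def using wfD(2)[OF wf] by (intro card_mono) auto
    also have "\<dots> = card (darts K)" using sim_viaD(2)[OF s] by (rule bij_betw_same_card)
    finally show ?thesis .
  qed
  have two: "card {x, y} \<le> 2" for x y :: 'd by (simp add: card_insert_if)
  show ?thesis
  proof
    fix K K' :: "('b, 'd) dart_graph"
    show "sim K0 K \<Longrightarrow> sim K K' \<Longrightarrow> sim K0 K'" using sim_trans[OF wf] .
    show "sim K0 K'" if "chain_type K h" "sim K0 K" for h
      using that br'[of K] two unfolding chain_type_def by fastforce
    show "sim K0 K'" if "circle_type K P" "sim K0 K" for P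
      using that br'[of K] two unfolding circle_type_def by fastforce
    show "\<not> step K K'" if "wf_dart_graph K" "sim K0 K"
      using sim_step[OF that(1) sim_sym[OF wf that(2)]] irr by blast
  qed
qed

lemma normal_form_property_chain:
  "normal_form_property (\<lambda>K. chain_type K h)"
proof
  show "chain_type K h \<Longrightarrow> sim K K' \<Longrightarrow> chain_type K' h" if "wf_dart_graph K" for K K'
    using sim_chain_type[OF that] .
  show "chain_type K' h" if "chain_type K h'" "chain_type K' h'" "chain_type K h" for K K' h'
    using chain_type_equiv[OF that(2) chain_type_unique[OF that(1,3)]] .
  show "chain_type K' h" if "circle_type K P" "chain_type K h" for K K' P
    using that unfolding chain_type_def circle_type_def by (auto simp: doubleton_eq_iff)
qed (use step_special in blast)

lemma normal_form_property_circle: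
  "normal_form_property (\<lambda>K. circle_type K P)"
proof
  show "circle_type K P \<Longrightarrow> sim K K' \<Longrightarrow> circle_type K' P" if "wf_dart_graph K" for K K'
    using sim_circle_type[OF that] .
  show "circle_type K' P" if "wf_dart_graph K" "circle_type K P'" "circle_type K' P'" "circle_type K P" for K K' P'
    using circle_type_equiv[OF that(3) circle_type_unique[OF that(1,2,4)]] .
  show "circle_type K' P" if "chain_type K h" "circle_type K P" for K K' h
    using that unfolding chain_type_def circle_type_def by (auto simp: doubleton_eq_iff)
qed (use step_special in blast)

text \<open>The birational transformation lives on natural numbers and the target graph on its own
  vertex type, so the predicate appears twice and gauge equivalence carries it from one type to the
  other.\<close>

lemma normal_form_transfer:
  fixes G :: "'a wgraph" and G' :: "'b wgraph"
    and Q1 :: "(nat, nat \<times> nat option \<times> nat) dart_graph \<Rightarrow> bool"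
    and Q2 :: "('b, 'b \<times> 'b option \<times> nat) dart_graph \<Rightarrow> bool"
  assumes be: "birationally_equivalent G G'" and conn: "connected_wgraph G"
    and st: "step\<^sup>*\<^sup>* (dg_of G) K"
    and Q1: "normal_form_property Q1" and Q2: "normal_form_property Q2"
    and KQ: "\<And>K1. sim K K1 \<Longrightarrow> Q1 K1"
    and QQ: "\<And>K1 K2. wf_dart_graph K1 \<Longrightarrow> Q1 K1 \<Longrightarrow> sim K1 K2 \<Longrightarrow> Q2 K2"
    and st': "step\<^sup>*\<^sup>* (dg_of G') K'" and irr: "\<And>Y. \<not> step K' Y"
  shows "Q2 K'"
proof -
  interpret n1: normal_form_property Q1 by (rule Q1)
  interpret n2: normal_form_property Q2 by (rule Q2)
  obtain H H' :: "nat wgraph" where H: "G \<cong>\<^sub>w H" "birational_step\<^sup>*\<^sup>* H H'" "H' \<cong>\<^sub>w G'"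
    using be unfolding birationally_equivalent_def by blast
  have wf: "wgraph G" "wgraph H" "wgraph H'" "wgraph G'" using H unfolding wgraph_iso_def by auto
  note s = sim_dg_of_iso[OF H(1)]
  obtain K1 where "step\<^sup>*\<^sup>* (dg_of H) K1" "sim K K1"
    using sim_steps[OF st wf_dg_of[OF wf(1)] s] by blast
  then have "n1.reaches (dg_of H)" using KQ unfolding n1.reaches_def by blast
  moreover have "connected_dart_graph (dg_of H)"
    using sim_connected[OF wf_dg_of[OF wf(1)] s connected_dg_of[OF conn]] .
  ultimately have r: "connected_dart_graph (dg_of H')" "n1.reaches (dg_of H')"
    using birational_steps_reaches[OF H(2) Q1 wf(2)] by blast+
  then obtain K2 where K2: "step\<^sup>*\<^sup>* (dg_of H') K2" "Q1 K2" unfolding n1.reaches_def by blast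
  note s' = sim_dg_of_iso[OF H(3)]
  have wfK2: "wf_dart_graph K2" using wf_steps[OF K2(1) wf_dg_of[OF wf(3)]] .
  obtain K3 where "step\<^sup>*\<^sup>* (dg_of G') K3" "sim K2 K3"
    using sim_steps[OF K2(1) wf_dg_of[OF wf(3)] s'] by blast
  then have "n2.reaches (dg_of G')" using QQ[OF wfK2 K2(2)] unfolding n2.reaches_def by blast
  moreover have "connected_dart_graph (dg_of G')"
    using sim_connected[OF wf_dg_of[OF wf(3)] s' r(1)] .
  ultimately have "n2.reaches K'" using n2.reaches_steps[OF st' wf_dg_of[OF wf(4)]] by blast
  then show ?thesis unfolding n2.reaches_def using irr by (metis converse_rtranclpE)
qed

lemma standard_non_circular_normal_form:
  assumes "standard_non_circular G"
  obtains (branched) K p where "step\<^sup>*\<^sup>* (dg_of G) K" "decomp G K p"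
      "\<forall>v\<in>nodes K. 3 \<le> card (darts_at K v)" "\<forall>d\<in>darts K. std_list (map (weight G) (p d))"
      "\<And>Y. \<not> step K Y"
  | (chain) K vs where "step\<^sup>*\<^sup>* (dg_of G) K" "wf_dart_graph K" "seg_list G vs" "set vs = verts G"
      "edges G = path_edges vs" "std_list (map (weight G) vs)"
      "chain_type K (chain_value (map (weight G) vs))"
proof -
  have conn: "connected_wgraph G" and nc: "\<not> is_circular G" and std: "\<forall>L\<in>segments G. standard_chain L"
    using assms unfolding standard_non_circular_def non_circular_def by auto
  have wf: "wgraph G" using conn by (simp add: connected_wgraph_def)
  obtain K p where K: "step\<^sup>*\<^sup>* (dg_of G) K" "decomp G K p" "\<forall>v a b. \<not> can_merge K v a b"
    using decomp_exists_irreducible[OF decomp_dg_of[OF wf]] by blast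
  note D = decompD[OF K(2)]
  have "connected_dart_graph K"
    using connected_steps_iff[OF K(1) wf_dg_of[OF wf]] connected_dg_of[OF conn] by blast
  from D(1) this K(3) show ?thesis
  proof (cases rule: irreducible_cases)
    case br: branched
    have s: "\<forall>d\<in>darts K. std_list (map (weight G) (p d))"
      using standard_strands[OF wf std K(2) br] by blast
    show ?thesis using branched[OF K(1,2) br s] branched_irreducible[OF K(2) br s] by blast
  next
    case ch: (chain v a b)
    obtain vs where vs: "seg_list G vs" "set vs = verts G" "edges G = path_edges vs"
        "chain_type K (chain_value (map (weight G) vs))"
      using decomp_chain[OF wf K(2) ch] by blast
    obtain L where "L \<in> segments G" "chain_order L vs" "weight L = weight G"
      using seg_list_segment[OF wf vs(1)] by blast
    then have "std_list (map (weight G) vs)" using std_list_of_chain std by metis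
    then show ?thesis using chain[OF K(1) D(1) vs(1-3) _ vs(4)] by blast
  next
    case (circle v a b)
    have c: "distinct (v # p a)" "set (v # p a) = verts G" "edges G = cycle_edges (v # p a)"
      using decomp_circle[OF K(2) circle] by auto
    have "G \<cong>\<^sub>w circular_wgraph (map (weight G) (v # p a))" by (rule circular_wgraph_iso[OF wf c])
    then show ?thesis using nc unfolding is_circular_def by blast
  qed
qed

lemma non_circular_case:
  fixes G :: "'a wgraph" and G' :: "'b wgraph"
  assumes be: "birationally_equivalent G G'" and G: "standard_non_circular G" and G': "standard_non_circular G'"
  shows "\<exists>\<Delta> \<Delta>'. segment_reversion\<^sup>*\<^sup>* G \<Delta> \<and> change_branching_weights \<Delta> \<Delta>' \<and> \<Delta>' \<cong>\<^sub>w G'"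
proof -
  have conn: "connected_wgraph G" using G unfolding standard_non_circular_def non_circular_def by simp
  have wf: "wgraph G" "wgraph G'"
    using G G' unfolding standard_non_circular_def non_circular_def connected_wgraph_def by simp_all
  \<comment> \<open>The number of darts of the normal form keeps chains and branched graphs
    apart.\<close>
  have dart_count: "card (darts K) = 2" if "chain_type K h" for K :: "('x, 'y) dart_graph" and h
    using that unfolding chain_type_def by auto
  have many: "3 \<le> card (darts K)" if wfK: "wf_dart_graph K" and br: "\<forall>v\<in>nodes K. 3 \<le> card (darts_at K v)"
    for K :: "('x, 'y) dart_graph"
  proof -
    obtain v where "v \<in> nodes K" using wfD(3)[OF wfK] by blast
    then have "3 \<le> card (darts_at K v)" using br by blast
    also have "\<dots> \<le> card (darts K)"
      unfolding darts_at_def using wfD(2)[OF wfK] by (intro card_mono) auto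
    finally show ?thesis .
  qed
  from G show ?thesis
  proof (cases rule: standard_non_circular_normal_form)
    case b: (branched K p)
    note wfK = decompD(1)[OF b(2)]
    note Q = normal_form_property_sim[OF wfK b(3) b(5)]
    have simK: "sim K K'" if "step\<^sup>*\<^sup>* (dg_of G') K'" "\<And>Y. \<not> step K' Y" for K'
      by (rule normal_form_transfer[OF be conn b(1) Q Q _ _ that]) (use sim_trans[OF wfK] in blast)+
    from G' show ?thesis
    proof (cases rule: standard_non_circular_normal_form)
      case b': (branched K' p')
      show ?thesis
        by (rule branched_reconstruction[OF wf b(2-4) b'(2,4) simK[OF b'(1,5)]])
    next
      case c': (chain K' vs')
      have "sim K K'" by (rule simK[OF c'(1)]) (use step_special c'(7) in blast)
      then have "card (darts K) = card (darts K')"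
        unfolding sim_def sim_via_def by (auto intro: bij_betw_same_card)
      then show ?thesis using many[OF wfK b(3)] dart_count[OF c'(7)] by simp
    qed
  next
    case c: (chain K vs)
    have ct: "chain_type K' (chain_value (map (weight G) vs))"
      if "step\<^sup>*\<^sup>* (dg_of G') K'" "\<And>Y. \<not> step K' Y" for K'
      by (rule normal_form_transfer[OF be conn c(1) normal_form_property_chain normal_form_property_chain _ _ that])
        (use sim_chain_type c(2,7) in blast)+
    from G' show ?thesis
    proof (cases rule: standard_non_circular_normal_form)
      case b': (branched K' p')
      show ?thesis
        using many[OF decompD(1)[OF b'(2)] b'(3)] dart_count[OF ct[OF b'(1,5)]] by simp
    next
      case c': (chain K' vs')
      have "chain_type K' (chain_value (map (weight G) vs))"
        by (rule ct[OF c'(1)]) (use step_special c'(7) in blast)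
      then have "chain_equiv (chain_value (map (weight G) vs)) (chain_value (map (weight G') vs'))"
        using chain_type_unique c'(7) by blast
      then show ?thesis using chain_reconstruction[OF wf c(3-6) c'(3-6)] by blast
    qed
  qed
qed

lemma std_cycle_of_standard_circular:
  assumes "standard_circular G"
  obtains W where "std_cycle W" "W \<noteq> []" "G \<cong>\<^sub>w circular_wgraph W"
proof -
  obtain W where W: "std_cycle W" "G \<cong>\<^sub>w circular_wgraph W"
    using assms unfolding standard_circular_def std_cycle_def by blast
  then have "W \<noteq> []" unfolding std_cycle_def by auto
  then show ?thesis using W that by blast
qed

lemma eff_cycle_rotate: "eff_cycle (rotate i W) = rotate i (eff_cycle W)"
proof (cases "length W = 1")
  case True
  then obtain w where "W = [w]" by (auto simp: length_Suc_conv)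
  then show ?thesis by (simp add: eff_cycle_def rotate_length01)
qed (simp add: eff_cycle_def)

lemma eff_cycle_rev: "rev (eff_cycle W) = eff_cycle (rev W)"
proof (cases "length W = 1")
  case True
  then obtain w where "W = [w]" by (auto simp: length_Suc_conv)
  then show ?thesis by (simp add: eff_cycle_def)
qed (simp add: eff_cycle_def)

text \<open>Reversing only the nonzero weights keeps a cycle standard. The split has to take all
  zeros to the left part, so in \<open>zeros l @ [0]\<close> the last weight joins them.\<close>

lemma std_cycle_reverse:
  assumes "std_cycle W"
  obtains m us where "W = zeros m @ us" "\<forall>w\<in>set us. w \<noteq> 0" "std_cycle (zeros m @ rev us)"
proof -
  consider (1) k us where "us \<noteq> []" "\<forall>w\<in>set us. w \<le> -2" "W = zeros (2 * k) @ us"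
    | (2) l w where "w \<le> 0" "W = zeros l @ [w]" | (3) k where "W = zeros (2 * k) @ [-1, -1]"
    using assms unfolding std_cycle_def by blast
  then show thesis
  proof cases
    case 1
    have "std_cycle (zeros (2 * k) @ rev us)" unfolding std_cycle_def
      using 1 by (intro disjI1 exI[of _ k] exI[of _ "rev us"]) simp
    then show thesis using that[of "2 * k" us] 1 by fastforce
  next
    case 2
    show thesis
    proof (cases "w = 0")
      case True
      then have "W = zeros (Suc l) @ []" using 2 by (simp add: replicate_append_same)
      then show thesis using that[of "Suc l" "[]"] assms by simp
    next
      case False
      then show thesis using that[of l "[w]"] 2 assms by simp
    qed
  next
    case 3
    then show thesis using that[of "2 * k" "[-1, -1]"] assms by simp
  qed
qed

lemma zeros_append_unique:
  assumes "zeros m @ us = zeros n @ vs" "\<forall>w\<in>set us. w \<noteq> 0" "\<forall>w\<in>set vs. w \<noteq> 0"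
  shows "m = n \<and> us = vs"
  using assms
proof (induction m arbitrary: n)
  case 0
  show ?case
  proof (cases n)
    case (Suc l)
    have "us = 0 # zeros l @ vs" using 0(1) Suc by simp
    then have "0 \<in> set us" by simp
    then show ?thesis using 0(2) by blast
  qed (use 0 in simp)
next
  case (Suc m)
  show ?case
  proof (cases n)
    case 0
    have "vs = 0 # zeros m @ us" using Suc(2) 0 by simp
    then have "0 \<in> set vs" by simp
    then show ?thesis using Suc(4) by blast
  next
    case (Suc l)
    then show ?thesis using Suc.IH[of l] Suc.prems by simp
  qed
qed

lemma circular_case:
  fixes G :: "'a wgraph" and G' :: "'b wgraph"
  assumes be: "birationally_equivalent G G'" and G: "standard_circular G" and G': "standard_circular G'"
  shows "\<exists>\<Delta> :: nat wgraph. cyclic_permutation G \<Delta> \<and> (\<Delta> \<cong>\<^sub>w G' \<or> circular_reversion \<Delta> G')"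
proof -
  obtain W where W: "std_cycle W" "W \<noteq> []" "G \<cong>\<^sub>w circular_wgraph W"
    using std_cycle_of_standard_circular[OF G] .
  obtain W' where W': "std_cycle W'" "W' \<noteq> []" "G' \<cong>\<^sub>w circular_wgraph W'"
    using std_cycle_of_standard_circular[OF G'] .
  obtain K where conn: "connected_wgraph G" and K: "step\<^sup>*\<^sup>* (dg_of G) K" "wf_dart_graph K"
      "circle_type K (cycle_value (eff_cycle W))"
    using circular_normal_form[OF W(3,2)] by blast
  obtain K' where K': "step\<^sup>*\<^sup>* (dg_of G') K'" "wf_dart_graph K'" "circle_type K' (cycle_value (eff_cycle W'))"
    using circular_normal_form[OF W'(3,2)] by blast
  have irr: "\<not> step K' Y" for Y using step_special K'(3) by blast
  have "circle_type K' (cycle_value (eff_cycle W))"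
    by (rule normal_form_transfer[OF be conn K(1) normal_form_property_circle normal_form_property_circle _ _ K'(1) irr])
      (use sim_circle_type K(2,3) in blast)+
  then have "circle_equiv (cycle_value (eff_cycle W)) (cycle_value (eff_cycle W'))"
    using circle_type_unique K'(2,3) by blast
  then consider "conjugate (cycle_value (eff_cycle W)) (cycle_value (eff_cycle W'))"
    | "conjugate (reversal (cycle_value (eff_cycle W))) (cycle_value (eff_cycle W'))"
    unfolding circle_equiv_def by blast
  then show ?thesis
  proof cases
    case 1
    obtain m us i where s: "\<forall>w\<in>set us. w \<noteq> 0" "W = zeros m @ us" "W' = zeros m @ rotate i us"
      using conjugate_std_cycles[OF W(1) W'(1) 1] unfolding same_cycle_def by blast
    have "cyclic_permutation G (circular_wgraph W')"
      unfolding cyclic_permutation_def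
      using s W(3) wgraph_iso_refl[OF wgraph_circular[OF W'(2)]] by metis
    then show ?thesis using wgraph_iso_sym[OF W'(3)] by blast
  next
    case 2
    obtain m us where us: "W = zeros m @ us" "\<forall>w\<in>set us. w \<noteq> 0" "std_cycle (zeros m @ rev us)"
      using std_cycle_reverse[OF W(1)] .
    \<comment> \<open>The reversed cycle is rotated back into standard form, so that it can be
      compared with W' like any other standard cycle.\<close>
    have "rotate (length us) (rev W) = zeros m @ rev us"
      using rotate_append[of "rev us" "zeros m"] us(1) by simp
    then have "conjugate (cycle_value (eff_cycle (rev W))) (cycle_value (eff_cycle (zeros m @ rev us)))"
      using conjugate_cycle_value_rotate[of "eff_cycle (rev W)" "length us"] by (simp add: eff_cycle_rotate[symmetric])
    moreover have "conjugate (reversal (cycle_value (eff_cycle W))) (cycle_value (eff_cycle (rev W)))"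
      using conjugate_reversal_cycle_value[of "eff_cycle W"] by (simp add: eff_cycle_rev)
    ultimately have "conjugate (cycle_value (eff_cycle (zeros m @ rev us))) (cycle_value (eff_cycle W'))"
      using 2 conjugate_sym conjugate_trans by metis
    then obtain m' us' i where s: "\<forall>w\<in>set us'. w \<noteq> 0" "zeros m @ rev us = zeros m' @ us'"
        "W' = zeros m' @ rotate i us'"
      using conjugate_std_cycles[OF us(3) W'(1)] unfolding same_cycle_def by blast
    have "m = m' \<and> rev us = us'" using zeros_append_unique[OF s(2) _ s(1)] us(2) by simp
    \<comment> \<open>The rotation found acts after the reversal; exchanging the two puts the cyclic
      permutation first and the reversion last.\<close>
    moreover obtain j where "rotate i (rev us) = rev (rotate j us)" using rotate_rev by blast
    ultimately have W'_eq: "W' = zeros m @ rev (rotate j us)" using s(3) by simp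
    let ?\<Delta> = "circular_wgraph (zeros m @ rotate j us)"
    have "zeros m @ rotate j us \<noteq> []" using W(2) us(1) by simp
    then have "?\<Delta> \<cong>\<^sub>w ?\<Delta>" using wgraph_iso_refl wgraph_circular by blast
    moreover have "G \<cong>\<^sub>w circular_wgraph (zeros m @ us)" using W(3) us(1) by simp
    ultimately have "cyclic_permutation G ?\<Delta>"
      unfolding cyclic_permutation_def using us(2) by blast
    moreover have "G' \<cong>\<^sub>w circular_wgraph (zeros m @ rev (rotate j us))" using W'(3) W'_eq by simp
    moreover have "\<forall>w\<in>set (rotate j us). w \<noteq> 0" using us(2) by simp
    ultimately have "circular_reversion ?\<Delta> G'"
      unfolding circular_reversion_def using \<open>?\<Delta> \<cong>\<^sub>w ?\<Delta>\<close> by blast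
    then show ?thesis using \<open>cyclic_permutation G ?\<Delta>\<close> by blast
  qed
qed

theorem corollary3p33:
  fixes \<Gamma> :: "'a wgraph" and \<Gamma>' :: "'b wgraph"
  assumes "birationally_equivalent \<Gamma> \<Gamma>'"
  shows "(standard_non_circular \<Gamma> \<and> standard_non_circular \<Gamma>' \<longrightarrow>
            (\<exists>\<Delta> \<Delta>'. segment_reversion\<^sup>*\<^sup>* \<Gamma> \<Delta> \<and> change_branching_weights \<Delta> \<Delta>' \<and> \<Delta>' \<cong>\<^sub>w \<Gamma>'))
       \<and> (standard_circular \<Gamma> \<and> standard_circular \<Gamma>' \<longrightarrow>
            (\<exists>\<Delta> :: nat wgraph. cyclic_permutation \<Gamma> \<Delta> \<and>
               (\<Delta> \<cong>\<^sub>w \<Gamma>' \<or> circular_reversion \<Delta> \<Gamma>')))"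
  using non_circular_case[OF assms] circular_case[OF assms] by blast

end
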